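(* Let $d>0$ be a square free integer, $F=\mathbb{Q}(\sqrt{-d})\subset\mathbb{C}$, and let $p$ be a prime number which splits completely in $F/\mathbb{Q}$. Fix an isomorphism of fields $\mathbb{C}\simeq\overline{\mathbb{Q}}_p$, used to identify the two fields (so $F\subset\mathbb{Q}_p$), and let $\mathfrak{p}$ be the prime ideal of $\mathcal{O}_F$ above $p$ corresponding to the embedding $F\subset\mathbb{C}=\overline{\mathbb{Q}}_p$. Let $\theta=\frac{-1+\sqrt{-d}}{2}$ if $-d\equiv1\bmod4$ and $\theta=\sqrt{-d}$ otherwise. Consider the $\{\infty,p\}$-continued fraction expansion $\theta=[\delta_1;a_1;b_{10},\dots,b_{1l_1};\delta_2;a_2;b_{20},\dots,b_{2l_2};\dots]$, with associated $x_k$, $B_k$. Then: (i) The $\{\infty,p\}$-continued fraction expansion of $\theta$ is purely periodic, i.e. there is an integer $N\ge1$ with $\theta=x_1=x_{N+1}$. (ii) Let $N$ be the smallest positive integer such that $\theta=x_1=x_{N+1}$ and set $\begin{pmatrix} q_N & r_N \\ s_N & t_N \end{pmatrix}:=B_N^{-1}\in SL_2(\mathbb{Z}[1/p])$. Then $\epsilon=s_N\theta+t_N\in F$ is a fundamental norm one $p$-unit of $F$, i.e. a generator of the rank one free abelian group $\mathcal{O}_F[1/p]^1/({\rm tor})$, where $\mathcal{O}_F[1/p]^1=\{x\in\mathcal{O}_F[1/p]^\times:N_{F/\mathbb{Q}}(x)=1\}$. (iii) In (ii), $s:=p^Ns_N$ and $t:=p^Nt_N$ are relatively prime integers. Set $u:=p^N\epsilon=s\theta+t\in\mathcal{O}_F$.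 Then $u\mathcal{O}_F=\mathfrak{p}^{2N}$ as ideals. Furthermore, if there exists $x\in\mathcal{O}_F$ such that $u/x^2$ is a root of unity, then $\mathrm{ord}[\mathfrak{p}]=N$, and otherwise $\mathrm{ord}[\mathfrak{p}]=2N$, where $\mathrm{ord}[\mathfrak{p}]$ is the order of the ideal class $[\mathfrak{p}]$ in the ideal class group of $\mathcal{O}_F$.
   Context: $\mathfrak{h}=\{z\in\mathbb{C}:\Im z>0\}$; $\sqrt{-d}$ is the root in $\mathfrak{h}$; $\mathcal{O}_F$ is the ring of integers of $F$; $(\mathrm{tor})$ denotes the torsion subgroup. "$\mathfrak{p}$ corresponds to the embedding" means $\mathfrak{p}=\mathcal{O}_F\cap p\mathbb{Z}_p$. $\mathcal{D}=\{z\in\mathfrak{h}:|z|>1,\ -\frac12\le\Re z<\frac12\}\cup\{e^{i\alpha}:\alpha\in[\pi/2,2\pi/3]\}$. Matrices in $SL_2(\mathbb{Z}[1/p])$ act by linear fractional transformations. $\{\infty,p\}$-continued fraction expansion of $z\in\mathfrak{h}\cap\mathbb{Q}_p$. Set $x_1=z$. For $x_k$, $k\ge1$, do the following. Initialization: if $x_k\in\mathbb{Z}_p$, set $z_k=x_k$, $\delta_k=+1$ and $D_k=I$ (identity matrix); otherwise set $z_k=-1/x_k\in\mathbb{Z}_p$, $\delta_k=-1$ and $D_k=\begin{pmatrix} 0 & -1 \\ 1 & 0 \end{pmatrix}$. $p$-adic reduction: determine $a_k\in\{0,\dots,p^2-1\}$ such that $z_k-a_k\equiv0\bmod p^2$ (in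 $\mathbb{Z}_p$), and set $z_{k0}=(z_k-a_k)/p^2$, $P_k=\begin{pmatrix} 1/p & 0 \\ 0 & p \end{pmatrix}\begin{pmatrix} 1 & -a_k \\ 0 & 1 \end{pmatrix}$. $\infty$-adic reduction: for $j\ge0$, if $z_{kj}\in\mathcal{D}$, set $x_{k+1}=z_{kj}$ and go to the initialization step for $k+1$; if not, determine $b_{kj}\in\mathbb{Z}$ so that $-\frac12\le\Re(z_{kj}-b_{kj})<\frac12$ and set $z_{k,j+1}=-1/(z_{kj}-b_{kj})$. The $\infty$-adic reduction is asserted to end within a finite number of steps, so that the algorithm is well defined. If $b_{k0},\dots,b_{kl_k}$ are the integers so obtained, set $Q_k=\begin{pmatrix} 0 & -1 \\ 1 & -b_{kl_k} \end{pmatrix}\cdots\begin{pmatrix} 0 & -1 \\ 1 & -b_{k0} \end{pmatrix}$ (the empty product being $I$). Put $A_k^{-1}=Q_kP_kD_k$ and $B_k=A_1\cdots A_k\in SL_2(\mathbb{Z}[1/p])$, so that $x_{k+1}=A_k^{-1}x_k=B_k^{-1}x_1$. The expansion is written formally as $z=[\delta_1;a_1;b_{10},\dots,b_{1l_1};\delta_2;a_2;b_{20},\dots,b_{2l_2};\dots]$.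
   Formalization: For d=3 the ∞-adic reduction never ends already at the first step (it cannot reach e^{2πi/3}), so the expansion of θ does not exist; termination is proved for d≠3, and (i)–(iii) are claimed whenever the algorithm is well defined at θ. *)

theory Defs
  imports
    "HOL-Analysis.Analysis"
    "HOL-Algebra.Algebra"
    "HOL-Algebra.Algebraic_Closure_Type"
    "HOL-Computational_Algebra.Computational_Algebra"
    "HOL-Number_Theory.Cong"
    "Berlekamp_Zassenhaus.Finite_Field"
begin

hide_const (open) Divisibility.prime

section \<open>The $p$-adic numbers and their algebraic closure\<close>

text \<open>
  The prime is carried by a type \<open>'p\<close> of prime cardinality, $p = $ \<open>CARD('p)\<close>. Elements of
  $\mathbb{Z}_p = \varprojlim \mathbb{Z}/p^n$ are coherent sequences of least residues.
\<close>

lemma padic_prime_pos: "0 < int CARD('p::prime_card)"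
  using prime_gt_0_nat[OF prime_card[where 'a = 'p]] unfolding of_nat_0_less_iff .

typedef 'p padic_int =
  "{f :: nat \<Rightarrow> int. \<forall>n. f n \<in> {0..<int CARD('p::prime_card) ^ n} \<and>
                        f (Suc n) mod int CARD('p) ^ n = f n}"
  morphisms padic_residue Abs_padic_int
  by (rule exI[of _ "\<lambda>_. 0"]) (simp add: padic_prime_pos)

setup_lifting type_definition_padic_int

lemma padic_residue_intro:
  assumes "\<And>n. h (Suc n) mod int CARD('p::prime_card) ^ n = h n mod int CARD('p) ^ n"
  shows "h n mod int CARD('p) ^ n \<in> {0..<int CARD('p) ^ n} \<and>
           h (Suc n) mod int CARD('p) ^ Suc n mod int CARD('p) ^ n = h n mod int CARD('p) ^ n"
proof -
  have "h (Suc n) mod int CARD('p) ^ Suc n mod int CARD('p) ^ n = h (Suc n) mod int CARD('p) ^ n"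
    by (rule mod_mod_cancel) simp
  moreover have "0 < int CARD('p) ^ n"
    by (rule zero_less_power) (rule padic_prime_pos)
  ultimately show "h n mod int CARD('p) ^ n \<in> {0..<int CARD('p) ^ n} \<and>
      h (Suc n) mod int CARD('p) ^ Suc n mod int CARD('p) ^ n = h n mod int CARD('p) ^ n"
    using assms[of n] unfolding atLeastLessThan_iff
    by (simp only: pos_mod_sign pos_mod_bound simp_thms)
qed

lemma padic_coherent:
  assumes "f n \<in> {0..<int CARD('p::prime_card) ^ n} \<and> f (Suc n) mod int CARD('p) ^ n = f n"
  shows "f (Suc n) mod int CARD('p) ^ n = f n mod int CARD('p) ^ n"
  using assms by (metis mod_mod_trivial)

instantiation padic_int :: (prime_card) comm_ring_1
begin

lift_definition zero_padic_int :: "'a padic_int" is "\<lambda>_. 0"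
  by (simp add: padic_prime_pos)

lift_definition one_padic_int :: "'a padic_int" is "\<lambda>n. 1 mod int CARD('a) ^ n"
  by (rule padic_residue_intro) (rule refl)

lift_definition plus_padic_int :: "'a padic_int \<Rightarrow> 'a padic_int \<Rightarrow> 'a padic_int"
  is "\<lambda>f g n. (f n + g n) mod int CARD('a) ^ n"
  by (rule padic_residue_intro, rule mod_add_cong; rule padic_coherent; blast)

lift_definition times_padic_int :: "'a padic_int \<Rightarrow> 'a padic_int \<Rightarrow> 'a padic_int"
  is "\<lambda>f g n. (f n * g n) mod int CARD('a) ^ n"
  by (rule padic_residue_intro, rule mod_mult_cong; rule padic_coherent; blast)

lift_definition minus_padic_int :: "'a padic_int \<Rightarrow> 'a padic_int \<Rightarrow> 'a padic_int"
  is "\<lambda>f g n. (f n - g n) mod int CARD('a) ^ n"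
  by (rule padic_residue_intro, rule mod_diff_cong; rule padic_coherent; blast)

lift_definition uminus_padic_int :: "'a padic_int \<Rightarrow> 'a padic_int"
  is "\<lambda>f n. (- f n) mod int CARD('a) ^ n"
  by (rule padic_residue_intro, rule mod_minus_cong, rule padic_coherent, blast)

instance
proof
  fix a b c :: "'a padic_int"
  show "a * b * c = a * (b * c)"
    by transfer (simp add: mod_mult_left_eq mod_mult_right_eq mult.assoc)
  show "a * b = b * a"
    by transfer (simp add: mult.commute)
  show "1 * a = a"
    by transfer (simp add: mod_mult_left_eq fun_eq_iff)
  show "a + b + c = a + (b + c)"
    by transfer (simp add: mod_add_left_eq mod_add_right_eq add.assoc)
  show "a + b = b + a"
    by transfer (simp add: add.commute)
  show "0 + a = a"
    by transfer (simp add: fun_eq_iff)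
  show "- a + a = 0"
    by transfer (simp add: mod_add_left_eq)
  show "a - b = a + - b"
    by transfer (simp add: mod_add_right_eq)
  show "(a + b) * c = a * c + b * c"
    by transfer (simp add: mod_mult_left_eq mod_add_eq distrib_right)
  have "(\<lambda>_. 0 :: int) \<noteq> (\<lambda>n. 1 mod int CARD('a) ^ n)"
    using prime_gt_1_nat[OF prime_card[where 'a = 'a]]
    by (auto simp: fun_eq_iff intro!: exI[of _ 1])
  then show "(0 :: 'a padic_int) \<noteq> 1"
    by transfer
qed

end

lemma padic_residue_mod:
  assumes "\<forall>n. f n \<in> {0..<int CARD('p::prime_card) ^ n} \<and>
               f (Suc n) mod int CARD('p) ^ n = f n"
  shows "f (n + k) mod int CARD('p) ^ n = f n"
proof (induction k)
  case 0
  show ?case using assms by simp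
next
  case (Suc k)
  have "f (n + Suc k) mod int CARD('p) ^ n
          = f (Suc (n + k)) mod int CARD('p) ^ (n + k) mod int CARD('p) ^ n"
    by (subst mod_mod_cancel) (simp_all add: le_imp_power_dvd)
  also have "\<dots> = f (n + k) mod int CARD('p) ^ n"
    using assms by simp
  finally show ?case using Suc by simp
qed

lemma padic_residue_not_dvd:
  assumes "\<forall>n. f n \<in> {0..<int CARD('p::prime_card) ^ n} \<and>
               f (Suc n) mod int CARD('p) ^ n = f n"
      and "f n \<noteq> 0"
  shows "\<not> int CARD('p) ^ n dvd f (n + k)"
  using padic_residue_mod[OF assms(1), of n k] assms(2) by (auto simp: dvd_eq_mod_eq_0)

lemma power_dvd_mult_prime:
  fixes q :: int
  assumes "prime q" "q ^ (a + b) dvd x * y"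
  shows "q ^ a dvd x \<or> q ^ b dvd y"
proof (cases "x = 0 \<or> y = 0")
  case True
  then show ?thesis by auto
next
  case False
  have "a + b \<le> multiplicity q (x * y)"
    using assms False by (subst power_dvd_iff_le_multiplicity[symmetric])
      (auto simp: prime_elem_not_unit prime_imp_prime_elem)
  then have "a + b \<le> multiplicity q x + multiplicity q y"
    using assms False by (subst (asm) prime_elem_multiplicity_mult_distrib)
      (auto intro: prime_imp_prime_elem)
  then have "a \<le> multiplicity q x \<or> b \<le> multiplicity q y" by linarith
  then show ?thesis by (auto intro: multiplicity_dvd')
qed

instance padic_int :: (prime_card) idom
proof
  fix a b :: "'a padic_int"
  assume "a \<noteq> 0" "b \<noteq> 0"
  then show "a * b \<noteq> 0"
  proof transfer
    fix f g :: "nat \<Rightarrow> int"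
    assume f: "\<forall>n. f n \<in> {0..<int CARD('a) ^ n} \<and> f (Suc n) mod int CARD('a) ^ n = f n"
       and g: "\<forall>n. g n \<in> {0..<int CARD('a) ^ n} \<and> g (Suc n) mod int CARD('a) ^ n = g n"
       and "f \<noteq> (\<lambda>_. 0)" "g \<noteq> (\<lambda>_. 0)"
    then obtain m n where mn: "f m \<noteq> 0" "g n \<noteq> 0" by (auto simp: fun_eq_iff)
    have "\<not> int CARD('a) ^ m dvd f (m + n)" "\<not> int CARD('a) ^ n dvd g (n + m)"
      using padic_residue_not_dvd[OF f mn(1)] padic_residue_not_dvd[OF g mn(2)] by auto
    then have "\<not> int CARD('a) ^ (m + n) dvd f (m + n) * g (m + n)"
      using power_dvd_mult_prime[OF prime_card_int[where 'a = 'a], of m n]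
      by (auto simp: add.commute)
    then show "(\<lambda>n. f n * g n mod int CARD('a) ^ n) \<noteq> (\<lambda>_. 0)"
      by (auto simp: fun_eq_iff dvd_eq_mod_eq_0)
  qed
qed

type_synonym 'p padic = "'p padic_int fract"

text \<open>$\mathbb{Z}_p$ as a subset of $\mathbb{C}$, through an identification
  \<open>\<iota>\<close> of $\mathbb{C}$ with $\overline{\mathbb{Q}}_p$.\<close>

definition Zp_in :: "(complex \<Rightarrow> 'p::prime_card padic alg_closure) \<Rightarrow> complex set" where
  "Zp_in \<iota> = {z. \<exists>y :: 'p padic_int. \<iota> z = to_ac (Fract y 1)}"


section \<open>The continued fraction algorithm\<close>

definition fund_domain :: "complex set" where
  "fund_domain =
     {z. Im z > 0 \<and> cmod z > 1 \<and> - 1 / 2 \<le> Re z \<and> Re z < 1 / 2} \<union>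
     {exp (\<i> * of_real \<alpha>) |\<alpha>. \<alpha> \<in> {pi / 2..2 * pi / 3}}"

definition mat2 :: "rat \<Rightarrow> rat \<Rightarrow> rat \<Rightarrow> rat \<Rightarrow> rat ^ 2 ^ 2" where
  "mat2 a b c d = vector [vector [a, b], vector [c, d]]"

definition SL2_Z_inv :: "nat \<Rightarrow> (rat ^ 2 ^ 2) set" where
  "SL2_Z_inv p = {M. det M = 1 \<and> (\<forall>i j. \<exists>(a :: int) n. M $ i $ j = of_int a / of_nat p ^ n)}"

text \<open>In what follows \<open>x\<close> stands for $x_k$.\<close>

definition cf_delta :: "(complex \<Rightarrow> 'p::prime_card padic alg_closure) \<Rightarrow> complex \<Rightarrow> int" where
  "cf_delta \<iota> x = (if x \<in> Zp_in \<iota> then 1 else - 1)"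

definition cf_z :: "(complex \<Rightarrow> 'p::prime_card padic alg_closure) \<Rightarrow> complex \<Rightarrow> complex" where
  "cf_z \<iota> x = (if cf_delta \<iota> x = 1 then x else - 1 / x)"

definition cf_D :: "(complex \<Rightarrow> 'p::prime_card padic alg_closure) \<Rightarrow> complex \<Rightarrow> rat ^ 2 ^ 2" where
  "cf_D \<iota> x = (if cf_delta \<iota> x = 1 then mat 1 else mat2 0 (- 1) 1 0)"

definition cf_a :: "(complex \<Rightarrow> 'p::prime_card padic alg_closure) \<Rightarrow> complex \<Rightarrow> int" where
  "cf_a \<iota> x = (THE a. a \<in> {0..<int CARD('p) ^ 2} \<and>
                       (\<exists>y \<in> Zp_in \<iota>. cf_z \<iota> x - of_int a = of_nat CARD('p) ^ 2 * y))"

definition cf_z0 :: "(complex \<Rightarrow> 'p::prime_card padic alg_closure) \<Rightarrow> complex \<Rightarrow> complex" where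
  "cf_z0 \<iota> x = (cf_z \<iota> x - of_int (cf_a \<iota> x)) / of_nat CARD('p) ^ 2"

definition cf_P :: "(complex \<Rightarrow> 'p::prime_card padic alg_closure) \<Rightarrow> complex \<Rightarrow> rat ^ 2 ^ 2" where
  "cf_P \<iota> x = mat2 (1 / of_nat CARD('p)) 0 0 (of_nat CARD('p)) **
               mat2 1 (- of_int (cf_a \<iota> x)) 0 1"

text \<open>The $\infty$-adic reduction, started at \<open>w\<close> and continued without regard to the stopping
  condition: \<open>inf_z w j\<close> is $z_{kj}$ and \<open>inf_b w j\<close> is $b_{kj}$ for \<open>w\<close> $= z_{k0}$. The integer
  $b$ with $-\frac12 \le \Re(z - b) < \frac12$ is $\lfloor \Re z + \frac12 \rfloor$.\<close>

primrec inf_z :: "complex \<Rightarrow> nat \<Rightarrow> complex" where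
  "inf_z w 0 = w"
| "inf_z w (Suc j) = - 1 / (inf_z w j - of_int \<lfloor>Re (inf_z w j) + 1 / 2\<rfloor>)"

definition inf_b :: "complex \<Rightarrow> nat \<Rightarrow> int" where
  "inf_b w j = \<lfloor>Re (inf_z w j) + 1 / 2\<rfloor>"

text \<open>\<open>inf_len w\<close> is the number $l_k + 1$ of integers $b_{kj}$ (possibly \<open>0\<close>); it is meaningful
  only if the reduction of \<open>w\<close> ends.\<close>

definition inf_ends :: "complex \<Rightarrow> bool" where
  "inf_ends w \<longleftrightarrow> (\<exists>j. inf_z w j \<in> fund_domain)"

definition inf_len :: "complex \<Rightarrow> nat" where
  "inf_len w = (LEAST j. inf_z w j \<in> fund_domain)"

primrec inf_Q :: "complex \<Rightarrow> nat \<Rightarrow> rat ^ 2 ^ 2" where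
  "inf_Q w 0 = mat 1"
| "inf_Q w (Suc j) = mat2 0 (- 1) 1 (- of_int (inf_b w j)) ** inf_Q w j"

definition cf_Q :: "(complex \<Rightarrow> 'p::prime_card padic alg_closure) \<Rightarrow> complex \<Rightarrow> rat ^ 2 ^ 2" where
  "cf_Q \<iota> x = inf_Q (cf_z0 \<iota> x) (inf_len (cf_z0 \<iota> x))"

definition cf_next :: "(complex \<Rightarrow> 'p::prime_card padic alg_closure) \<Rightarrow> complex \<Rightarrow> complex" where
  "cf_next \<iota> x = inf_z (cf_z0 \<iota> x) (inf_len (cf_z0 \<iota> x))"

text \<open>\<open>cf_x \<iota> z k\<close> is $x_k$, for \<open>k \<ge> 1\<close>.\<close>

definition cf_x :: "(complex \<Rightarrow> 'p::prime_card padic alg_closure) \<Rightarrow> complex \<Rightarrow> nat \<Rightarrow> complex" where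
  "cf_x \<iota> z k = (cf_next \<iota> ^^ (k - 1)) z"

definition cf_A :: "(complex \<Rightarrow> 'p::prime_card padic alg_closure) \<Rightarrow> complex \<Rightarrow> nat \<Rightarrow> rat ^ 2 ^ 2" where
  "cf_A \<iota> z k = (let x = cf_x \<iota> z k in matrix_inv (cf_Q \<iota> x ** cf_P \<iota> x ** cf_D \<iota> x))"

primrec cf_B :: "(complex \<Rightarrow> 'p::prime_card padic alg_closure) \<Rightarrow> complex \<Rightarrow> nat \<Rightarrow> rat ^ 2 ^ 2" where
  "cf_B \<iota> z 0 = mat 1"
| "cf_B \<iota> z (Suc k) = cf_B \<iota> z k ** cf_A \<iota> z (Suc k)"

text \<open>The algorithm is well defined at \<open>z\<close>: every $\infty$-adic reduction ends. This fails for
  $z = e^{2\pi i/3}$: a reduction that reaches an $SL_2(\mathbb{Z})$-translate of $z$ outside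
  \<open>fund_domain\<close> gets stuck at $e^{\pi i/3}$, since $-1/(e^{\pi i/3} - 1) = e^{\pi i/3}$.\<close>

definition cf_well_defined :: "(complex \<Rightarrow> 'p::prime_card padic alg_closure) \<Rightarrow> complex \<Rightarrow> bool" where
  "cf_well_defined \<iota> z \<longleftrightarrow> (\<forall>k\<ge>1. inf_ends (cf_z0 \<iota> (cf_x \<iota> z k)))"


section \<open>Imaginary quadratic fields\<close>

definition sqrt_neg :: "int \<Rightarrow> complex" where
  "sqrt_neg d = \<i> * of_real (sqrt (of_int d))"

definition quad_field :: "int \<Rightarrow> complex set" where
  "quad_field d = {of_rat a + of_rat b * sqrt_neg d |a b. True}"

definition quad_integers :: "int \<Rightarrow> complex set" where
  "quad_integers d = {x \<in> quad_field d. algebraic_int x}"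

definition quad_integers_inv :: "int \<Rightarrow> nat \<Rightarrow> complex set" where
  "quad_integers_inv d p = {x / of_nat p ^ n |x n. x \<in> quad_integers d}"

definition complex_ring :: "complex set \<Rightarrow> complex ring" where
  "complex_ring S = ring_of_type_algebra\<lparr>carrier := S\<rparr>"

abbreviation quad_ring :: "int \<Rightarrow> complex ring" where
  "quad_ring d \<equiv> complex_ring (quad_integers d)"

text \<open>The nontrivial automorphism of an imaginary quadratic field is complex conjugation.\<close>

definition quad_norm :: "complex \<Rightarrow> complex" where
  "quad_norm x = x * cnj x"

text \<open>In degree two, splitting completely means being a product of two distinct primes.\<close>

definition splits_completely :: "nat \<Rightarrow> int \<Rightarrow> bool" where
  "splits_completely p d \<longleftrightarrow>
     (\<exists>P Q. primeideal P (quad_ring d) \<and> primeideal Q (quad_ring d) \<and> P \<noteq> Q \<and>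
        PIdl\<^bsub>quad_ring d\<^esub> (of_nat p) = ideal_prod (quad_ring d) P Q)"

text \<open>$\mathcal{O}_F \cap p\mathbb{Z}_p$\<close>

definition prime_above ::
  "(complex \<Rightarrow> 'p::prime_card padic alg_closure) \<Rightarrow> int \<Rightarrow> complex set" where
  "prime_above \<iota> d = {x \<in> quad_integers d. \<exists>y \<in> Zp_in \<iota>. x = of_nat CARD('p) * y}"

definition norm_one_group :: "int \<Rightarrow> nat \<Rightarrow> complex monoid" where
  "norm_one_group d p =
     units_of (complex_ring (quad_integers_inv d p))
       \<lparr>carrier := {x \<in> Units (complex_ring (quad_integers_inv d p)). quad_norm x = 1}\<rparr>"

definition torsion_subgroup :: "('a, 'b) monoid_scheme \<Rightarrow> 'a set" where
  "torsion_subgroup G = {x \<in> carrier G. \<exists>n::nat. n > 0 \<and> x [^]\<^bsub>G\<^esub> n = \<one>\<^bsub>G\<^esub>}"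

text \<open>The quotient by the torsion subgroup is free abelian of rank one, generated by the class
  of \<open>\<epsilon>\<close>.\<close>

definition fundamental_norm_one_unit :: "int \<Rightarrow> nat \<Rightarrow> complex \<Rightarrow> bool" where
  "fundamental_norm_one_unit d p \<epsilon> \<longleftrightarrow>
     (let G = norm_one_group d p; T = torsion_subgroup G in
        \<epsilon> \<in> carrier G \<and>
        G Mod T \<cong> integer_group \<and>
        generate (G Mod T) {T #>\<^bsub>G\<^esub> \<epsilon>} = carrier (G Mod T))"

definition fractional_ideal :: "int \<Rightarrow> complex set \<Rightarrow> bool" where
  "fractional_ideal d J \<longleftrightarrow>
     J \<subseteq> quad_field d \<and> 0 \<in> J \<and> J \<noteq> {0} \<and>
     (\<forall>x\<in>J. \<forall>y\<in>J. x + y \<in> J) \<and> (\<forall>a\<in>quad_integers d. \<forall>x\<in>J. a * x \<in> J) \<and>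
     (\<exists>c\<in>quad_integers d. c \<noteq> 0 \<and> (\<forall>x\<in>J. c * x \<in> quad_integers d))"

text \<open>The product of fractional ideals consists of the sums of products of their elements, computed
  in the field.\<close>

definition fractional_ideal_group :: "int \<Rightarrow> complex set monoid" where
  "fractional_ideal_group d =
     \<lparr>carrier = {J. fractional_ideal d J},
      mult = ideal_prod (complex_ring (quad_field d)),
      one = quad_integers d\<rparr>"

definition principal_fractional_ideals :: "int \<Rightarrow> complex set set" where
  "principal_fractional_ideals d = {(*) x ` quad_integers d |x. x \<in> quad_field d \<and> x \<noteq> 0}"

definition class_group :: "int \<Rightarrow> complex set set monoid" where
  "class_group d = fractional_ideal_group d Mod principal_fractional_ideals d"

definition ideal_class :: "int \<Rightarrow> complex set \<Rightarrow> complex set set" where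
  "ideal_class d I = principal_fractional_ideals d #>\<^bsub>fractional_ideal_group d\<^esub> I"

definition ideal_class_ord :: "int \<Rightarrow> complex set \<Rightarrow> nat" where
  "ideal_class_ord d I = group.ord (class_group d) (ideal_class d I)"

end

theory Submission
  imports Defs
begin

text \<open>
  The algorithm multiplies ideal classes by $\mathfrak{p}^2$. A point \<open>x\<close> of the field in the upper half
  plane stands for the lattice $\mathbb{Z} + \mathbb{Z} x$ up to scaling. The points that occur are
  $x = (\theta - c) / a$ with \<open>a\<close> dividing $f(c)$, where \<open>f\<close> is the minimal polynomial of $\theta$; their
  lattices are proportional to ideals of the maximal order. Replacing \<open>x\<close> by $-1/x$ or $x - b$ changes
  the lattice by a scalar only. Replacing $z \in \mathbb{Z}_p$ by $(z - a)/p^2$ cuts the lattice down to its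
  intersection with $p^2 \mathbb{Z}_p$, which is multiplication by $\mathfrak{p}^2$
  (\<open>padic_step_ideal\<close>). The scalars are the automorphy factors of the matrices, so with
  $\epsilon_k$ the automorphy factor of $B_k^{-1}$ at $\theta$ one gets
  $p^k \epsilon_k (\mathbb{Z} + \mathbb{Z} x_{k+1}) = \mathfrak{p}^{2k}$ (\<open>cf_invariant\<close>).

  The only reduced point whose lattice is proportional to the maximal order is $\theta$
  (\<open>reduced_principal\<close>). Hence $x_{k+1} = \theta$ exactly when $\mathfrak{p}^{2k}$ is principal
  (\<open>cf_x_return_iff\<close>), and then $p^k \epsilon_k$ is a generator. Such a $k \ge 1$ exists because there are
  finitely many reduced points: if $x_{m+1} = x_{m+k+1}$, then $\mathfrak{p}^{2m}$ and $\mathfrak{p}^{2m+2k}$ are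
  proportional, and the factor generates $\mathfrak{p}^{2k}$ (\<open>exists_principal_power\<close>).
  The reduction ends because each step lowers the leading coefficient \<open>a\<close> until the point has reached
  the unit circle or its exterior; only the corner $e^{2 \pi i / 3}$ is dangerous, and it requires
  $d = 3$ (\<open>inf_ends_pt\<close>, \<open>no_corner\<close>).

  The rest is arithmetic of the least \<open>N\<close> with $\mathfrak{p}^{2N}$ principal. Let $u$ be the
  generator. A norm-one p-unit in lowest terms is $y / p^m$, where $y$ or its conjugate generates
  $\mathfrak{p}^{2m}$; so \<open>N\<close> divides \<open>m\<close>, and the unit is a power of $\epsilon = u / p^N$ times a root of
  unity (\<open>fundamental_norm_one_unit_if_gen\<close>). The principal powers of $\mathfrak{p}$ are those whose
  exponent is a multiple of the order \<open>h\<close> of the class, so \<open>N\<close> is \<open>h\<close> or $h/2$ according to the parity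
  of \<open>h\<close> (\<open>half_order_cases\<close>), and $h = N$ means that $\mathfrak{p}^N$ has a generator $x$, that is, that
  $u / x^2$ is a root of unity (\<open>square_root_iff\<close>). That the class group is a group rests on the
  fact that the product of an ideal and its conjugate is principal (\<open>lat_conj_product\<close>).

  Lattices with given bases are compared through the areas of their fundamental parallelograms, which
  replace indices and norms of ideals throughout. The p-adic numbers enter through a few properties
  of $\mathbb{Z}_p$ as a subring of the complex numbers (\<open>padic_subring\<close>). Hensel's lemma shows that
  $\theta$ lies in this subring when \<open>p\<close> splits.
\<close>

section \<open>Divisibility and units in the p-adic integers\<close>

lemma padic_residue_range:
  "padic_residue (y :: 'p::prime_card padic_int) n \<in> {0..<int CARD('p) ^ n}"
  using padic_residue[of y] by blast

lemma padic_residue_shift: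
  "padic_residue (y :: 'p::prime_card padic_int) (n + k) mod int CARD('p) ^ n = padic_residue y n"
  using padic_residue[of y] by (intro padic_residue_mod) blast

lemma padic_residue_of_int:
  "padic_residue (of_int k :: 'p::prime_card padic_int) n = k mod int CARD('p) ^ n"
proof -
  have nat: "padic_residue (of_nat m :: 'p padic_int) n = int m mod int CARD('p) ^ n" for m
    by (induction m)
       (simp_all add: zero_padic_int.rep_eq plus_padic_int.rep_eq one_padic_int.rep_eq mod_simps)
  obtain a b where "k = int a - int b" by (cases k rule: int_diff_cases)
  then show ?thesis
    by (simp add: minus_padic_int.rep_eq nat mod_simps)
qed

text \<open>A coherent sequence that vanishes at level \<open>n\<close> is divisible by the
  \<open>n\<close>-th power of the prime: the quotient is obtained by shifting the sequence by
  \<open>n\<close> levels and dividing the residues.\<close>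

lemma padic_prime_power_dvd_iff:
  fixes y :: "'p::prime_card padic_int"
  shows "of_nat CARD('p) ^ n dvd y \<longleftrightarrow> padic_residue y n = 0"
proof
  have pow: "padic_residue (of_nat CARD('p) ^ n :: 'p padic_int) m
               = int CARD('p) ^ n mod int CARD('p) ^ m" for m
    using padic_residue_of_int[of "int CARD('p) ^ n" m, where 'p = 'p] by simp
  {
    assume "of_nat CARD('p) ^ n dvd y"
    then obtain z where "y = of_nat CARD('p) ^ n * z" by (elim dvdE)
    then show "padic_residue y n = 0"
      by (simp add: times_padic_int.rep_eq pow)
  }
  assume y: "padic_residue y n = 0"
  have pp: "0 < int CARD('p) ^ k" for k
    using padic_prime_pos[where 'p = 'p] by simp
  define h where "h = (\<lambda>m. padic_residue y (m + n) div int CARD('p) ^ n)"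
  have hn: "int CARD('p) ^ n * h m = padic_residue y (m + n)" for m
  proof -
    have "padic_residue y (m + n) mod int CARD('p) ^ n = 0"
      using padic_residue_shift[of y n m] y by (simp add: add.commute)
    then show ?thesis unfolding h_def by (auto simp: dvd_eq_mod_eq_0[symmetric])
  qed
  have "h m \<in> {0..<int CARD('p) ^ m} \<and> h (Suc m) mod int CARD('p) ^ m = h m" for m
  proof
    have "padic_residue y (m + n) \<in> {0..<int CARD('p) ^ (m + n)}"
      by (rule padic_residue_range)
    then have "int CARD('p) ^ n * h m \<in> {0..<int CARD('p) ^ n * int CARD('p) ^ m}"
      unfolding hn by (simp add: power_add mult.commute)
    then show "h m \<in> {0..<int CARD('p) ^ m}"
      using pp[of n] by (auto simp: zero_le_mult_iff)
    have "int CARD('p) ^ n * (h (Suc m) mod int CARD('p) ^ m)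
            = (int CARD('p) ^ n * h (Suc m)) mod (int CARD('p) ^ n * int CARD('p) ^ m)"
      by (rule mult_mod_right)
    also have "\<dots> = padic_residue y (Suc m + n) mod int CARD('p) ^ (m + n)"
      unfolding hn power_add by (simp only: mult.commute)
    also have "\<dots> = int CARD('p) ^ n * h m"
      using padic_residue_shift[of y "m + n" 1] by (simp add: hn)
    finally show "h (Suc m) mod int CARD('p) ^ m = h m"
      using pp[of n] by simp
  qed
  then have res: "padic_residue (Abs_padic_int h :: 'p padic_int) = h"
    by (intro Abs_padic_int_inverse) simp
  have "y = of_nat CARD('p) ^ n * Abs_padic_int h"
  proof (rule iffD1[OF padic_residue_inject], rule ext)
    fix m
    have "padic_residue (of_nat CARD('p) ^ n * Abs_padic_int h :: 'p padic_int) m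
            = (int CARD('p) ^ n * h m) mod int CARD('p) ^ m"
      by (simp add: times_padic_int.rep_eq pow res mod_simps)
    then show "padic_residue y m = padic_residue (of_nat CARD('p) ^ n * Abs_padic_int h :: 'p padic_int) m"
      by (simp add: hn padic_residue_shift)
  qed
  then show "of_nat CARD('p) ^ n dvd y" by (metis dvd_triv_left)
qed

text \<open>A nonzero residue at level 1 is invertible at every level, and the inverses cohere because
  inverses are unique.\<close>

lemma padic_unit:
  fixes y :: "'p::prime_card padic_int"
  assumes "\<not> of_nat CARD('p) dvd y"
  shows "y dvd 1"
proof -
  let ?p = "int CARD('p)"
  have y1: "padic_residue y 1 \<noteq> 0"
    using assms padic_prime_power_dvd_iff[of 1 y] by auto
  have coprime: "coprime (padic_residue y m) (?p ^ m)" for m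
  proof (cases m)
    case (Suc k)
    have "padic_residue y m mod ?p ^ 1 = padic_residue y 1"
      using padic_residue_shift[of y 1 k] Suc by simp
    then have "\<not> ?p dvd padic_residue y m" using y1 by (auto simp: dvd_eq_mod_eq_0)
    then have "coprime ?p (padic_residue y m)"
      using prime_card_int[where 'a = 'p] by (intro prime_imp_coprime) auto
    then show ?thesis by (simp add: coprime_commute)
  qed simp
  then have "\<forall>m. \<exists>x. [padic_residue y m * x = 1] (mod ?p ^ m)"
    using cong_solve_coprime_int by blast
  then obtain g where g: "\<And>m. [padic_residue y m * g m = 1] (mod ?p ^ m)" by metis
  define h where "h = (\<lambda>m. g m mod ?p ^ m)"
  have "h m \<in> {0..<?p ^ m} \<and> h (Suc m) mod ?p ^ m = h m" for m
    unfolding h_def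
  proof (rule padic_residue_intro)
    fix m
    have "[padic_residue y (Suc m) * g (Suc m) = 1] (mod ?p ^ m)"
      using g[of "Suc m"] by (rule cong_dvd_modulus) simp
    moreover have "[padic_residue y (Suc m) = padic_residue y m] (mod ?p ^ m)"
      using padic_residue_shift[of y m 1] padic_residue_range[of y m] by (simp add: cong_def)
    ultimately have "[padic_residue y m * g (Suc m) = 1] (mod ?p ^ m)"
      by (meson cong_scalar_right cong_sym cong_trans)
    then have "[padic_residue y m * g (Suc m) = padic_residue y m * g m] (mod ?p ^ m)"
      using g[of m] cong_sym cong_trans by blast
    then show "g (Suc m) mod ?p ^ m = g m mod ?p ^ m"
      using cong_mult_lcancel[OF coprime[of m]] by (simp add: cong_def)
  qed
  then have res: "padic_residue (Abs_padic_int h :: 'p padic_int) = h"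
    by (intro Abs_padic_int_inverse) simp
  have "y * Abs_padic_int h = 1"
  proof (rule iffD1[OF padic_residue_inject], rule ext)
    fix m
    show "padic_residue (y * Abs_padic_int h) m = padic_residue (1 :: 'p padic_int) m"
      unfolding times_padic_int.rep_eq one_padic_int.rep_eq res
      using g[of m] by (simp add: h_def mod_simps cong_def)
  qed
  then show ?thesis by (metis dvd_triv_left)
qed

text \<open>Hensel's lemma. At each level the root is corrected by a multiple of the last prime power, and
  the multiplier solves a linear congruence whose leading coefficient is the derivative.\<close>

lemma padic_quadratic_root:
  fixes T n c :: int
  assumes root: "int CARD('p::prime_card) dvd c ^ 2 + T * c + n"
    and simple: "\<not> int CARD('p) dvd 2 * c + T"
  shows "\<exists>y :: 'p padic_int. y ^ 2 + of_int T * y + of_int n = 0"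
proof -
  let ?p = "int CARD('p)"
  define f where "f = (\<lambda>x::int. x ^ 2 + T * x + n)"
  have "\<exists>g. \<forall>m. (?p ^ Suc m dvd f (g m) \<and> ?p dvd g m - c) \<and> ?p ^ Suc m dvd g (Suc m) - g m"
  proof (rule dependent_nat_choice)
    show "\<exists>x. ?p ^ Suc 0 dvd f x \<and> ?p dvd x - c"
      using root by (intro exI[of _ c]) (simp add: f_def)
  next
    fix x m assume x: "?p ^ Suc m dvd f x \<and> ?p dvd x - c"
    then obtain e where e: "f x = ?p ^ Suc m * e" by (auto elim: dvdE)
    have "\<not> ?p dvd 2 * x + T"
    proof
      assume "?p dvd 2 * x + T"
      moreover have "?p dvd 2 * (x - c)" using x dvd_mult by blast
      ultimately have "?p dvd (2 * x + T) - 2 * (x - c)" by (rule dvd_diff)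
      then show False using simple by (simp add: algebra_simps)
    qed
    then have "coprime ?p (2 * x + T)"
      using prime_card_int[where 'a = 'p] by (intro prime_imp_coprime) auto
    then obtain t where t: "[(2 * x + T) * t = - e] (mod ?p)"
      by (metis cong_solve_coprime_int coprime_commute cong_scalar_right mult.assoc mult_1)
    have td: "?p dvd e + (2 * x + T) * t"
      using t by (simp add: cong_iff_dvd_diff add.commute)
    have "f (x + t * ?p ^ Suc m) = ?p ^ Suc m * (e + (2 * x + T) * t) + t ^ 2 * ?p ^ Suc m * ?p ^ Suc m"
      using e unfolding f_def by (simp add: algebra_simps power2_eq_square)
    moreover have "?p ^ Suc (Suc m) dvd ?p ^ Suc m * (e + (2 * x + T) * t)"
      using mult_dvd_mono[OF dvd_refl td, of "?p ^ Suc m"] by (simp add: mult.commute mult.left_commute)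
    moreover have "?p ^ Suc (Suc m) dvd t ^ 2 * ?p ^ Suc m * ?p ^ Suc m"
      by (simp add: mult.commute mult.left_commute)
    ultimately have "?p ^ Suc (Suc m) dvd f (x + t * ?p ^ Suc m)"
      using dvd_add by metis
    moreover have "?p dvd x + t * ?p ^ Suc m - c"
    proof -
      have "?p dvd (x - c) + t * ?p ^ Suc m" using x by (intro dvd_add) auto
      then show ?thesis by (simp add: algebra_simps)
    qed
    ultimately show "\<exists>y. (?p ^ Suc (Suc m) dvd f y \<and> ?p dvd y - c) \<and> ?p ^ Suc m dvd y - x"
      by (intro exI[of _ "x + t * ?p ^ Suc m"]) auto
  qed
  then obtain g where g: "\<And>m. ?p ^ Suc m dvd f (g m)" "\<And>m. ?p ^ Suc m dvd g (Suc m) - g m"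
    by auto
  define h where "h = (\<lambda>m. g m mod ?p ^ m)"
  have "h m \<in> {0..<?p ^ m} \<and> h (Suc m) mod ?p ^ m = h m" for m
    unfolding h_def
  proof (rule padic_residue_intro)
    fix m
    have "?p ^ m dvd g (Suc m) - g m" using g(2)[of m] dvd_mult_right by auto
    then show "g (Suc m) mod ?p ^ m = g m mod ?p ^ m" by (simp add: mod_eq_dvd_iff)
  qed
  then have res: "padic_residue (Abs_padic_int h :: 'p padic_int) = h"
    by (intro Abs_padic_int_inverse) simp
  have "(Abs_padic_int h) ^ 2 + of_int T * Abs_padic_int h + of_int n = (0 :: 'p padic_int)"
  proof (rule iffD1[OF padic_residue_inject], rule ext)
    fix m
    have "padic_residue ((Abs_padic_int h) ^ 2 + of_int T * Abs_padic_int h + of_int n :: 'p padic_int) m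
            = f (h m) mod ?p ^ m"
      unfolding power2_eq_square plus_padic_int.rep_eq times_padic_int.rep_eq res
        padic_residue_of_int f_def
      by (simp only: mod_add_left_eq mod_add_right_eq mod_mult_left_eq)
    also have "\<dots> = f (g m) mod ?p ^ m"
    proof -
      have "[h m = g m] (mod ?p ^ m)" by (simp add: h_def cong_def)
      then have "[f (h m) = f (g m)] (mod ?p ^ m)"
        unfolding f_def by (intro cong_add cong_pow cong_mult cong_refl)
      then show ?thesis by (simp add: cong_def)
    qed
    also have "\<dots> = 0" using g(1)[of m] dvd_mult_right by (auto simp: dvd_eq_mod_eq_0[symmetric])
    finally show "padic_residue ((Abs_padic_int h) ^ 2 + of_int T * Abs_padic_int h + of_int n
        :: 'p padic_int) m = padic_residue (0 :: 'p padic_int) m"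
      by (simp add: zero_padic_int.rep_eq)
  qed
  then show ?thesis by blast
qed

section \<open>The p-adic integers inside the complex numbers\<close>

text \<open>The properties of $\mathbb{Z}_p$, viewed inside the complex numbers, on which all the
  arithmetic of the quadratic field rests. The last three say that an integer divisible by $p^m$
  in the ring is so among the integers, that the integers are dense, and that the ring is local
  with maximal ideal generated by \<open>p\<close>.\<close>

locale padic_subring =
  fixes p :: nat and R :: "complex set"
  assumes prime_p: "prime p"
    and one_in: "1 \<in> R"
    and add_in: "x \<in> R \<Longrightarrow> y \<in> R \<Longrightarrow> x + y \<in> R"
    and mult_in: "x \<in> R \<Longrightarrow> y \<in> R \<Longrightarrow> x * y \<in> R"
    and minus_in: "x \<in> R \<Longrightarrow> - x \<in> R"
    and int_dvd: "of_int k / of_nat p ^ m \<in> R \<Longrightarrow> int p ^ m dvd k"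
    and approx: "x \<in> R \<Longrightarrow> \<exists>a. (x - of_int a) / of_nat p ^ m \<in> R"
    and unit: "x \<in> R \<Longrightarrow> x / of_nat p \<notin> R \<Longrightarrow> 1 / x \<in> R"

text \<open>The inverse of the identification of the two fields, restricted to the p-adic integers. It is
  an injective ring homomorphism whose image is the set \<open>Zp_in\<close>.\<close>

definition padic_emb :: "(complex \<Rightarrow> 'p::prime_card padic alg_closure) \<Rightarrow> 'p padic_int \<Rightarrow> complex" where
  "padic_emb \<iota> y = inv_into UNIV \<iota> (to_ac (Fract y 1))"

context
  fixes \<iota> :: "complex \<Rightarrow> 'p::prime_card padic alg_closure"
  assumes iota: "\<iota> \<in> ring_iso ring_of_type_algebra ring_of_type_algebra"
begin

lemma iota_hom:
  "\<iota> (x + y) = \<iota> x + \<iota> y" "\<iota> (x * y) = \<iota> x * \<iota> y" "\<iota> 1 = 1" "bij \<iota>"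
proof -
  have hom: "\<iota> \<in> Ring.ring_hom ring_of_type_algebra ring_of_type_algebra"
    using iota by (simp add: ring_iso_def)
  show "\<iota> (x + y) = \<iota> x + \<iota> y" "\<iota> (x * y) = \<iota> x * \<iota> y" "\<iota> 1 = 1"
    using Ring.ring_hom_add[OF hom, of x y] Ring.ring_hom_mult[OF hom, of x y] Ring.ring_hom_one[OF hom]
    by (simp_all add: ring_of_type_algebra_def)
  show "bij \<iota>"
    using iota by (simp add: ring_iso_def ring_of_type_algebra_def)
qed

lemma padic_emb_iota: "\<iota> (padic_emb \<iota> y) = to_ac (Fract y 1)"
  unfolding padic_emb_def using iota_hom(4) by (simp add: bij_is_surj surj_f_inv_f)

lemma padic_emb_add: "padic_emb \<iota> (x + y) = padic_emb \<iota> x + padic_emb \<iota> y"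
  by (rule injD[OF bij_is_inj[OF iota_hom(4)]])
     (simp add: padic_emb_iota iota_hom to_ac_add[symmetric])

lemma padic_emb_mult: "padic_emb \<iota> (x * y) = padic_emb \<iota> x * padic_emb \<iota> y"
  by (rule injD[OF bij_is_inj[OF iota_hom(4)]])
     (simp add: padic_emb_iota iota_hom to_ac_mult[symmetric])

lemma padic_emb_1: "padic_emb \<iota> 1 = 1"
  by (rule injD[OF bij_is_inj[OF iota_hom(4)]])
     (simp add: padic_emb_iota iota_hom One_fract_def[symmetric])

lemma padic_emb_inj: "padic_emb \<iota> x = padic_emb \<iota> y \<longleftrightarrow> x = y"
proof
  assume "padic_emb \<iota> x = padic_emb \<iota> y"
  then have "to_ac (Fract x 1) = to_ac (Fract y 1)" by (metis padic_emb_iota)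
  then show "x = y" by (simp add: eq_fract)
qed simp

lemma padic_emb_0: "padic_emb \<iota> 0 = 0"
  using padic_emb_add[of 0 0] by simp

lemma padic_emb_minus: "padic_emb \<iota> (- x) = - padic_emb \<iota> x"
  using padic_emb_add[of x "- x"] by (simp add: padic_emb_0 add_eq_0_iff)

lemma padic_emb_diff: "padic_emb \<iota> (x - y) = padic_emb \<iota> x - padic_emb \<iota> y"
  using padic_emb_add[of x "- y"] by (simp add: padic_emb_minus)

lemma padic_emb_of_nat: "padic_emb \<iota> (of_nat k) = of_nat k"
  by (induction k) (simp_all add: padic_emb_0 padic_emb_1 padic_emb_add)

lemma padic_emb_of_int: "padic_emb \<iota> (of_int k) = of_int k"
  by (cases k rule: int_diff_cases) (simp add: padic_emb_diff padic_emb_of_nat)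

lemma padic_emb_power: "padic_emb \<iota> (x ^ k) = padic_emb \<iota> x ^ k"
  by (induction k) (simp_all add: padic_emb_1 padic_emb_mult)

lemma Zp_in_eq_range: "Zp_in \<iota> = range (padic_emb \<iota>)"
proof -
  have "\<iota> z = to_ac (Fract y 1) \<longleftrightarrow> z = padic_emb \<iota> y" for z y
    unfolding padic_emb_iota[symmetric] using iota_hom(4) by (simp add: bij_is_inj inj_eq)
  then show ?thesis unfolding Zp_in_def by auto
qed

lemma padic_emb_div_prime_power_iff:
  "padic_emb \<iota> y / of_nat CARD('p) ^ m \<in> Zp_in \<iota> \<longleftrightarrow> of_nat CARD('p) ^ m dvd y"
proof
  have p: "CARD('p) > 0" by simp
  {
    assume "padic_emb \<iota> y / of_nat CARD('p) ^ m \<in> Zp_in \<iota>"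
    then obtain z where "padic_emb \<iota> y / of_nat CARD('p) ^ m = padic_emb \<iota> z"
      by (auto simp: Zp_in_eq_range)
    then have "padic_emb \<iota> y = padic_emb \<iota> (of_nat CARD('p) ^ m * z)"
      by (simp add: padic_emb_mult padic_emb_power padic_emb_of_nat field_simps)
    then show "of_nat CARD('p) ^ m dvd y" by (simp add: padic_emb_inj)
  }
  assume "of_nat CARD('p) ^ m dvd y"
  then obtain z where "y = of_nat CARD('p) ^ m * z" by (elim dvdE)
  then show "padic_emb \<iota> y / of_nat CARD('p) ^ m \<in> Zp_in \<iota>"
    by (simp add: padic_emb_mult padic_emb_power padic_emb_of_nat Zp_in_eq_range)
qed

lemma padic_subring_Zp_in: "padic_subring CARD('p) (Zp_in \<iota>)"
proof
  show "prime CARD('p)" by (rule prime_card)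
  show "1 \<in> Zp_in \<iota>" unfolding Zp_in_eq_range using padic_emb_1 rangeI[of "padic_emb \<iota>" 1] by simp
next
  fix x y assume "x \<in> Zp_in \<iota>" "y \<in> Zp_in \<iota>"
  then obtain u v where uv: "x = padic_emb \<iota> u" "y = padic_emb \<iota> v"
    by (auto simp: Zp_in_eq_range)
  have "x + y = padic_emb \<iota> (u + v)" "x * y = padic_emb \<iota> (u * v)"
    by (simp_all add: uv padic_emb_add padic_emb_mult)
  then show "x + y \<in> Zp_in \<iota>" "x * y \<in> Zp_in \<iota>"
    by (simp_all add: Zp_in_eq_range)
next
  fix x assume x: "x \<in> Zp_in \<iota>"
  then obtain u where u: "x = padic_emb \<iota> u" by (auto simp: Zp_in_eq_range)
  have "- x = padic_emb \<iota> (- u)"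
    by (simp add: u padic_emb_minus)
  then show "- x \<in> Zp_in \<iota>" by (simp add: Zp_in_eq_range)
  show "\<exists>a. (x - of_int a) / of_nat CARD('p) ^ m \<in> Zp_in \<iota>" for m
  proof -
    let ?a = "padic_residue u m"
    have "padic_residue (u - of_int ?a) m = 0"
      by (simp add: minus_padic_int.rep_eq padic_residue_of_int mod_simps)
    then have "of_nat CARD('p) ^ m dvd u - of_int ?a"
      by (simp add: padic_prime_power_dvd_iff)
    then have "padic_emb \<iota> (u - of_int ?a) / of_nat CARD('p) ^ m \<in> Zp_in \<iota>"
      by (simp add: padic_emb_div_prime_power_iff)
    then show ?thesis by (auto simp: u padic_emb_diff padic_emb_of_int)
  qed
  {
    assume nd: "x / of_nat CARD('p) \<notin> Zp_in \<iota>"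
    have "\<not> of_nat CARD('p) dvd u"
      using nd padic_emb_div_prime_power_iff[of u 1] by (simp add: u)
    then obtain w where "1 = u * w" by (metis padic_unit dvdE)
    then have "padic_emb \<iota> u * padic_emb \<iota> w = 1"
      by (metis padic_emb_1 padic_emb_mult)
    then have "1 / x = padic_emb \<iota> w" unfolding u by (metis divide_eq_eq mult.commute mult_zero_left zero_neq_one)
    then show "1 / x \<in> Zp_in \<iota>" by (simp add: Zp_in_eq_range)
  }
next
  fix k m assume "of_int k / of_nat CARD('p) ^ m \<in> Zp_in \<iota>"
  then have "of_nat CARD('p) ^ m dvd (of_int k :: 'p padic_int)"
    using padic_emb_div_prime_power_iff[of "of_int k" m] by (simp add: padic_emb_of_int)
  then show "int CARD('p) ^ m dvd k"
    by (simp add: padic_prime_power_dvd_iff padic_residue_of_int dvd_eq_mod_eq_0)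
qed

lemma quadratic_root_in_Zp_in:
  fixes T n c :: int
  assumes "int CARD('p) dvd c ^ 2 + T * c + n" "\<not> int CARD('p) dvd 2 * c + T"
  shows "\<exists>x \<in> Zp_in \<iota>. x ^ 2 + of_int T * x + of_int n = 0"
proof -
  obtain y :: "'p padic_int" where y: "y ^ 2 + of_int T * y + of_int n = 0"
    using padic_quadratic_root[OF assms] by blast
  have "padic_emb \<iota> y ^ 2 + of_int T * padic_emb \<iota> y + of_int n
          = padic_emb \<iota> (y ^ 2 + of_int T * y + of_int n)"
    by (simp add: padic_emb_add padic_emb_mult padic_emb_power padic_emb_of_int)
  then show ?thesis unfolding y padic_emb_0 by (auto simp: Zp_in_eq_range)
qed

end

section \<open>Lattices in the complex plane\<close>

definition lat :: "complex \<Rightarrow> complex \<Rightarrow> complex set" where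
  "lat \<alpha> \<beta> = {of_int i * \<alpha> + of_int j * \<beta> |i j. True}"

text \<open>The signed area of the parallelogram spanned by two complex numbers.\<close>

definition area :: "complex \<Rightarrow> complex \<Rightarrow> real" where
  "area \<alpha> \<beta> = Im (cnj \<alpha> * \<beta>)"

lemma latI: "x = of_int i * \<alpha> + of_int j * \<beta> \<Longrightarrow> x \<in> lat \<alpha> \<beta>"
  by (auto simp: lat_def)

lemma latE:
  assumes "x \<in> lat \<alpha> \<beta>"
  obtains i j where "x = of_int i * \<alpha> + of_int j * \<beta>"
  using assms by (auto simp: lat_def)

lemma lat_add: "x \<in> lat \<alpha> \<beta> \<Longrightarrow> y \<in> lat \<alpha> \<beta> \<Longrightarrow> x + y \<in> lat \<alpha> \<beta>"
proof (elim latE)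
  fix i j k l
  assume "x = of_int i * \<alpha> + of_int j * \<beta>" "y = of_int k * \<alpha> + of_int l * \<beta>"
  then have "x + y = of_int (i + k) * \<alpha> + of_int (j + l) * \<beta>" by (simp add: algebra_simps)
  then show ?thesis by (rule latI)
qed

lemma lat_int_mult: "x \<in> lat \<alpha> \<beta> \<Longrightarrow> of_int k * x \<in> lat \<alpha> \<beta>"
proof (elim latE)
  fix i j
  assume "x = of_int i * \<alpha> + of_int j * \<beta>"
  then have "of_int k * x = of_int (k * i) * \<alpha> + of_int (k * j) * \<beta>" by (simp add: algebra_simps)
  then show ?thesis by (rule latI)
qed

lemma lat_minus: "x \<in> lat \<alpha> \<beta> \<Longrightarrow> - x \<in> lat \<alpha> \<beta>"
  using lat_int_mult[of x \<alpha> \<beta> "- 1"] by simp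

lemma lat_diff: "x \<in> lat \<alpha> \<beta> \<Longrightarrow> y \<in> lat \<alpha> \<beta> \<Longrightarrow> x - y \<in> lat \<alpha> \<beta>"
  using lat_add[of x \<alpha> \<beta> "- y"] lat_minus[of y] by simp

lemma lat_gen: "\<alpha> \<in> lat \<alpha> \<beta>" "\<beta> \<in> lat \<alpha> \<beta>" "0 \<in> lat \<alpha> \<beta>"
  using latI[of \<alpha> 1 \<alpha> 0 \<beta>] latI[of \<beta> 0 \<alpha> 1 \<beta>] latI[of 0 0 \<alpha> 0 \<beta>] by simp_all

lemma lat_subset_iff: "lat \<gamma> \<delta> \<subseteq> lat \<alpha> \<beta> \<longleftrightarrow> \<gamma> \<in> lat \<alpha> \<beta> \<and> \<delta> \<in> lat \<alpha> \<beta>"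
proof
  assume "\<gamma> \<in> lat \<alpha> \<beta> \<and> \<delta> \<in> lat \<alpha> \<beta>"
  then show "lat \<gamma> \<delta> \<subseteq> lat \<alpha> \<beta>" by (auto elim!: latE[of _ \<gamma> \<delta>] intro: lat_add lat_int_mult)
qed (use lat_gen in blast)

lemma lat_scale: "(*) x ` lat \<alpha> \<beta> = lat (x * \<alpha>) (x * \<beta>)"
proof (intro equalityI subsetI)
  fix y assume "y \<in> (*) x ` lat \<alpha> \<beta>"
  then obtain i j where "y = x * (of_int i * \<alpha> + of_int j * \<beta>)" by (auto elim!: latE)
  then show "y \<in> lat (x * \<alpha>) (x * \<beta>)" by (intro latI[of _ i _ j]) (simp add: algebra_simps)
next
  fix y assume "y \<in> lat (x * \<alpha>) (x * \<beta>)"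
  then obtain i j where "y = of_int i * (x * \<alpha>) + of_int j * (x * \<beta>)" by (rule latE)
  then have "y = x * (of_int i * \<alpha> + of_int j * \<beta>)" by (simp add: algebra_simps)
  then show "y \<in> (*) x ` lat \<alpha> \<beta>" using latI by blast
qed

lemma lat_swap: "lat \<alpha> \<beta> = lat \<beta> (- \<alpha>)"
  using lat_subset_iff[of \<alpha> \<beta> \<beta> "- \<alpha>"] lat_subset_iff[of \<beta> "- \<alpha>" \<alpha> \<beta>]
    lat_minus[of "- \<alpha>" \<beta> "- \<alpha>"] lat_gen lat_minus by (intro equalityI) auto

lemma lat_shift: "lat \<alpha> (\<beta> - of_int k * \<alpha>) = lat \<alpha> \<beta>"
proof (intro equalityI; unfold lat_subset_iff, intro conjI)
  show "\<beta> \<in> lat \<alpha> (\<beta> - of_int k * \<alpha>)" by (rule latI[of _ k _ 1]) simp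
  show "\<beta> - of_int k * \<alpha> \<in> lat \<alpha> \<beta>" by (rule latI[of _ "- k" _ 1]) simp
qed (rule lat_gen)+

lemma area_scale: "area (x * \<alpha>) (x * \<beta>) = (cmod x)\<^sup>2 * area \<alpha> \<beta>"
proof -
  have "cnj (x * \<alpha>) * (x * \<beta>) = of_real ((cmod x)\<^sup>2) * (cnj \<alpha> * \<beta>)"
    by (simp add: complex_norm_square mult_ac del: of_real_power)
  moreover have "Im (of_real r * z) = r * Im z" for r z by simp
  ultimately show ?thesis unfolding area_def by (simp only:)
qed

lemma area_det:
  "area (of_int i * \<alpha> + of_int j * \<beta>) (of_int k * \<alpha> + of_int l * \<beta>) = of_int (i * l - j * k) * area \<alpha> \<beta>"
  unfolding area_def by (simp add: algebra_simps)

text \<open>Passing to a sublattice multiplies the area by the determinant of the change of basis, which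
  is invertible exactly when the lattices agree.\<close>

lemma lat_eqI:
  assumes "\<gamma> \<in> lat \<alpha> \<beta>" "\<delta> \<in> lat \<alpha> \<beta>" "\<bar>area \<gamma> \<delta>\<bar> = \<bar>area \<alpha> \<beta>\<bar>" "area \<alpha> \<beta> \<noteq> 0"
  shows "lat \<gamma> \<delta> = lat \<alpha> \<beta>"
proof
  show "lat \<gamma> \<delta> \<subseteq> lat \<alpha> \<beta>" using assms by (simp add: lat_subset_iff)
  obtain i j where ij: "\<gamma> = of_int i * \<alpha> + of_int j * \<beta>" using assms(1) by (rule latE)
  obtain k l where kl: "\<delta> = of_int k * \<alpha> + of_int l * \<beta>" using assms(2) by (rule latE)
  define D where "D = i * l - j * k"
  have "real_of_int \<bar>D\<bar> = 1"
    using assms(3,4) unfolding ij kl area_det D_def[symmetric] by (simp add: abs_mult)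
  then have "\<bar>D\<bar> * \<bar>D\<bar> = 1" by (simp only: of_int_eq_1_iff) 
  then have "D * D = 1" by (simp add: abs_mult[symmetric] flip: power2_eq_square)
  then have D: "of_int D * of_int D = (1 :: complex)" by (metis of_int_1 of_int_mult)
  have D': "of_int D = of_int i * of_int l - of_int j * (of_int k :: complex)"
    by (simp add: D_def)
  have "\<alpha> = of_int D * (of_int D * \<alpha>)" using D by (simp add: mult.assoc[symmetric])
  also have "\<dots> = of_int (D * l) * \<gamma> + of_int (- D * j) * \<delta>"
    unfolding ij kl by (simp add: algebra_simps D')
  finally have "\<alpha> \<in> lat \<gamma> \<delta>" by (rule latI)
  have "\<beta> = of_int D * (of_int D * \<beta>)" using D by (simp add: mult.assoc[symmetric])
  also have "\<dots> = of_int (- D * k) * \<gamma> + of_int (D * i) * \<delta>"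
    unfolding ij kl by (simp add: algebra_simps D')
  finally have "\<beta> \<in> lat \<gamma> \<delta>" by (rule latI)
  with \<open>\<alpha> \<in> lat \<gamma> \<delta>\<close> show "lat \<alpha> \<beta> \<subseteq> lat \<gamma> \<delta>" by (simp add: lat_subset_iff)
qed

lemma lat_eq_area:
  assumes "lat \<gamma> \<delta> = lat \<alpha> \<beta>"
  shows "\<bar>area \<gamma> \<delta>\<bar> = \<bar>area \<alpha> \<beta>\<bar>"
proof -
  have le: "\<bar>area \<alpha> \<beta>\<bar> \<le> \<bar>area \<gamma> \<delta>\<bar>"
    if h: "\<gamma> \<in> lat \<alpha> \<beta>" "\<delta> \<in> lat \<alpha> \<beta>" "area \<gamma> \<delta> \<noteq> 0" for \<alpha> \<beta> \<gamma> \<delta>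
  proof -
    obtain i j where ij: "\<gamma> = of_int i * \<alpha> + of_int j * \<beta>" using h(1) by (rule latE)
    obtain k l where kl: "\<delta> = of_int k * \<alpha> + of_int l * \<beta>" using h(2) by (rule latE)
    have eq: "area \<gamma> \<delta> = of_int (i * l - j * k) * area \<alpha> \<beta>" unfolding ij kl area_det ..
    then have "i * l - j * k \<noteq> 0" using h(3) by (metis of_int_0 mult_zero_left)
    then have "1 \<le> \<bar>i * l - j * k\<bar>" by linarith
    then have "1 \<le> \<bar>real_of_int (i * l - j * k)\<bar>" by linarith
    then show ?thesis unfolding eq abs_mult by (metis abs_ge_zero mult_1 mult_right_mono)
  qed
  have zero: "area \<gamma> \<delta> = 0"
    if "\<gamma> \<in> lat \<alpha> \<beta>" "\<delta> \<in> lat \<alpha> \<beta>" "area \<alpha> \<beta> = 0" for \<alpha> \<beta> \<gamma> \<delta>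
    using that by (auto elim!: latE simp: area_det)
  have mem: "\<gamma> \<in> lat \<alpha> \<beta>" "\<delta> \<in> lat \<alpha> \<beta>" "\<alpha> \<in> lat \<gamma> \<delta>" "\<beta> \<in> lat \<gamma> \<delta>"
    using assms lat_gen by metis+
  show ?thesis
  proof (cases "area \<alpha> \<beta> = 0 \<or> area \<gamma> \<delta> = 0")
    case True
    then show ?thesis using zero[OF mem(1,2)] zero[OF mem(3,4)] by auto
  next
    case False
    then show ?thesis using le[OF mem(1,2)] le[OF mem(3,4)] by auto
  qed
qed

section \<open>Imaginary quadratic orders\<close>

text \<open>An imaginary quadratic integer with minimal polynomial $X^2 + T X + n$. The possible
  values of \<open>T\<close> belong to the generators $\sqrt{-d}$ and $(-1 + \sqrt{-d}) / 2$.\<close>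

locale imag_quadratic =
  fixes T n :: int and \<theta> :: complex
  assumes theta_root: "\<theta> ^ 2 + of_int T * \<theta> + of_int n = 0"
    and trace_cases: "T = 0 \<or> T = 1"
    and Im_theta: "Im \<theta> > 0"
begin

text \<open>The minimal polynomial of \<open>\<theta>\<close> on the integers.\<close>

definition f :: "int \<Rightarrow> int" where "f c = c ^ 2 + T * c + n"

abbreviation O_F :: "complex set" where "O_F \<equiv> lat 1 \<theta>"

lemma cnj_theta: "cnj \<theta> = - of_int T - \<theta>"
proof -
  have "Im (\<theta> ^ 2 + of_int T * \<theta> + of_int n) = 0" by (simp add: theta_root)
  then have "Im \<theta> * (2 * Re \<theta> + of_int T) = 0" by (simp add: power2_eq_square algebra_simps)
  then have "2 * Re \<theta> + of_int T = 0" using Im_theta by simp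
  then show ?thesis by (simp add: complex_eq_iff)
qed

lemma theta_sq: "\<theta> * \<theta> = - of_int T * \<theta> - of_int n"
proof -
  have "\<theta> * \<theta> = (\<theta> ^ 2 + of_int T * \<theta> + of_int n) - of_int T * \<theta> - of_int n"
    by (simp add: power2_eq_square)
  then show ?thesis unfolding theta_root by simp
qed

lemma theta_sq_left: "\<theta> * (\<theta> * x) = - (of_int T * \<theta> + of_int n) * x"
  unfolding mult.assoc[symmetric] theta_sq by (simp add: algebra_simps)

lemma theta_sub_norm: "(\<theta> - of_int c) * cnj (\<theta> - of_int c) = of_int (f c)"
  by (simp add: cnj_theta f_def algebra_simps theta_sq theta_sq_left power2_eq_square)

lemma of_rat_complex: "of_rat r = complex_of_real (of_rat r)"
  by (cases r) (simp add: of_rat_rat)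

lemma rat_basis_unique:
  assumes "of_rat a + of_rat b * \<theta> = of_rat a' + of_rat b' * \<theta>"
  shows "a = a'" "b = b'"
proof -
  have im: "Im (of_rat r :: complex) = 0" for r by (simp add: of_rat_complex)
  have "Im (of_rat a + of_rat b * \<theta>) = Im (of_rat a' + of_rat b' * \<theta>)" using assms by simp
  then show b: "b = b'" using Im_theta by (simp add: im of_rat_complex)
  show "a = a'" using assms unfolding b by simp
qed

lemma int_basis_unique:
  assumes "of_int a + of_int b * \<theta> = of_int a' + of_int b' * \<theta>"
  shows "a = a'" "b = b'"
  using rat_basis_unique[of "of_int a" "of_int b" "of_int a'" "of_int b'"] assms by simp_all

lemma O_F_E:
  assumes "x \<in> O_F"
  obtains i j where "x = of_int i + of_int j * \<theta>"
  using assms by (elim latE) simp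

lemma O_F_I: "x = of_int i + of_int j * \<theta> \<Longrightarrow> x \<in> O_F"
  using latI[of x i 1 j \<theta>] by simp

lemma O_F_int: "of_int k \<in> O_F" "of_nat l \<in> O_F" "1 \<in> O_F" "\<theta> \<in> O_F"
  using O_F_I[of "of_int k" k 0] O_F_I[of "of_nat l" "int l" 0] lat_gen by auto

lemma O_F_mult: "x \<in> O_F \<Longrightarrow> y \<in> O_F \<Longrightarrow> x * y \<in> O_F"
proof (elim O_F_E)
  fix i j k l
  assume xy: "x = of_int i + of_int j * \<theta>" "y = of_int k + of_int l * \<theta>"
  have "x * y = of_int i * of_int k + (of_int i * of_int l + of_int j * of_int k) * \<theta>
                + of_int j * of_int l * (\<theta> * \<theta>)"
    unfolding xy by (simp add: algebra_simps)
  also have "\<dots> = of_int (i * k - j * l * n) + of_int (i * l + j * k - j * l * T) * \<theta>"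
    unfolding theta_sq by (simp add: algebra_simps)
  finally show ?thesis by (rule O_F_I)
qed

lemma O_F_power: "x \<in> O_F \<Longrightarrow> x ^ k \<in> O_F"
  by (induction k) (auto intro: O_F_mult O_F_int)

lemma O_F_cnj: "x \<in> O_F \<Longrightarrow> cnj x \<in> O_F"
proof (elim O_F_E)
  fix i j assume x: "x = of_int i + of_int j * \<theta>"
  have "cnj x = of_int (i - j * T) + of_int (- j) * \<theta>"
    by (simp add: x cnj_theta algebra_simps)
  then show ?thesis by (rule O_F_I)
qed

lemma O_F_norm: "x \<in> O_F \<Longrightarrow> \<exists>N::nat. x * cnj x = of_nat N"
proof (elim O_F_E)
  fix i j assume x: "x = of_int i + of_int j * \<theta>"
  have "x * cnj x = of_int (i ^ 2 - i * j * T + j ^ 2 * n)"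
    by (simp add: x cnj_theta algebra_simps theta_sq theta_sq_left power2_eq_square)
  moreover have "x * cnj x = of_real ((cmod x)\<^sup>2)" by (rule complex_norm_square[symmetric])
  ultimately have "complex_of_real (of_int (i ^ 2 - i * j * T + j ^ 2 * n)) = of_real ((cmod x)\<^sup>2)"
    by (simp only: of_real_of_int_eq)
  then have "real_of_int (i ^ 2 - i * j * T + j ^ 2 * n) = (cmod x)\<^sup>2"
    by (simp only: of_real_eq_iff)
  then have "i ^ 2 - i * j * T + j ^ 2 * n \<ge> 0" by (metis of_int_0_le_iff zero_le_power2)
  then show ?thesis
    using \<open>x * cnj x = of_int _\<close> by (metis nat_0_le of_int_of_nat_eq)
qed

lemma norm_cmod: "x * cnj x = of_real ((cmod x)\<^sup>2)"
  by (rule complex_norm_square[symmetric])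

lemma area_O_F: "area 1 \<theta> = Im \<theta>" by (simp add: area_def)

text \<open>The powers of such an element lie on the unit circle, which contains finitely many points of
  the order, so two of them agree.\<close>

lemma O_F_unit_torsion:
  assumes "x \<in> O_F" "x * cnj x = 1"
  shows "\<exists>k>0. x ^ k = 1"
proof -
  have cm: "cmod (x ^ k) = 1" for k
  proof -
    have "(cmod x)\<^sup>2 = 1" using assms(2) unfolding norm_cmod by (metis of_real_eq_1_iff)
    then have "cmod x = 1" by (simp add: power2_eq_1_iff) (metis norm_ge_zero not_one_le_zero neg_0_le_iff_le)
    then show ?thesis by (simp add: norm_power)
  qed
  \<comment> \<open>Bounds for the coefficients of a point $i + j \theta$ of the unit circle: the imaginary part
    bounds \<open>j\<close>, and then the triangle inequality bounds \<open>i\<close>.\<close>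
  define B where "B = \<lceil>1 / Im \<theta>\<rceil>"
  define C where "C = \<lceil>1 + of_int B * cmod \<theta>\<rceil>"
  let ?S = "(\<lambda>(i, j). of_int i + of_int j * \<theta>) ` ({- C..C} \<times> {- B..B})"
  have "x ^ k \<in> ?S" for k
  proof -
    have "x ^ k \<in> O_F" using assms(1) by (rule O_F_power)
    then obtain i j where ij: "x ^ k = of_int i + of_int j * \<theta>" by (rule O_F_E)
    have "\<bar>Im (x ^ k)\<bar> \<le> 1" using abs_Im_le_cmod[of "x ^ k"] cm[of k] by simp
    then have "\<bar>real_of_int j\<bar> * Im \<theta> \<le> 1" using Im_theta unfolding ij by (simp add: abs_mult)
    then have "\<bar>real_of_int j\<bar> \<le> 1 / Im \<theta>" using Im_theta by (simp add: field_simps)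
    then have j: "\<bar>j\<bar> \<le> B" unfolding B_def by linarith
    have "real_of_int \<bar>i\<bar> = cmod (x ^ k - of_int j * \<theta>)" unfolding ij by simp
    also have "\<dots> \<le> cmod (x ^ k) + cmod (of_int j * \<theta>)" by (rule norm_triangle_ineq4)
    also have "\<dots> \<le> 1 + of_int B * cmod \<theta>"
      using j by (simp add: cm norm_mult mult_right_mono)
    finally have "\<bar>i\<bar> \<le> C" unfolding C_def by linarith
    with j show ?thesis unfolding ij by (intro image_eqI[of _ _ "(i, j)"]) auto
  qed
  then have "range (\<lambda>k. x ^ k) \<subseteq> ?S" by blast
  moreover have "finite ?S" by (intro finite_imageI finite_cartesian_product) simp_all
  ultimately have "finite (range (\<lambda>k. x ^ k))" by (rule finite_subset)
  then have "\<not> inj (\<lambda>k::nat. x ^ k)" using finite_imageD[of "\<lambda>k. x ^ k" UNIV] by auto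
  then obtain k l where kl: "k < l" "x ^ k = x ^ l"
    unfolding inj_def by (metis linorder_neqE_nat)
  have "x \<noteq> 0" using assms(2) by auto
  moreover have "x ^ l = x ^ k * x ^ (l - k)" using kl(1) by (simp flip: power_add)
  ultimately have "x ^ (l - k) = 1" using kl(2) by simp
  then show ?thesis using kl(1) by (intro exI[of _ "l - k"]) simp
qed

end

section \<open>A prime that splits\<close>

text \<open>The inclusion of the order in \<open>R\<close> and its composition with complex conjugation are
  the two p-adic embeddings. They differ modulo \<open>p\<close> because \<open>p\<close> does
  not divide the discriminant.\<close>

locale split_prime = imag_quadratic T n \<theta> + padic_subring p R
  for T n :: int and \<theta> :: complex and p :: nat and R :: "complex set" +
  assumes theta_in: "\<theta> \<in> R"
    and unramified: "\<not> int p dvd T ^ 2 - 4 * n"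
begin

lemma p_pos: "p > 0" using prime_p by (simp add: prime_gt_0_nat)

lemma p_gt1: "p > 1" using prime_gt_1_nat[OF prime_p] .

lemma diff_in: "x \<in> R \<Longrightarrow> y \<in> R \<Longrightarrow> x - y \<in> R"
  using add_in[of x "- y"] minus_in[of y] by simp

lemma zero_in: "0 \<in> R" using diff_in[OF one_in one_in] by simp

lemma nat_in: "of_nat k \<in> R"
  by (induction k) (auto simp: zero_in one_in add_in)

lemma int_in: "of_int k \<in> R"
  by (cases k rule: int_diff_cases) (simp add: diff_in nat_in)

lemma power_in: "x \<in> R \<Longrightarrow> x ^ k \<in> R"
  by (induction k) (auto intro: one_in mult_in)

lemma div_power_le:
  assumes "x / of_nat p ^ m \<in> R" "k \<le> m"
  shows "x / of_nat p ^ k \<in> R"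
proof -
  have "x / of_nat p ^ k = x / of_nat p ^ m * of_nat (p ^ (m - k))"
    using assms(2) p_pos by (simp add: field_simps flip: power_add)
  then show ?thesis using assms by (metis mult_in nat_in)
qed

lemma O_F_in: "x \<in> O_F \<Longrightarrow> x \<in> R"
  by (elim O_F_E) (auto intro: add_in mult_in int_in theta_in)

lemma disc_sq: "(\<theta> - cnj \<theta>) ^ 2 = of_int (T ^ 2 - 4 * n)"
  by (simp add: cnj_theta power2_eq_square algebra_simps theta_sq theta_sq_left)

text \<open>The two embeddings together detect divisibility by powers of \<open>p\<close>. For $x = i + j
  \theta$ the square of $x - \overline{x}$ is $j^2$ times the discriminant, which yields the
  divisibility of \<open>j\<close>, and then that of \<open>i\<close> follows.\<close>

lemma p_pow_dvd_int:
  assumes "x \<in> O_F" "x / of_nat p ^ m \<in> R" "cnj x / of_nat p ^ m \<in> R"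
  shows "\<exists>y \<in> O_F. x = of_nat p ^ m * y"
proof -
  obtain i j where ij: "x = of_int i + of_int j * \<theta>" using assms(1) by (rule O_F_E)
  have "(x / of_nat p ^ m - cnj x / of_nat p ^ m) ^ 2 \<in> R"
    using assms(2,3) by (intro power_in diff_in)
  also have "x / of_nat p ^ m - cnj x / of_nat p ^ m = (of_int j * (\<theta> - cnj \<theta>)) / of_nat p ^ m"
    by (simp add: ij diff_divide_distrib[symmetric] algebra_simps)
  also have "\<dots> ^ 2 = of_int (j ^ 2 * (T ^ 2 - 4 * n)) / of_nat p ^ (2 * m)"
    by (simp add: power_divide power_mult_distrib disc_sq power_mult[symmetric] mult.commute del: of_int_diff)
  finally have "int p ^ (2 * m) dvd j ^ 2 * (T ^ 2 - 4 * n)" by (rule int_dvd)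
  moreover have "coprime (int p ^ (2 * m)) (T ^ 2 - 4 * n)"
    using prime_imp_coprime[of "int p" "T ^ 2 - 4 * n"] unramified prime_p by simp
  ultimately have "int p ^ (2 * m) dvd j ^ 2" by (simp add: coprime_dvd_mult_left_iff)
  then have "(int p ^ m) ^ 2 dvd j ^ 2" by (simp add: power_mult mult.commute[of 2])
  then have "int p ^ m dvd j" by (simp add: pow_divides_pow_iff)
  then obtain j' where j': "j = int p ^ m * j'" by (elim dvdE)
  have "x / of_nat p ^ m - of_int j' * \<theta> \<in> R" by (intro diff_in assms mult_in int_in theta_in)
  also have "x / of_nat p ^ m - of_int j' * \<theta> = of_int i / of_nat p ^ m"
    using p_pos by (simp add: ij j' field_simps)
  finally have "int p ^ m dvd i" by (rule int_dvd)
  then obtain i' where i': "i = int p ^ m * i'" by (elim dvdE)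
  have "x = of_nat p ^ m * (of_int i' + of_int j' * \<theta>)"
    by (simp add: ij i' j' algebra_simps)
  then show ?thesis by (metis O_F_I)
qed

text \<open>An integer congruent to \<open>\<theta>\<close> modulo $p^m$ in \<open>R\<close>, hence a root
  of the minimal polynomial modulo $p^m$.\<close>

definition root_mod :: "nat \<Rightarrow> int" where
  "root_mod m = (SOME c. (\<theta> - of_int c) / of_nat p ^ m \<in> R)"

lemma root_mod: "(\<theta> - of_int (root_mod m)) / of_nat p ^ m \<in> R"
  unfolding root_mod_def using approx[OF theta_in, of m] by (rule someI_ex)

lemma root_mod_f: "int p ^ m dvd f (root_mod m)"
proof (rule int_dvd)
  have "cnj (\<theta> - of_int (root_mod m)) \<in> R"
    by (intro O_F_in O_F_cnj lat_diff O_F_int)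
  then have "(\<theta> - of_int (root_mod m)) / of_nat p ^ m * cnj (\<theta> - of_int (root_mod m)) \<in> R"
    using root_mod mult_in by blast
  then show "of_int (f (root_mod m)) / of_nat p ^ m \<in> R"
    by (simp add: theta_sub_norm[symmetric])
qed

text \<open>If both conjugates of $\theta - c$ were divisible by \<open>p\<close> in \<open>R\<close>, then
  $\theta - c$ would be divisible by \<open>p\<close> in the order, but its coefficient at
  \<open>\<theta>\<close> is 1.\<close>

lemma cnj_root_mod_unit: "m \<ge> 1 \<Longrightarrow> cnj (\<theta> - of_int (root_mod m)) / of_nat p \<notin> R"
proof
  assume m: "m \<ge> 1" and "cnj (\<theta> - of_int (root_mod m)) / of_nat p \<in> R"
  moreover have "(\<theta> - of_int (root_mod m)) / of_nat p \<in> R"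
    using div_power_le[OF root_mod, of 1] m by simp
  ultimately obtain y where y: "y \<in> O_F" "\<theta> - of_int (root_mod m) = of_nat p * y"
    using p_pow_dvd_int[of "\<theta> - of_int (root_mod m)" 1] by (auto intro: lat_diff O_F_int)
  obtain i j where ij: "y = of_int i + of_int j * \<theta>" using y(1) by (rule O_F_E)
  have "of_int (- root_mod m) + of_int 1 * \<theta> = of_int (int p * i) + of_int (int p * j) * \<theta>"
    using y(2) by (simp add: ij algebra_simps)
  then have "int p dvd 1" using int_basis_unique(2) by (metis dvd_triv_left)
  then show False using p_gt1 by simp
qed

text \<open>The $m$-th power of the prime ideal cut out by \<open>R\<close>.\<close>

definition pow_ideal :: "nat \<Rightarrow> complex set" where
  "pow_ideal m = {x \<in> O_F. x / of_nat p ^ m \<in> R}"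

lemma pow_ideal_eq_lat: "pow_ideal m = lat (of_nat p ^ m) (\<theta> - of_int (root_mod m))"
proof (intro equalityI subsetI)
  fix x assume "x \<in> pow_ideal m"
  then have x: "x \<in> O_F" "x / of_nat p ^ m \<in> R" by (auto simp: pow_ideal_def)
  obtain i j where ij: "x = of_int i + of_int j * \<theta>" using x(1) by (rule O_F_E)
  have "x / of_nat p ^ m - of_int j * ((\<theta> - of_int (root_mod m)) / of_nat p ^ m) \<in> R"
    by (intro diff_in x mult_in int_in root_mod)
  also have "x / of_nat p ^ m - of_int j * ((\<theta> - of_int (root_mod m)) / of_nat p ^ m)
               = of_int (i + j * root_mod m) / of_nat p ^ m"
    by (simp add: ij diff_divide_distrib[symmetric] algebra_simps)
  finally have "int p ^ m dvd i + j * root_mod m" by (rule int_dvd)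
  then obtain k where "i + j * root_mod m = int p ^ m * k" by (elim dvdE)
  then have i: "i = int p ^ m * k - j * root_mod m" by simp
  show "x \<in> lat (of_nat p ^ m) (\<theta> - of_int (root_mod m))"
    by (rule latI[of _ k _ j]) (simp add: ij i algebra_simps)
next
  fix x assume "x \<in> lat (of_nat p ^ m) (\<theta> - of_int (root_mod m))"
  then obtain k j where kj: "x = of_int k * of_nat p ^ m + of_int j * (\<theta> - of_int (root_mod m))"
    by (rule latE)
  have "x = of_int (k * int p ^ m - j * root_mod m) + of_int j * \<theta>"
    by (simp add: kj algebra_simps)
  then have "x \<in> O_F" by (rule O_F_I)
  moreover have "of_int k + of_int j * ((\<theta> - of_int (root_mod m)) / of_nat p ^ m) \<in> R"
    by (intro add_in mult_in int_in root_mod)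
  then have "x / of_nat p ^ m \<in> R" using p_pos by (simp add: kj add_divide_distrib)
  ultimately show "x \<in> pow_ideal m" by (simp add: pow_ideal_def)
qed

lemma area_pow_ideal: "area (of_nat p ^ m) (\<theta> - of_int (root_mod m)) = real p ^ m * Im \<theta>"
  by (simp add: area_def flip: of_nat_power)

text \<open>An element of an ideal whose norm is the index of the ideal generates it. This form of being a
  generator is the one that can be verified elementwise.\<close>

definition is_gen :: "complex \<Rightarrow> nat \<Rightarrow> bool" where
  "is_gen y m \<longleftrightarrow> y \<in> pow_ideal m \<and> y * cnj y = of_nat p ^ m"

lemma is_gen_cmod: "y * cnj y = of_nat p ^ m \<longleftrightarrow> (cmod y)\<^sup>2 = real p ^ m"
  unfolding norm_cmod by (metis of_real_eq_iff of_real_of_nat_eq of_real_power)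

lemma is_gen_iff: "is_gen y m \<longleftrightarrow> lat y (y * \<theta>) = pow_ideal m"
proof
  assume y: "is_gen y m"
  then have "y \<in> pow_ideal m" by (simp add: is_gen_def)
  moreover from this have "y * \<theta> \<in> pow_ideal m"
    unfolding pow_ideal_def using mult_in[OF _ theta_in, of "y / of_nat p ^ m"]
    by (auto intro: O_F_mult O_F_int)
  moreover have "area y (y * \<theta>) = real p ^ m * Im \<theta>"
    using y area_scale[of y 1 \<theta>] by (simp add: is_gen_def is_gen_cmod area_O_F)
  ultimately show "lat y (y * \<theta>) = pow_ideal m"
    unfolding pow_ideal_eq_lat using p_pos Im_theta
    by (intro lat_eqI) (auto simp: area_pow_ideal)
next
  assume eq: "lat y (y * \<theta>) = pow_ideal m"
  then have "(cmod y)\<^sup>2 * Im \<theta> = real p ^ m * Im \<theta>"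
    using lat_eq_area[OF eq[unfolded pow_ideal_eq_lat]] area_scale[of y 1 \<theta>] Im_theta
    by (simp add: area_O_F area_pow_ideal abs_mult)
  then have "y * cnj y = of_nat p ^ m" unfolding is_gen_cmod using Im_theta by simp
  moreover have "y \<in> pow_ideal m" using eq lat_gen(1) by blast
  ultimately show "is_gen y m" by (simp add: is_gen_def)
qed

text \<open>An element of p-power norm that is not divisible by \<open>p\<close> has a conjugate that is a
  unit of \<open>R\<close>, so its norm can be cancelled against that conjugate.\<close>

lemma primitive_is_gen:
  assumes "x \<in> O_F" "x * cnj x = of_nat p ^ m" "\<not> (\<exists>y \<in> O_F. x = of_nat p * y)"
  shows "is_gen x m \<or> is_gen (cnj x) m"
proof -
  have half: "x / of_nat p ^ m \<in> R" if "x * cnj x = of_nat p ^ m" "cnj x \<in> R" "cnj x / of_nat p \<notin> R" for x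
  proof -
    have "1 / cnj x \<in> R" using that unit by blast
    moreover have "cnj x \<noteq> 0" using that zero_in by auto
    then have "x / of_nat p ^ m = 1 / cnj x" unfolding that(1)[symmetric] by auto
    ultimately show ?thesis by simp
  qed
  have c: "cnj x \<in> O_F" using assms(1) by (rule O_F_cnj)
  have "x / of_nat p \<notin> R \<or> cnj x / of_nat p \<notin> R"
    using p_pow_dvd_int[of x 1] assms(1,3) by auto
  then show ?thesis
    using half[of x] half[of "cnj x"] assms(1,2) c
    by (auto simp: is_gen_def pow_ideal_def mult.commute intro: O_F_in)
qed

end

section \<open>The fundamental domain and the reduction\<close>

lemma fund_domain_iff:
  "z \<in> fund_domain \<longleftrightarrow>
     Im z > 0 \<and> - 1 / 2 \<le> Re z \<and> Re z < 1 / 2 \<and> cmod z \<ge> 1 \<and> (cmod z = 1 \<longrightarrow> Re z \<le> 0)"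
  (is "_ \<longleftrightarrow> ?rhs")
proof -
  have arc: "(\<exists>\<alpha>. z = exp (\<i> * of_real \<alpha>) \<and> \<alpha> \<in> {pi / 2..2 * pi / 3})
          \<longleftrightarrow> Im z > 0 \<and> - 1 / 2 \<le> Re z \<and> Re z \<le> 0 \<and> cmod z = 1"
  proof
    assume "\<exists>\<alpha>. z = exp (\<i> * of_real \<alpha>) \<and> \<alpha> \<in> {pi / 2..2 * pi / 3}"
    then obtain \<alpha> where z: "z = cis \<alpha>" and \<alpha>: "pi / 2 \<le> \<alpha>" "\<alpha> \<le> 2 * pi / 3"
      by (auto simp: cis_conv_exp)
    have "cos (2 * pi / 3) \<le> cos \<alpha>" "cos \<alpha> \<le> cos (pi / 2)"
      using \<alpha> by (intro cos_monotone_0_pi_le; simp)+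
    moreover have "sin \<alpha> > 0" using \<alpha> pi_gt_zero by (intro sin_gt_zero) linarith+
    ultimately show "Im z > 0 \<and> - 1 / 2 \<le> Re z \<and> Re z \<le> 0 \<and> cmod z = 1"
      by (simp add: z cos_120)
  next
    assume z: "Im z > 0 \<and> - 1 / 2 \<le> Re z \<and> Re z \<le> 0 \<and> cmod z = 1"
    define \<alpha> where "\<alpha> = arccos (Re z)"
    have cos: "cos \<alpha> = Re z" using z by (simp add: \<alpha>_def)
    have "(Re z)\<^sup>2 + (Im z)\<^sup>2 = 1" using z cmod_power2[of z] by simp
    then have "sqrt (1 - (Re z)\<^sup>2) = Im z" using z by (intro real_sqrt_unique) auto
    then have sin: "sin \<alpha> = Im z" using z by (simp add: \<alpha>_def sin_arccos)
    have "arccos 0 \<le> arccos (Re z)" "arccos (Re z) \<le> arccos (- 1 / 2)"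
      using z by (intro arccos_le_arccos; simp)+
    moreover have "arccos (- 1 / 2) = 2 * pi / 3"
      using arccos_cos[of "2 * pi / 3"] by (simp add: cos_120)
    ultimately have "\<alpha> \<in> {pi / 2..2 * pi / 3}" by (simp add: \<alpha>_def)
    moreover have "z = exp (\<i> * of_real \<alpha>)"
      by (simp add: cis_conv_exp[symmetric] complex_eq_iff cos sin)
    ultimately show "\<exists>\<alpha>. z = exp (\<i> * of_real \<alpha>) \<and> \<alpha> \<in> {pi / 2..2 * pi / 3}" by blast
  qed
  have "z \<in> fund_domain \<longleftrightarrow> (Im z > 0 \<and> cmod z > 1 \<and> - 1 / 2 \<le> Re z \<and> Re z < 1 / 2) \<or>
          (\<exists>\<alpha>. z = exp (\<i> * of_real \<alpha>) \<and> \<alpha> \<in> {pi / 2..2 * pi / 3})"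
    unfolding fund_domain_def by blast
  then show ?thesis unfolding arc by auto
qed

text \<open>The square of the absolute value of $i + j z$ is $i^2 + 2 i j \Re z + j^2 |z|^2$, which is at
  least $i^2 - |i j| + j^2$ for reduced \<open>z\<close>.\<close>

lemma fund_domain_short_vector:
  assumes "z \<in> fund_domain" "\<mu> \<in> lat 1 z" "\<mu> \<noteq> 0"
  shows "1 \<le> (cmod \<mu>)\<^sup>2"
proof -
  obtain i j where ij: "\<mu> = of_int i + of_int j * z" using assms(2) by (elim latE) simp
  have z: "\<bar>Re z\<bar> \<le> 1 / 2" "1 \<le> (cmod z)\<^sup>2" using assms(1) by (auto simp: fund_domain_iff)
  have "(i, j) \<noteq> (0, 0)" using assms(3) by (auto simp: ij)
  then have "0 < i ^ 2 + j ^ 2" by (auto simp: sum_power2_gt_zero_iff)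
  moreover have "2 * (i ^ 2 - \<bar>i * j\<bar> + j ^ 2) = (\<bar>i\<bar> - \<bar>j\<bar>) ^ 2 + (i ^ 2 + j ^ 2)"
    by (simp add: power2_diff abs_mult)
  moreover have "(\<bar>i\<bar> - \<bar>j\<bar>) ^ 2 \<ge> 0" by simp
  ultimately have "0 < 2 * (i ^ 2 - \<bar>i * j\<bar> + j ^ 2)" by (metis add_nonneg_pos)
  then have "1 \<le> i ^ 2 - \<bar>i * j\<bar> + j ^ 2"
    by (simp only: int_one_le_iff_zero_less zero_less_mult_iff) simp
  then have "1 \<le> real_of_int (i ^ 2 - \<bar>i * j\<bar> + j ^ 2)" by linarith
  also have "\<dots> = (real_of_int i)\<^sup>2 - \<bar>real_of_int i * real_of_int j\<bar> + (real_of_int j)\<^sup>2" by simp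
  also have "\<dots> \<le> (real_of_int i)\<^sup>2 + 2 * (real_of_int i * real_of_int j) * Re z + (real_of_int j)\<^sup>2 * (cmod z)\<^sup>2"
  proof -
    have "\<bar>real_of_int i * real_of_int j\<bar> * \<bar>Re z\<bar> \<le> \<bar>real_of_int i * real_of_int j\<bar> * (1 / 2)"
      using z(1) by (intro mult_left_mono) auto
    then have "\<bar>(real_of_int i * real_of_int j) * Re z\<bar> \<le> \<bar>real_of_int i * real_of_int j\<bar> / 2"
      by (simp only: abs_mult)
    moreover have "(real_of_int j)\<^sup>2 * 1 \<le> (real_of_int j)\<^sup>2 * (cmod z)\<^sup>2"
      using z(2) by (intro mult_left_mono) auto
    ultimately show ?thesis by (simp add: abs_if split: if_splits)
  qed
  also have "\<dots> = (cmod \<mu>)\<^sup>2"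
    unfolding cmod_power2 by (simp add: ij power2_eq_square algebra_simps)
  finally show ?thesis .
qed

lemma inf_z_shift: "inf_z w (Suc j) = inf_z (inf_z w 1) j"
  by (induction j) simp_all

lemma inf_ends_shift:
  assumes "inf_ends (inf_z w 1)"
  shows "inf_ends w"
  using assms unfolding inf_ends_def inf_z_shift[symmetric] by blast

context imag_quadratic
begin

text \<open>Roots of positive definite integral binary quadratic forms with the discriminant of the order.
  The natural number \<open>a\<close> is the leading coefficient of the form. If the order is maximal, these are
  the points of the upper half plane whose lattice is proportional to an ideal.\<close>

definition is_pt :: "complex \<Rightarrow> nat \<Rightarrow> bool" where
  "is_pt x a \<longleftrightarrow> a > 0 \<and> (\<exists>c. int a dvd f c \<and> x = (\<theta> - of_int c) / of_nat a)"

definition pts :: "complex set" where "pts = {x. \<exists>a. is_pt x a}"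

lemma is_pt_theta: "is_pt \<theta> 1"
  unfolding is_pt_def by (auto intro: exI[of _ 0])

lemma is_pt_Im: "is_pt x a \<Longrightarrow> Im x = Im \<theta> / a \<and> a > 0 \<and> Im x > 0"
  unfolding is_pt_def using Im_theta by (auto simp: Im_divide_of_nat)

lemma f_pos: "f c > 0"
proof -
  have "complex_of_real (of_int (f c)) = of_real ((cmod (\<theta> - of_int c))\<^sup>2)"
    using theta_sub_norm[of c] unfolding norm_cmod by simp
  then have "real_of_int (f c) = (cmod (\<theta> - of_int c))\<^sup>2" by (simp only: of_real_eq_iff)
  moreover have "\<theta> - of_int c \<noteq> 0" using Im_theta by (auto simp: complex_eq_iff)
  ultimately have "real_of_int (f c) > 0" by simp
  then show ?thesis by simp
qed

lemma is_pt_shift: "is_pt x a \<Longrightarrow> is_pt (x - of_int b) a"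
proof -
  assume "is_pt x a"
  then obtain c where c: "a > 0" "int a dvd f c" "x = (\<theta> - of_int c) / of_nat a"
    by (auto simp: is_pt_def)
  have "f (c + int a * b) = f c + int a * (2 * c * b + int a * b ^ 2 + T * b)"
    by (simp add: f_def power2_eq_square algebra_simps)
  then have "int a dvd f (c + int a * b)" using c(2) by simp
  moreover have "x - of_int b = (\<theta> - of_int (c + int a * b)) / of_nat a"
    using c(1) by (simp add: c(3) field_simps)
  ultimately show ?thesis using c(1) unfolding is_pt_def by blast
qed

text \<open>With $f(c) = a a'$ the point $-1/x$ belongs to the form in which \<open>a\<close> and $a'$ are
  exchanged, and \<open>c\<close> is replaced by the other root $-T - c$.\<close>

lemma is_pt_inverse:
  assumes "is_pt x a"
  shows "\<exists>a'. is_pt (- 1 / x) a' \<and> real a' = real a * (cmod x)\<^sup>2"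
proof -
  obtain c where c: "a > 0" "int a dvd f c" "x = (\<theta> - of_int c) / of_nat a"
    using assms by (auto simp: is_pt_def)
  obtain a' where a': "f c = int a * a'" using c(2) by (elim dvdE)
  then have "a' > 0" using f_pos[of c] c(1) by (simp add: zero_less_mult_iff)
  have w: "(\<theta> - of_int c) * cnj (\<theta> - of_int c) = of_nat a * of_int a'"
    unfolding theta_sub_norm by (simp add: a')
  have nz: "\<theta> - of_int c \<noteq> 0" using Im_theta by (auto simp: complex_eq_iff)
  have "- 1 / x = - of_nat a / (\<theta> - of_int c)" by (simp add: c(3))
  also have "\<dots> = - cnj (\<theta> - of_int c) / of_int a'"
    using w nz \<open>a' > 0\<close> by (simp add: field_simps del: complex_cnj_diff)
  also have "- cnj (\<theta> - of_int c) = \<theta> - of_int (- T - c)" by (simp add: cnj_theta)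
  also have "complex_of_int a' = of_nat (nat a')" using \<open>a' > 0\<close> by simp
  finally have x': "- 1 / x = (\<theta> - of_int (- T - c)) / of_nat (nat a')" .
  have "f (- T - c) = f c" by (simp add: f_def power2_eq_square algebra_simps)
  then have "int (nat a') dvd f (- T - c)" using a' \<open>a' > 0\<close> by simp
  with x' have "is_pt (- 1 / x) (nat a')" using \<open>a' > 0\<close> unfolding is_pt_def by auto
  moreover have "real (nat a') = real a * (cmod x)\<^sup>2"
  proof -
    have "complex_of_real ((cmod (\<theta> - of_int c))\<^sup>2) = of_real (real a * of_int a')"
      using w unfolding norm_cmod by simp
    then have "(cmod (\<theta> - of_int c))\<^sup>2 = real a * of_int a'" by (simp only: of_real_eq_iff)
    then show ?thesis
      using c(1) \<open>a' > 0\<close> by (simp add: c(3) norm_divide power_divide power2_eq_square)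
  qed
  ultimately show ?thesis by blast
qed

lemma inf_z_pts: "w \<in> pts \<Longrightarrow> inf_z w j \<in> pts"
proof (induction j)
  case (Suc j)
  then show ?case using is_pt_shift is_pt_inverse unfolding pts_def by (simp, blast)
qed simp

text \<open>A reduction step lowers the leading coefficient as long as the shifted point is inside the unit
  disc. After that at most two more steps are needed, unless the shifted point is the corner
  $e^{2 \pi i / 3}$: the next shift after the inversion returns to the corner, and the reduction
  cycles.\<close>

lemma inf_ends_pt:
  assumes corner: "\<And>x a. is_pt x a \<Longrightarrow> cmod x = 1 \<Longrightarrow> Re x \<noteq> - 1 / 2"
  shows "is_pt x a \<Longrightarrow> inf_ends x"
proof (induction a arbitrary: x rule: less_induct)
  case (less a)
  define w where "w = x - of_int \<lfloor>Re x + 1 / 2\<rfloor>"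
  define y where "y = - 1 / w"
  have y1: "inf_z x 1 = y" by (simp add: y_def w_def)
  have w: "is_pt w a" unfolding w_def by (rule is_pt_shift[OF less.prems])
  have "Re w = Re x - of_int \<lfloor>Re x + 1 / 2\<rfloor>" by (simp add: w_def)
  then have Rew: "- 1 / 2 \<le> Re w" "Re w < 1 / 2" by linarith+
  have Imw: "Im w > 0" and a: "a > 0" using is_pt_Im[OF w] by auto
  obtain a' where a': "is_pt y a'" "real a' = real a * (cmod w)\<^sup>2"
    using is_pt_inverse[OF w] unfolding y_def by blast
  have Imy: "Im y > 0" using is_pt_Im[OF a'(1)] by auto
  have Rey: "Re y = - Re w / (cmod w)\<^sup>2"
    unfolding y_def by (simp add: Re_divide cmod_power2)
  show ?case
  proof (cases "cmod w < 1")
    case True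
    then have "(cmod w)\<^sup>2 < 1" by (simp add: power_less_one_iff)
    then have "real a' < real a" using a a'(2) by simp
    then have "inf_ends y" using less.IH[OF _ a'(1)] by simp
    then show ?thesis using y1 inf_ends_shift by metis
  next
    case False
    then have ge: "cmod w \<ge> 1" "(cmod w)\<^sup>2 \<ge> 1" by simp_all
    show ?thesis
    proof (cases "cmod w = 1 \<and> Re w > 0")
      case True
      have "cmod y = 1" using True by (simp add: y_def norm_divide)
      then have "y \<in> fund_domain" using True Rew Imy Rey by (simp add: fund_domain_iff)
      then have "inf_z x 1 \<in> fund_domain" by (simp only: y1)
      then show ?thesis unfolding inf_ends_def by blast
    next
      case F: False
      then have wD: "w \<in> fund_domain" using ge Rew Imw by (auto simp: fund_domain_iff)
      have "\<bar>Re w\<bar> / (cmod w)\<^sup>2 \<le> 1 / 2 \<and> Re y < 1 / 2"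
      proof
        have "\<bar>Re w\<bar> \<le> 1 / 2" using Rew by linarith
        also have "\<dots> \<le> 1 / 2 * (cmod w)\<^sup>2" using ge by simp
        finally show "\<bar>Re w\<bar> / (cmod w)\<^sup>2 \<le> 1 / 2" using ge by (simp add: divide_le_eq)
        show "Re y < 1 / 2"
        proof (cases "Re w = - 1 / 2")
          case True
          then have "cmod w \<noteq> 1" using corner[OF w] by auto
          then have "(cmod w)\<^sup>2 > 1" using ge by (simp add: one_less_power)
          then show ?thesis using ge unfolding Rey True by (subst pos_divide_less_eq) auto
        next
          case False
          then have "- Re w < 1 / 2" using Rew by linarith
          also have "\<dots> \<le> 1 / 2 * (cmod w)\<^sup>2" using ge by simp
          finally have "- Re w / (cmod w)\<^sup>2 < 1 / 2" using ge by (subst pos_divide_less_eq) auto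
          then show ?thesis by (simp add: Rey)
        qed
      qed
      moreover have "\<bar>Re y\<bar> = \<bar>Re w\<bar> / (cmod w)\<^sup>2" unfolding Rey by (simp add: abs_div)
      ultimately have "- 1 / 2 \<le> Re y" "Re y < 1 / 2" by linarith+
      then have "\<lfloor>Re y + 1 / 2\<rfloor> = 0" by (intro floor_unique) simp_all
      then have "inf_z y 1 = w" using Imw by (simp add: y_def)
      then have "inf_ends y" using wD unfolding inf_ends_def by metis
      then show ?thesis using y1 inf_ends_shift by metis
    qed
  qed
qed

text \<open>A reduced point has imaginary part at least $1/2$, which bounds \<open>a\<close>, and then the
  bound on its real part bounds \<open>c\<close>.\<close>

lemma finite_reduced: "finite (pts \<inter> fund_domain)"
proof -
  define A where "A = \<lceil>2 * Im \<theta>\<rceil>"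
  let ?S = "(\<lambda>(a, c). (\<theta> - of_int c) / of_int a) ` ({0..A} \<times> {- (1 + A)..1 + A})"
  have "x \<in> ?S" if x: "x \<in> pts" "x \<in> fund_domain" for x
  proof -
    obtain a c where ac: "a > 0" "x = (\<theta> - of_int c) / of_nat a"
      using x(1) by (auto simp: pts_def is_pt_def)
    have D: "Im x > 0" "\<bar>Re x\<bar> \<le> 1 / 2" "cmod x \<ge> 1" using x(2) by (auto simp: fund_domain_iff)
    have "1 \<le> (Re x)\<^sup>2 + (Im x)\<^sup>2" using D(3) by (simp flip: cmod_power2)
    moreover have "(Re x)\<^sup>2 \<le> (1 / 2)\<^sup>2" using D(2) by (subst abs_le_square_iff[symmetric]) simp
    ultimately have "(1 / 2)\<^sup>2 \<le> (Im x)\<^sup>2" by (simp add: power2_eq_square)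
    then have "1 / 2 \<le> Im x" using D(1) by (simp add: abs_le_square_iff[symmetric])
    moreover have "Im \<theta> = real a * Im x" using ac by (simp add: Im_divide_of_nat)
    ultimately have "real a * (1 / 2) \<le> Im \<theta>" by (metis mult_left_mono of_nat_0_le_iff)
    then have a: "int a \<le> A" unfolding A_def by linarith
    have "real_of_int c = Re \<theta> - real a * Re x" using ac by (simp add: Re_divide_of_nat)
    moreover have "\<bar>real a * Re x\<bar> \<le> real a * 1" unfolding abs_mult using D(2) by (intro mult_mono) auto
    moreover have "\<bar>Re \<theta>\<bar> \<le> 1"
    proof -
      have "Re (cnj \<theta>) = Re (- of_int T - \<theta>)" by (simp only: cnj_theta)
      then show ?thesis using trace_cases by auto
    qed
    ultimately have "\<bar>c\<bar> \<le> 1 + A" using a by linarith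
    with a ac show ?thesis by (intro image_eqI[of _ _ "(int a, c)"]) auto
  qed
  then have "pts \<inter> fund_domain \<subseteq> ?S" by blast
  moreover have "finite ?S" by (intro finite_imageI finite_cartesian_product) simp_all
  ultimately show ?thesis by (rule finite_subset)
qed

text \<open>By comparison of areas the generator has square absolute value $1/a$. As a vector of the
  lattice of a reduced point it is not shorter than 1, so $a = 1$, and the strip determines
  \<open>c\<close>.\<close>

lemma reduced_principal:
  assumes "x \<in> pts" "x \<in> fund_domain" "lat 1 x = lat \<mu> (\<mu> * \<theta>)"
  shows "x = \<theta>"
proof -
  obtain a c where ac: "a > 0" "x = (\<theta> - of_int c) / of_nat a"
    using assms(1) by (auto simp: pts_def is_pt_def)
  have Imx: "Im x = Im \<theta> / a" using ac by (simp add: Im_divide_of_nat)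
  have "area 1 x = Im x" by (simp add: area_def)
  moreover have "area \<mu> (\<mu> * \<theta>) = (cmod \<mu>)\<^sup>2 * Im \<theta>"
    using area_scale[of \<mu> 1 \<theta>] by (simp add: area_O_F)
  ultimately have "(cmod \<mu>)\<^sup>2 * Im \<theta> = Im \<theta> / a"
    using lat_eq_area[OF assms(3)] Im_theta Imx ac(1) by (simp add: abs_mult)
  then have l: "(cmod \<mu>)\<^sup>2 = 1 / a" using Im_theta ac(1) by (simp add: field_simps)
  have "\<mu> \<in> lat 1 x" using assms(3) lat_gen(1) by blast
  moreover have "\<mu> \<noteq> 0" using l ac(1) by auto
  ultimately have "1 \<le> 1 / real a" using fund_domain_short_vector[OF assms(2)] l by metis
  then have "a = 1" using ac(1) by (simp add: field_simps)
  then have x: "x = \<theta> - of_int c" using ac by simp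
  have "Re (cnj \<theta>) = Re (- of_int T - \<theta>)" by (simp only: cnj_theta)
  moreover have "- 1 / 2 \<le> Re x" "Re x < 1 / 2" using assms(2) by (auto simp: fund_domain_iff)
  ultimately have "c = 0" using trace_cases unfolding x by auto
  then show ?thesis by (simp add: x)
qed

end

context split_prime
begin

text \<open>An element of \<open>R\<close> is a power of \<open>p\<close> times a unit once its
  divisibility by \<open>p\<close> is bounded. A nonzero integer \<open>k\<close> provides the
  bound.\<close>

lemma p_val:
  assumes "x \<in> R" "\<And>m. x / of_nat p ^ m \<in> R \<Longrightarrow> int p ^ m dvd k" "k \<noteq> 0"
  shows "\<exists>m u. u \<in> R \<and> 1 / u \<in> R \<and> u \<noteq> 0 \<and> x = of_nat p ^ m * u"
proof -
  have bound: "m \<le> nat \<bar>k\<bar>" if "x / of_nat p ^ m \<in> R" for m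
  proof -
    have "int p ^ m \<le> \<bar>k\<bar>" using dvd_imp_le_int[OF assms(3) assms(2)[OF that]] by simp
    moreover have "int m < int p ^ m" using of_nat_less_iff[of m "p ^ m"] p_gt1 by (simp add: less_exp power_gt_expt)
    ultimately show ?thesis by linarith
  qed
  define m where "m = (GREATEST m. x / of_nat p ^ m \<in> R)"
  have m: "x / of_nat p ^ m \<in> R"
    unfolding m_def using bound by (intro GreatestI_nat[of "\<lambda>m. x / of_nat p ^ m \<in> R" 0]) (auto simp: assms(1))
  have "x / of_nat p ^ Suc m \<notin> R"
  proof
    assume "x / of_nat p ^ Suc m \<in> R"
    then have "Suc m \<le> m"
      unfolding m_def using bound by (intro Greatest_le_nat[of "\<lambda>m. x / of_nat p ^ m \<in> R"]) auto
    then show False by simp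
  qed
  then have n: "x / of_nat p ^ m / of_nat p \<notin> R" by (simp add: field_simps)
  then have "1 / (x / of_nat p ^ m) \<in> R" by (intro unit m)
  moreover have "x / of_nat p ^ m \<noteq> 0" using n zero_in by (metis div_0)
  moreover have "x = of_nat p ^ m * (x / of_nat p ^ m)" using p_pos by simp
  ultimately show ?thesis using m by blast
qed

text \<open>The numerator and the denominator of the point are powers of \<open>p\<close> times units of
  \<open>R\<close>; for the numerator this is seen from its norm.\<close>

lemma pts_in_R_or_inverse:
  assumes "x \<in> pts"
  shows "x \<in> R \<or> - 1 / x \<in> R"
proof -
  obtain a c where ac: "a > 0" "x = (\<theta> - of_int c) / of_nat a"
    using assms by (auto simp: pts_def is_pt_def)
  have "\<exists>k u. u \<in> R \<and> 1 / u \<in> R \<and> u \<noteq> 0 \<and> \<theta> - of_int c = of_nat p ^ k * u"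
  proof (rule p_val)
    show "f c \<noteq> 0" using f_pos[of c] by simp
    show "\<theta> - of_int c \<in> R" by (intro diff_in theta_in int_in)
    fix m assume "(\<theta> - of_int c) / of_nat p ^ m \<in> R"
    then have "(\<theta> - of_int c) / of_nat p ^ m * cnj (\<theta> - of_int c) \<in> R"
      by (rule mult_in[OF _ O_F_in[OF O_F_cnj[OF lat_diff[OF O_F_int(4) O_F_int(1)]]]])
    also have "(\<theta> - of_int c) / of_nat p ^ m * cnj (\<theta> - of_int c) = of_int (f c) / of_nat p ^ m"
      by (simp add: theta_sub_norm[symmetric])
    finally show "int p ^ m dvd f c" by (rule int_dvd)
  qed
  then obtain k u where u: "u \<in> R" "1 / u \<in> R" "u \<noteq> 0" "\<theta> - of_int c = of_nat p ^ k * u" by blast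
  have "\<exists>l v. v \<in> R \<and> 1 / v \<in> R \<and> v \<noteq> 0 \<and> of_nat a = of_nat p ^ l * v"
    by (rule p_val[of _ "int a"]) (use ac(1) int_dvd[of "int a"] in \<open>auto intro: nat_in\<close>)
  then obtain l v where v: "v \<in> R" "1 / v \<in> R" "v \<noteq> 0" "of_nat a = of_nat p ^ l * v" by blast
  show ?thesis
  proof (cases "l \<le> k")
    case True
    then have "x = of_nat (p ^ (k - l)) * (u * (1 / v))"
      using p_pos v(3) unfolding ac(2) u(4) v(4) by (simp add: field_simps flip: power_add)
    then have "x \<in> R" using u v by (metis mult_in nat_in)
    then show ?thesis ..
  next
    case False
    then have "- 1 / x = - (of_nat (p ^ (l - k)) * (v * (1 / u)))"
      using p_pos u(3) v(3) unfolding ac(2) u(4) v(4) by (simp add: field_simps flip: power_add)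
    then have "- 1 / x \<in> R" using u v by (metis mult_in nat_in minus_in)
    then show ?thesis ..
  qed
qed

text \<open>The leading coefficient is multiplied by $p^k$. Its p-part divides \<open>f c\<close> because
  it divides $\theta - c$ in \<open>R\<close>, and its part prime to \<open>p\<close> divides
  \<open>f c\<close> already before the step.\<close>

lemma pts_padic_step:
  assumes "x \<in> pts" "(x - of_int b) / of_nat p ^ k \<in> R"
  shows "(x - of_int b) / of_nat p ^ k \<in> pts"
proof -
  obtain a where "is_pt x a" using assms(1) by (auto simp: pts_def)
  then have "is_pt (x - of_int b) a" by (rule is_pt_shift)
  then obtain c where c: "a > 0" "int a dvd f c" "x - of_int b = (\<theta> - of_int c) / of_nat a"
    by (auto simp: is_pt_def)
  obtain l a0 where a0: "a = p ^ l * a0" "\<not> p dvd a0"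
    using multiplicity_decompose'[of a p] c(1) p_gt1 by (metis mult.commute nat_neq_iff not_gr_zero nat_dvd_1_iff_1)
  have "(\<theta> - of_int c) / of_nat p ^ (l + k) = of_nat a0 * ((x - of_int b) / of_nat p ^ k)"
    using p_pos c(1) unfolding c(3) by (simp add: a0(1) power_add)
  then have "(\<theta> - of_int c) / of_nat p ^ (l + k) \<in> R" using assms(2) by (metis mult_in nat_in)
  then have "(\<theta> - of_int c) / of_nat p ^ (l + k) * cnj (\<theta> - of_int c) \<in> R"
    by (rule mult_in[OF _ O_F_in[OF O_F_cnj[OF lat_diff[OF O_F_int(4) O_F_int(1)]]]])
  also have "(\<theta> - of_int c) / of_nat p ^ (l + k) * cnj (\<theta> - of_int c) = of_int (f c) / of_nat p ^ (l + k)"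
    by (simp add: theta_sub_norm[symmetric])
  finally have "int p ^ (l + k) dvd f c" by (rule int_dvd)
  moreover have "int a0 dvd f c" using c(2) a0(1) by (auto intro: dvd_mult_right)
  moreover have "coprime (int p ^ (l + k)) (int a0)"
    using a0(2) prime_p by (simp add: prime_imp_coprime)
  ultimately have "int p ^ (l + k) * int a0 dvd f c" by (rule divides_mult)
  then have "int (a * p ^ k) dvd f c" by (simp add: a0(1) power_add mult_ac)
  moreover have "(x - of_int b) / of_nat p ^ k = (\<theta> - of_int c) / of_nat (a * p ^ k)"
    by (simp add: c(3))
  ultimately have "is_pt ((x - of_int b) / of_nat p ^ k) (a * p ^ k)"
    unfolding is_pt_def using c(1) p_pos by auto
  then show ?thesis by (auto simp: pts_def)
qed

text \<open>The lattice of the new point is cut out of the lattice of the old one by a congruence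
  modulo the k-th power of the prime. The inclusion is a matter of divisibility, and equality
  follows by comparing areas.\<close>

lemma padic_step_ideal:
  assumes "lat u (u * z) = pow_ideal m" "(z - of_int b) / of_nat p ^ k \<in> R"
  shows "lat (u * of_nat p ^ k) (u * of_nat p ^ k * ((z - of_int b) / of_nat p ^ k)) = pow_ideal (m + k)"
proof -
  let ?v = "u * of_nat p ^ k * ((z - of_int b) / of_nat p ^ k)"
  have v: "?v = u * z - of_int b * u" using p_pos by (simp add: algebra_simps)
  have u: "u \<in> O_F" "u / of_nat p ^ m \<in> R" "u * z \<in> O_F"
    using assms(1) lat_gen by (auto simp: pow_ideal_def set_eq_iff)
  have "u * of_nat p ^ k \<in> pow_ideal (m + k)"
    using u p_pos by (auto simp: pow_ideal_def power_add intro!: O_F_mult O_F_power O_F_int)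
  moreover have "?v \<in> pow_ideal (m + k)"
  proof -
    have "?v / of_nat p ^ (m + k) = u / of_nat p ^ m * ((z - of_int b) / of_nat p ^ k)"
      using p_pos by (simp add: power_add)
    then have "?v / of_nat p ^ (m + k) \<in> R" using u(2) assms(2) by (metis mult_in)
    moreover have "?v \<in> O_F" unfolding v by (intro lat_diff u O_F_mult O_F_int)
    ultimately show ?thesis by (simp add: pow_ideal_def)
  qed
  moreover have "area (u * of_nat p ^ k) ?v = real p ^ k * area u (u * z)"
  proof -
    have "area (u * of_nat p ^ k) ?v
            = area (of_int (int p ^ k) * u + of_int 0 * (u * z)) (of_int (- b) * u + of_int 1 * (u * z))"
      unfolding v by (simp add: mult.commute)
    then show ?thesis unfolding area_det by simp
  qed
  moreover have "\<bar>area u (u * z)\<bar> = real p ^ m * Im \<theta>"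
    using lat_eq_area[OF assms(1)[unfolded pow_ideal_eq_lat]] Im_theta
    by (simp add: area_pow_ideal abs_mult)
  ultimately have "\<bar>area (u * of_nat p ^ k) ?v\<bar> = real p ^ (m + k) * Im \<theta>"
    by (simp add: abs_mult power_add mult_ac)
  then show ?thesis
    using \<open>u * of_nat p ^ k \<in> pow_ideal (m + k)\<close> \<open>?v \<in> pow_ideal (m + k)\<close> p_pos Im_theta
    unfolding pow_ideal_eq_lat by (intro lat_eqI) (simp_all add: area_pow_ideal)
qed

lemma lat_inversion: "x \<noteq> 0 \<Longrightarrow> lat (u * x) (u * x * (- 1 / x)) = lat u (u * x)"
  using lat_swap[of u "u * x"] by simp

lemma lat_translation: "lat u (u * (x - of_int b)) = lat u (u * x)"
  using lat_shift[of u "u * x" b] by (simp add: algebra_simps)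

text \<open>The ideals differ by the factor $\mathfrak{p}^k$, so \<open>\<mu>\<close> should generate it.
  The point is that \<open>\<mu>\<close> is integral at the conjugate prime, which holds because
  the ideal contains an element prime to that one.\<close>

lemma proportional_principal:
  assumes "(*) \<mu> ` pow_ideal m = pow_ideal (m + k)"
  shows "is_gen \<mu> k"
proof -
  have mem: "\<mu> * x \<in> pow_ideal (m + k)" if "x \<in> pow_ideal m" for x using assms that by blast
  have "(cmod \<mu>)\<^sup>2 * (real p ^ m * Im \<theta>) = real p ^ (m + k) * Im \<theta>"
    using lat_eq_area[OF assms[unfolded pow_ideal_eq_lat lat_scale]] Im_theta
    by (simp only: area_scale area_pow_ideal) (simp add: abs_mult)
  then have "(cmod \<mu>)\<^sup>2 = real p ^ k" using Im_theta p_pos by (simp add: power_add)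
  then have norm: "\<mu> * cnj \<mu> = of_nat p ^ k" by (simp add: is_gen_cmod)
  have "of_nat p ^ m \<in> pow_ideal m" unfolding pow_ideal_eq_lat by (rule lat_gen)
  from mem[OF this] have l: "\<mu> * of_nat p ^ m \<in> O_F" "\<mu> * of_nat p ^ m / of_nat p ^ (m + k) \<in> R"
    by (auto simp: pow_ideal_def)
  have lR: "\<mu> / of_nat p ^ k \<in> R" using l(2) p_pos by (simp add: power_add)
  then have lR': "\<mu> \<in> R" using div_power_le[of \<mu> k 0] by simp
  have "cnj \<mu> \<in> R"
  proof (cases "m = 0")
    case True
    then show ?thesis using l(1) by (auto intro: O_F_in O_F_cnj)
  next
    case False
    let ?w = "\<theta> - of_int (root_mod m)"
    have "?w \<in> pow_ideal m" unfolding pow_ideal_eq_lat by (rule lat_gen)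
    then have "cnj (\<mu> * ?w) \<in> R" "cnj ?w \<in> R" using mem
      by (auto simp: pow_ideal_def simp del: complex_cnj_mult complex_cnj_diff intro!: O_F_in O_F_cnj)
    moreover have "1 / cnj ?w \<in> R"
      using cnj_root_mod_unit[of m] False \<open>cnj ?w \<in> R\<close> by (intro unit) auto
    moreover have "cnj ?w \<noteq> 0" using Im_theta by (auto simp: complex_eq_iff)
    then have "cnj \<mu> = cnj (\<mu> * ?w) * (1 / cnj ?w)" by simp
    ultimately show ?thesis by (metis mult_in)
  qed
  then have "cnj (\<mu> * of_nat p ^ m) / of_nat p ^ m \<in> R" "\<mu> * of_nat p ^ m / of_nat p ^ m \<in> R"
    using lR' p_pos by simp_all
  then obtain y where "y \<in> O_F" "\<mu> * of_nat p ^ m = of_nat p ^ m * y"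
    using p_pow_dvd_int[OF l(1)] by blast
  then have "\<mu> \<in> O_F" using p_pos by simp
  then show ?thesis using lR norm by (simp add: is_gen_def pow_ideal_def)
qed

end

section \<open>Moebius transformations with automorphy factors\<close>

(* From here on the dollar sign denotes vector entries only; with the power series notation in
   scope every matrix entry parses in several ways. *)
no_notation fps_nth (infixl "$" 75)

lemma mat2_entries [simp]:
  "mat2 a b c d $ 1 $ 1 = a" "mat2 a b c d $ 1 $ 2 = b"
  "mat2 a b c d $ 2 $ 1 = c" "mat2 a b c d $ 2 $ 2 = d"
  by (simp_all add: mat2_def)

lemma mat_1_entries:
  "(mat 1 :: rat ^ 2 ^ 2) $ 1 $ 1 = 1" "(mat 1 :: rat ^ 2 ^ 2) $ 1 $ 2 = 0"
  "(mat 1 :: rat ^ 2 ^ 2) $ 2 $ 1 = 0" "(mat 1 :: rat ^ 2 ^ 2) $ 2 $ 2 = 1"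
  by (simp_all add: mat_def)

lemma matrix_mult_2_entry:
  "((A :: rat ^ 2 ^ 2) ** B) $ i $ j = A $ i $ 1 * B $ 1 $ j + A $ i $ 2 * B $ 2 $ j"
  by (simp add: matrix_matrix_mult_def sum_2)

text \<open>The matrix \<open>M\<close> sends \<open>x\<close> to \<open>y\<close> with automorphy factor \<open>e\<close>.\<close>

definition acts :: "rat ^ 2 ^ 2 \<Rightarrow> complex \<Rightarrow> complex \<Rightarrow> complex \<Rightarrow> bool" where
  "acts M x e y \<longleftrightarrow>
     of_rat (M $ 1 $ 1) * x + of_rat (M $ 1 $ 2) = e * y \<and>
     of_rat (M $ 2 $ 1) * x + of_rat (M $ 2 $ 2) = e"

lemma acts_id: "acts (mat 1) x 1 x"
  by (simp add: acts_def mat_1_entries)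

lemma acts_mult:
  assumes "acts M x e y" "acts M' y e' z"
  shows "acts (M' ** M) x (e * e') z"
proof -
  have M: "of_rat (M $ 1 $ 1) * x + of_rat (M $ 1 $ 2) = e * y"
          "of_rat (M $ 2 $ 1) * x + of_rat (M $ 2 $ 2) = e"
    using assms(1) by (simp_all add: acts_def)
  have M': "of_rat (M' $ 1 $ 1) * y + of_rat (M' $ 1 $ 2) = e' * z"
           "of_rat (M' $ 2 $ 1) * y + of_rat (M' $ 2 $ 2) = e'"
    using assms(2) by (simp_all add: acts_def)
  have row: "of_rat ((M' ** M) $ i $ 1) * x + of_rat ((M' ** M) $ i $ 2)
               = (of_rat (M' $ i $ 1) * y + of_rat (M' $ i $ 2)) * e" for i :: 2
  proof -
    have "of_rat ((M' ** M) $ i $ 1) * x + of_rat ((M' ** M) $ i $ 2)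
            = of_rat (M' $ i $ 1) * (of_rat (M $ 1 $ 1) * x + of_rat (M $ 1 $ 2))
              + of_rat (M' $ i $ 2) * (of_rat (M $ 2 $ 1) * x + of_rat (M $ 2 $ 2))"
      by (simp add: matrix_mult_2_entry of_rat_add of_rat_mult algebra_simps)
    then show ?thesis unfolding M by (simp add: algebra_simps)
  qed
  show ?thesis unfolding acts_def row M' by simp
qed

lemma SL2_Z_inv_int:
  fixes M :: "rat ^ 2 ^ 2"
  assumes "det M = 1" "\<And>i j. \<exists>a::int. M $ i $ j = of_int a"
  shows "M \<in> SL2_Z_inv q"
proof -
  have "\<exists>(a::int) n. M $ i $ j = of_int a / of_nat q ^ n" for i j :: 2
  proof -
    obtain a :: int where "M $ i $ j = of_int a" using assms(2) by blast
    then have "M $ i $ j = of_int a / of_nat q ^ 0" by simp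
    then show ?thesis by blast
  qed
  then show ?thesis using assms(1) by (simp add: SL2_Z_inv_def)
qed

lemma SL2_Z_inv_mult:
  assumes "A \<in> SL2_Z_inv q" "B \<in> SL2_Z_inv q" "q > 0"
  shows "A ** B \<in> SL2_Z_inv q"
proof -
  have mult: "\<exists>(c::int) n. x * y = of_int c / of_nat q ^ n"
    if h: "\<exists>(a::int) n. x = of_int a / of_nat q ^ n" "\<exists>(b::int) n. y = of_int b / of_nat q ^ n" for x y :: rat
  proof -
    obtain a n b m where xy: "x = of_int a / of_nat q ^ n" "y = of_int b / of_nat q ^ m"
      using h by blast
    have "x * y = of_int (a * b) / of_nat q ^ (n + m)" unfolding xy by (simp add: power_add)
    then show ?thesis by blast
  qed
  have add: "\<exists>(c::int) n. x + y = of_int c / of_nat q ^ n"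
    if h: "\<exists>(a::int) n. x = of_int a / of_nat q ^ n" "\<exists>(b::int) n. y = of_int b / of_nat q ^ n" for x y :: rat
  proof -
    obtain a n b m where xy: "x = of_int a / of_nat q ^ n" "y = of_int b / of_nat q ^ m"
      using h by blast
    have "x + y = of_int (a * int q ^ m + b * int q ^ n) / of_nat q ^ (n + m)"
      using assms(3) unfolding xy by (simp add: power_add add_divide_distrib)
    then show ?thesis by blast
  qed
  have "\<exists>(c::int) n. (A ** B) $ i $ j = of_int c / of_nat q ^ n" for i j :: 2
    unfolding matrix_mult_2_entry
    using assms(1,2) by (intro add mult) (simp_all add: SL2_Z_inv_def)
  then show ?thesis using assms(1,2) by (simp add: SL2_Z_inv_def det_mul)
qed

lemma matrix_inv_eqI:
  fixes A B :: "rat ^ 2 ^ 2"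
  assumes "A ** B = mat 1" "B ** A = mat 1"
  shows "matrix_inv A = B"
proof -
  have "A ** matrix_inv A = mat 1 \<and> matrix_inv A ** A = mat 1"
    unfolding matrix_inv_def using assms by (intro someI) auto
  moreover have "(B ** A) ** matrix_inv A = B ** (A ** matrix_inv A)"
    by (simp only: matrix_mul_assoc)
  ultimately show ?thesis using assms(2) by simp
qed

lemma matrix_inv_SL2:
  fixes A :: "rat ^ 2 ^ 2"
  assumes "det A = 1"
  shows "A ** matrix_inv A = mat 1" "matrix_inv A ** A = mat 1"
proof -
  let ?B = "mat2 (A $ 2 $ 2) (- A $ 1 $ 2) (- A $ 2 $ 1) (A $ 1 $ 1)"
  have "A $ 1 $ 1 * A $ 2 $ 2 - A $ 1 $ 2 * A $ 2 $ 1 = 1" using assms by (simp add: det_2)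
  then have "A ** ?B = mat 1" "?B ** A = mat 1"
    by (simp_all add: vec_eq_iff forall_2 matrix_mult_2_entry mat_1_entries algebra_simps)
  then show "A ** matrix_inv A = mat 1" "matrix_inv A ** A = mat 1"
    using matrix_inv_eqI by auto
qed

section \<open>The ideals attached to the continued fraction\<close>

locale padic_cf =
  split_prime T n \<theta> "CARD('p)" "Zp_in \<iota>"
  for T n :: int and \<theta> :: complex and \<iota> :: "complex \<Rightarrow> 'p::prime_card padic alg_closure"
begin

lemma cf_z_pts: "x \<in> pts \<Longrightarrow> cf_z \<iota> x \<in> pts \<and> cf_z \<iota> x \<in> Zp_in \<iota>"
  using pts_in_R_or_inverse[of x] is_pt_inverse unfolding cf_z_def cf_delta_def pts_def by auto

lemma cf_a:
  assumes "cf_z \<iota> x \<in> Zp_in \<iota>"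
  shows "(cf_z \<iota> x - of_int (cf_a \<iota> x)) / of_nat CARD('p) ^ 2 \<in> Zp_in \<iota>"
proof -
  let ?z = "cf_z \<iota> x" and ?q = "of_nat CARD('p) :: complex"
  have q: "?q \<noteq> 0" by simp
  have iff: "(\<exists>y \<in> Zp_in \<iota>. ?z - of_int a = ?q ^ 2 * y) \<longleftrightarrow> (?z - of_int a) / ?q ^ 2 \<in> Zp_in \<iota>" for a
    using q by (auto simp: bex_simps field_simps intro!: bexI[of _ "(?z - of_int a) / ?q ^ 2"])
  obtain a0 where a0: "(?z - of_int a0) / ?q ^ 2 \<in> Zp_in \<iota>" using approx[OF assms] by blast
  define a where "a = a0 mod int CARD('p) ^ 2"
  have a0': "a0 = a + int CARD('p) ^ 2 * (a0 div int CARD('p) ^ 2)" by (simp add: a_def)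
  have "(?z - of_int a0) / ?q ^ 2 + of_int (a0 div int CARD('p) ^ 2) \<in> Zp_in \<iota>"
    by (intro add_in a0 int_in)
  also have "(?z - of_int a0) / ?q ^ 2 + of_int (a0 div int CARD('p) ^ 2) = (?z - of_int a) / ?q ^ 2"
  proof -
    have "(of_int a0 :: complex) = of_int a + ?q ^ 2 * of_int (a0 div int CARD('p) ^ 2)"
      by (subst a0') simp
    then show ?thesis using q by (simp add: field_simps)
  qed
  finally have a: "(?z - of_int a) / ?q ^ 2 \<in> Zp_in \<iota>" .
  have range: "a \<in> {0..<int CARD('p) ^ 2}" by (simp add: a_def)
  have "\<exists>!a. a \<in> {0..<int CARD('p) ^ 2} \<and> (\<exists>y \<in> Zp_in \<iota>. ?z - of_int a = ?q ^ 2 * y)"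
    unfolding iff
  proof (intro ex1I[of _ a] conjI a range)
    fix b assume b: "b \<in> {0..<int CARD('p) ^ 2} \<and> (?z - of_int b) / ?q ^ 2 \<in> Zp_in \<iota>"
    then have "(?z - of_int b) / ?q ^ 2 - (?z - of_int a) / ?q ^ 2 \<in> Zp_in \<iota>"
      by (intro diff_in a) auto
    also have "(?z - of_int b) / ?q ^ 2 - (?z - of_int a) / ?q ^ 2 = of_int (a - b) / ?q ^ 2"
      by (simp add: diff_divide_distrib)
    finally have "int CARD('p) ^ 2 dvd a - b" by (rule int_dvd)
    then have "a mod int CARD('p) ^ 2 = b mod int CARD('p) ^ 2" by (simp add: mod_eq_dvd_iff)
    then show "b = a" using b range by simp
  qed
  from theI'[OF this, folded cf_a_def] show ?thesis using iff by blast
qed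

lemma cf_z0_pts: "x \<in> pts \<Longrightarrow> cf_z0 \<iota> x \<in> pts"
  using cf_z_pts[of x] pts_padic_step[of "cf_z \<iota> x" "cf_a \<iota> x" 2] cf_a[of x]
  by (simp add: cf_z0_def)

lemma cf_next_pts: "x \<in> pts \<Longrightarrow> cf_next \<iota> x \<in> pts"
  unfolding cf_next_def by (intro inf_z_pts cf_z0_pts)

lemma pts_Im: "x \<in> pts \<Longrightarrow> Im x > 0"
  using is_pt_Im by (auto simp: pts_def)

lemma cf_D_step:
  assumes "x \<in> pts"
  shows "\<exists>e. acts (cf_D \<iota> x) x e (cf_z \<iota> x) \<and> (\<forall>u. lat (u * e) (u * e * cf_z \<iota> x) = lat u (u * x))"
proof (cases "cf_delta \<iota> x = 1")
  case True
  then show ?thesis by (auto simp: cf_D_def cf_z_def intro!: exI[of _ 1] acts_id)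
next
  case False
  have "x \<noteq> 0" using pts_Im[OF assms] by auto
  then show ?thesis using False lat_inversion[of x]
    by (auto simp: cf_D_def cf_z_def acts_def intro!: exI[of _ x])
qed

lemma cf_P_step: "acts (cf_P \<iota> x) (cf_z \<iota> x) (of_nat CARD('p)) (cf_z0 \<iota> x)"
  by (simp add: acts_def cf_P_def matrix_mult_2_entry cf_z0_def of_rat_divide of_rat_minus of_rat_mult
      field_simps power2_eq_square)

text \<open>Inversions and translations preserve the lattice of a point up to the automorphy factor.\<close>

lemma inf_Q_step:
  assumes "w \<in> pts"
  shows "\<exists>e. acts (inf_Q w j) w e (inf_z w j) \<and> (\<forall>u. lat (u * e) (u * e * inf_z w j) = lat u (u * w))"
proof (induction j)
  case 0
  then show ?case by (auto intro!: exI[of _ 1] acts_id)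
next
  case (Suc j)
  then obtain e where e: "acts (inf_Q w j) w e (inf_z w j)"
      "\<And>u. lat (u * e) (u * e * inf_z w j) = lat u (u * w)" by blast
  define v where "v = inf_z w j - of_int (inf_b w j)"
  have "Im v > 0" using pts_Im[OF inf_z_pts[OF assms, of j]] by (simp add: v_def)
  then have "v \<noteq> 0" by auto
  then have "acts (mat2 0 (- 1) 1 (- of_int (inf_b w j))) (inf_z w j) v (inf_z w (Suc j))"
    by (simp add: acts_def v_def inf_b_def of_rat_minus)
  then have "acts (inf_Q w (Suc j)) w (e * v) (inf_z w (Suc j))"
    using acts_mult[OF e(1)] by simp
  moreover have "lat (u * (e * v)) (u * (e * v) * inf_z w (Suc j)) = lat u (u * w)" for u
    using lat_inversion[OF \<open>v \<noteq> 0\<close>, of "u * e"] lat_translation[of "u * e" "inf_z w j" "inf_b w j"] e(2)[of u]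
    by (simp add: v_def inf_b_def mult.assoc)
  ultimately show ?case by blast
qed

text \<open>The matrix $A_k^{-1}$ of the algorithm at $x = x_k$.\<close>

definition cf_W :: "complex \<Rightarrow> rat ^ 2 ^ 2" where
  "cf_W x = cf_Q \<iota> x ** cf_P \<iota> x ** cf_D \<iota> x"

text \<open>Only the p-adic reduction changes the lattice. Its matrix contributes the automorphy factor
  \<open>p\<close>, and the normalizing power of \<open>p\<close> contributes another one, which
  makes up the $p^2$ of \<open>padic_step_ideal\<close>.\<close>

lemma cf_W_step:
  assumes "x \<in> pts"
  shows "\<exists>e. acts (cf_W x) x e (cf_next \<iota> x) \<and>
             (\<forall>u m. lat u (u * x) = pow_ideal m \<longrightarrow>
                lat (of_nat CARD('p) * u * e) (of_nat CARD('p) * u * e * cf_next \<iota> x) = pow_ideal (m + 2))"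
proof -
  let ?q = "of_nat CARD('p) :: complex"
  obtain e1 where e1: "acts (cf_D \<iota> x) x e1 (cf_z \<iota> x)"
      "\<And>u. lat (u * e1) (u * e1 * cf_z \<iota> x) = lat u (u * x)"
    using cf_D_step[OF assms] by blast
  obtain e2 where e2: "acts (cf_Q \<iota> x) (cf_z0 \<iota> x) e2 (cf_next \<iota> x)"
      "\<And>u. lat (u * e2) (u * e2 * cf_next \<iota> x) = lat u (u * cf_z0 \<iota> x)"
    using inf_Q_step[OF cf_z0_pts[OF assms]] unfolding cf_Q_def cf_next_def by blast
  have "acts (cf_W x) x (e1 * (?q * e2)) (cf_next \<iota> x)"
    unfolding cf_W_def by (intro acts_mult[OF e1(1)] acts_mult[OF cf_P_step] e2(1))
  moreover have "lat (?q * u * (e1 * (?q * e2))) (?q * u * (e1 * (?q * e2)) * cf_next \<iota> x) = pow_ideal (m + 2)"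
    if "lat u (u * x) = pow_ideal m" for u m
  proof -
    have "lat (u * e1 * ?q ^ 2) (u * e1 * ?q ^ 2 * cf_z0 \<iota> x) = pow_ideal (m + 2)"
      unfolding cf_z0_def using that cf_z_pts[OF assms] by (intro padic_step_ideal cf_a) (auto simp: e1(2))
    then show ?thesis using e2(2)[of "u * e1 * ?q ^ 2"] by (simp add: power2_eq_square mult_ac)
  qed
  ultimately show ?thesis by blast
qed

lemma cf_W_SL2: "cf_W x \<in> SL2_Z_inv CARD('p)"
proof -
  have int: "mat2 (of_int a) (of_int b) (of_int c) (of_int d) \<in> SL2_Z_inv q" if "a * d - b * c = 1" for a b c d q
  proof (rule SL2_Z_inv_int)
    show "det (mat2 (of_int a) (of_int b) (of_int c) (of_int d)) = 1"
      using that by (simp add: det_2 flip: of_int_mult of_int_diff)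
    show "\<exists>e::int. mat2 (of_int a) (of_int b) (of_int c) (of_int d) $ i $ j = of_int e" for i j :: 2
      using exhaust_2[of i] exhaust_2[of j] by auto
  qed
  have one: "mat 1 = mat2 (of_int 1) (of_int 0) (of_int 0) (of_int 1)"
    by (simp add: vec_eq_iff forall_2 mat_1_entries)
  have id: "mat 1 \<in> SL2_Z_inv q" for q unfolding one by (rule int) simp
  have D: "cf_D \<iota> x \<in> SL2_Z_inv CARD('p)"
    using int[of 0 0 "- 1" 1] id by (simp add: cf_D_def)
  have P1: "mat2 (1 / of_nat CARD('p)) 0 0 (of_nat CARD('p)) \<in> SL2_Z_inv CARD('p)"
  proof -
    have "\<exists>(a::int) n. mat2 (1 / of_nat CARD('p)) 0 0 (of_nat CARD('p)) $ i $ j = of_int a / of_nat CARD('p) ^ n" for i j :: 2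
    proof -
      have "(1 / of_nat CARD('p) :: rat) = of_int 1 / of_nat CARD('p) ^ 1"
           "(0 :: rat) = of_int 0 / of_nat CARD('p) ^ 0"
           "(of_nat CARD('p) :: rat) = of_int (int CARD('p)) / of_nat CARD('p) ^ 0" by simp_all
      then show ?thesis using exhaust_2[of i] exhaust_2[of j] mat2_entries by metis
    qed
    then show ?thesis by (simp add: SL2_Z_inv_def det_2)
  qed
  have P2: "mat2 1 (- of_int (cf_a \<iota> x)) 0 1 \<in> SL2_Z_inv CARD('p)"
    using int[of 1 1 "- cf_a \<iota> x" 0] by simp
  have Q: "inf_Q w j \<in> SL2_Z_inv CARD('p)" for w j
  proof (induction j)
    case (Suc j)
    have "mat2 0 (- 1) 1 (- of_int (inf_b w j)) \<in> SL2_Z_inv CARD('p)"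
      using int[of 0 "- inf_b w j" "- 1" 1] by simp
    then show ?case using Suc by (simp add: SL2_Z_inv_mult)
  qed (simp add: id)
  show ?thesis unfolding cf_W_def cf_Q_def cf_P_def
    by (intro SL2_Z_inv_mult D P1 P2 Q) simp_all
qed

lemma cf_x_Suc: "cf_x \<iota> \<theta> (Suc (Suc k)) = cf_next \<iota> (cf_x \<iota> \<theta> (Suc k))"
  by (simp add: cf_x_def)

lemma cf_x_1: "cf_x \<iota> \<theta> (Suc 0) = \<theta>"
  by (simp add: cf_x_def)

lemma cf_x_pts: "cf_x \<iota> \<theta> (Suc k) \<in> pts"
proof (induction k)
  case 0
  show ?case using is_pt_theta unfolding cf_x_1 pts_def by blast
qed (simp add: cf_x_Suc cf_next_pts)

text \<open>The invariant of the algorithm: up to the factor $p^k \epsilon_k$, where $\epsilon_k$ is the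
  automorphy factor of $B_k^{-1}$, the lattice of $x_{k + 1}$ is the $2k$-th power of the prime.\<close>

lemma cf_invariant:
  "\<exists>M e. M = matrix_inv (cf_B \<iota> \<theta> k) \<and> M \<in> SL2_Z_inv CARD('p) \<and> acts M \<theta> e (cf_x \<iota> \<theta> (Suc k)) \<and>
     lat (of_nat CARD('p) ^ k * e) (of_nat CARD('p) ^ k * e * cf_x \<iota> \<theta> (Suc k)) = pow_ideal (2 * k)"
proof -
  let ?q = "of_nat CARD('p) :: complex"
  have "\<exists>M e. cf_B \<iota> \<theta> k ** M = mat 1 \<and> M ** cf_B \<iota> \<theta> k = mat 1 \<and>
     M \<in> SL2_Z_inv CARD('p) \<and> acts M \<theta> e (cf_x \<iota> \<theta> (Suc k)) \<and>
     lat (?q ^ k * e) (?q ^ k * e * cf_x \<iota> \<theta> (Suc k)) = pow_ideal (2 * k)"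
  proof (induction k)
    case 0
    have "mat 1 \<in> SL2_Z_inv CARD('p)"
    proof (rule SL2_Z_inv_int)
      show "\<exists>a::int. mat 1 $ i $ j = (of_int a :: rat)" for i j :: 2
        by (cases "i = j") (auto simp: mat_def intro: exI[of _ 0] exI[of _ 1])
    qed simp
    moreover have "pow_ideal 0 = lat 1 \<theta>" unfolding pow_ideal_def using O_F_in by auto
    ultimately show ?case
      by (intro exI[of _ "mat 1"] exI[of _ 1]) (simp add: cf_x_1 acts_id)
  next
    case (Suc k)
    let ?x = "cf_x \<iota> \<theta> (Suc k)"
    obtain M e where M: "cf_B \<iota> \<theta> k ** M = mat 1" "M ** cf_B \<iota> \<theta> k = mat 1"
        "M \<in> SL2_Z_inv CARD('p)" "acts M \<theta> e ?x"
        "lat (?q ^ k * e) (?q ^ k * e * ?x) = pow_ideal (2 * k)"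
      using Suc by blast
    obtain e' where e': "acts (cf_W ?x) ?x e' (cf_next \<iota> ?x)"
        "\<And>u m. lat u (u * ?x) = pow_ideal m \<Longrightarrow>
           lat (?q * u * e') (?q * u * e' * cf_next \<iota> ?x) = pow_ideal (m + 2)"
      using cf_W_step[OF cf_x_pts] by blast
    have W: "det (cf_W ?x) = 1" using cf_W_SL2[of ?x] by (simp add: SL2_Z_inv_def)
    have B: "cf_B \<iota> \<theta> (Suc k) = cf_B \<iota> \<theta> k ** matrix_inv (cf_W ?x)"
      by (simp add: cf_A_def cf_W_def Let_def)
    have "cf_B \<iota> \<theta> (Suc k) ** (cf_W ?x ** M)
            = cf_B \<iota> \<theta> k ** (matrix_inv (cf_W ?x) ** cf_W ?x) ** M"
      unfolding B by (simp only: matrix_mul_assoc)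
    then have 1: "cf_B \<iota> \<theta> (Suc k) ** (cf_W ?x ** M) = mat 1"
      by (simp add: matrix_inv_SL2[OF W] M(1))
    have "(cf_W ?x ** M) ** cf_B \<iota> \<theta> (Suc k)
            = cf_W ?x ** (M ** cf_B \<iota> \<theta> k) ** matrix_inv (cf_W ?x)"
      unfolding B by (simp only: matrix_mul_assoc)
    then have 2: "(cf_W ?x ** M) ** cf_B \<iota> \<theta> (Suc k) = mat 1"
      by (simp add: matrix_inv_SL2[OF W] M(2))
    have 3: "acts (cf_W ?x ** M) \<theta> (e * e') (cf_x \<iota> \<theta> (Suc (Suc k)))"
      unfolding cf_x_Suc by (rule acts_mult[OF M(4) e'(1)])
    have "lat (?q ^ Suc k * (e * e')) (?q ^ Suc k * (e * e') * cf_x \<iota> \<theta> (Suc (Suc k))) = pow_ideal (2 * Suc k)"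
      using e'(2)[OF M(5)] unfolding cf_x_Suc by (simp add: mult_ac)
    with 1 2 3 M(3) cf_W_SL2[of ?x] show ?case
      by (intro exI[of _ "cf_W ?x ** M"] exI[of _ "e * e'"]) (simp add: SL2_Z_inv_mult)
  qed
  then obtain M e where M: "cf_B \<iota> \<theta> k ** M = mat 1" "M ** cf_B \<iota> \<theta> k = mat 1"
      "M \<in> SL2_Z_inv CARD('p)" "acts M \<theta> e (cf_x \<iota> \<theta> (Suc k))"
      "lat (?q ^ k * e) (?q ^ k * e * cf_x \<iota> \<theta> (Suc k)) = pow_ideal (2 * k)"
    by blast
  then show ?thesis using matrix_inv_eqI[OF M(1,2)] by blast
qed

lemma cf_x_fund_domain:
  assumes "cf_well_defined \<iota> \<theta>"
  shows "cf_x \<iota> \<theta> (Suc (Suc k)) \<in> fund_domain"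
proof -
  have "inf_ends (cf_z0 \<iota> (cf_x \<iota> \<theta> (Suc k)))" using assms by (simp add: cf_well_defined_def)
  then show ?thesis unfolding cf_x_Suc cf_next_def inf_len_def inf_ends_def by (rule LeastI_ex)
qed

lemma cf_well_defined_if_no_corner:
  assumes "\<And>x a. is_pt x a \<Longrightarrow> cmod x = 1 \<Longrightarrow> Re x \<noteq> - 1 / 2"
  shows "cf_well_defined \<iota> \<theta>"
  unfolding cf_well_defined_def
proof (intro allI impI)
  fix k :: nat assume "k \<ge> 1"
  then obtain j where "k = Suc j" by (cases k) auto
  then show "inf_ends (cf_z0 \<iota> (cf_x \<iota> \<theta> k))"
    using cf_z0_pts[OF cf_x_pts[of j]] inf_ends_pt[OF assms] by (auto simp: pts_def)
qed

text \<open>By the invariant, the lattice of the point is proportional to $\mathfrak{p}^{2k}$, and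
  \<open>\<theta>\<close> is the only reduced point with a principal lattice.\<close>

lemma cf_x_return_iff:
  assumes "cf_well_defined \<iota> \<theta>" "k \<ge> 1"
  shows "cf_x \<iota> \<theta> (k + 1) = \<theta> \<longleftrightarrow> (\<exists>y. is_gen y (2 * k))"
proof -
  obtain v where v: "lat v (v * cf_x \<iota> \<theta> (Suc k)) = pow_ideal (2 * k)"
    using cf_invariant[of k] by blast
  show ?thesis
  proof
    assume "cf_x \<iota> \<theta> (k + 1) = \<theta>"
    then show "\<exists>y. is_gen y (2 * k)" using v is_gen_iff by auto
  next
    assume "\<exists>y. is_gen y (2 * k)"
    then obtain y where y: "lat y (y * \<theta>) = lat v (v * cf_x \<iota> \<theta> (Suc k))"
      using v by (auto simp: is_gen_iff)
    have "v \<noteq> 0"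
    proof
      assume "v = 0"
      then have "\<bar>area 0 0\<bar> = real CARD('p) ^ (2 * k) * Im \<theta>"
        using lat_eq_area[OF v[unfolded pow_ideal_eq_lat]] Im_theta by (simp add: area_pow_ideal)
      then show False using Im_theta by (simp add: area_def)
    qed
    have "(*) (1 / v) ` lat y (y * \<theta>) = (*) (1 / v) ` lat v (v * cf_x \<iota> \<theta> (Suc k))"
      by (simp only: y)
    then have "lat 1 (cf_x \<iota> \<theta> (Suc k)) = lat (1 / v * y) (1 / v * y * \<theta>)"
      unfolding lat_scale using \<open>v \<noteq> 0\<close> by simp
    moreover have "cf_x \<iota> \<theta> (Suc k) \<in> fund_domain"
      using cf_x_fund_domain[OF assms(1), of "k - 1"] assms(2) by simp
    ultimately have "cf_x \<iota> \<theta> (Suc k) = \<theta>"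
      by (intro reduced_principal cf_x_pts)
    then show "cf_x \<iota> \<theta> (k + 1) = \<theta>" by simp
  qed
qed

text \<open>There are finitely many reduced points, so one is reached at two different times. The powers of
  the prime at these times are proportional.\<close>

lemma exists_principal_power:
  assumes "cf_well_defined \<iota> \<theta>"
  shows "\<exists>k\<ge>1. \<exists>y. is_gen y (2 * k)"
proof -
  let ?X = "\<lambda>k. cf_x \<iota> \<theta> (Suc (Suc k))"
  have "range ?X \<subseteq> pts \<inter> fund_domain" using cf_x_pts cf_x_fund_domain[OF assms] by blast
  then have "finite (range ?X)" using finite_reduced finite_subset by blast
  then have "\<not> inj ?X" using finite_imageD[of ?X UNIV] by auto
  then obtain i j where ij: "i < j" "?X i = ?X j" unfolding inj_def by (metis linorder_neqE_nat)
  define m k where "m = Suc i" and "k = j - i"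
  have k: "k \<ge> 1" "Suc j = m + k" using ij(1) by (auto simp: m_def k_def)
  define x where "x = cf_x \<iota> \<theta> (Suc m)"
  have x: "x = cf_x \<iota> \<theta> (Suc (m + k))" using ij(2) k(2) by (simp add: x_def m_def)
  obtain v where v: "lat v (v * x) = pow_ideal (2 * m)" using cf_invariant[of m] unfolding x_def by blast
  obtain w where w: "lat w (w * x) = pow_ideal (2 * (m + k))"
    using cf_invariant[of "m + k"] unfolding x by blast
  have "v \<noteq> 0"
  proof
    assume "v = 0"
    then have "\<bar>area 0 0\<bar> = real CARD('p) ^ (2 * m) * Im \<theta>"
      using lat_eq_area[OF v[unfolded pow_ideal_eq_lat]] Im_theta by (simp add: area_pow_ideal)
    then show False using Im_theta by (simp add: area_def)
  qed
  then have "(*) (w / v) ` pow_ideal (2 * m) = pow_ideal (2 * m + 2 * k)"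
    unfolding v[symmetric] lat_scale using w by (simp add: distrib_left)
  then have "is_gen (w / v) (2 * k)" by (rule proportional_principal)
  then show ?thesis using k(1) by blast
qed

end

section \<open>Integers of an imaginary quadratic field\<close>

lemma lat_sum: "(\<And>i. i \<in> A \<Longrightarrow> g i \<in> lat \<alpha> \<beta>) \<Longrightarrow> sum g A \<in> lat \<alpha> \<beta>"
  by (induction A rule: infinite_finite_induct) (auto intro: lat_gen lat_add)

lemma rat_denominator_dvd:
  fixes r :: rat
  assumes "\<And>u v. coprime u v \<Longrightarrow> v > 0 \<Longrightarrow> r = of_int u / of_int v \<Longrightarrow> v dvd (1::int)"
  shows "r \<in> \<int>"
proof -
  obtain u v where uv: "quotient_of r = (u, v)" by (cases "quotient_of r")
  then have r: "r = of_int u / of_int v" "v > 0" "coprime u v"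
    using quotient_of_div quotient_of_denom_pos quotient_of_coprime by blast+
  then have "v dvd 1" using assms by blast
  then have "v = 1" using r(2) by auto
  then show ?thesis using r(1) by simp
qed

lemma rat_integral_if_powers_bounded_denominator:
  fixes r :: rat and D :: int
  assumes "D \<noteq> 0" "\<And>k. of_int D * r ^ k \<in> \<int>"
  shows "r \<in> \<int>"
proof (rule rat_denominator_dvd)
  fix u v assume uv: "coprime u v" "v > 0" "r = of_int u / of_int v"
  have dvd: "v ^ k dvd D" for k
  proof -
    obtain m where "of_int D * r ^ k = of_int m" using assms(2)[of k] by (auto elim: Ints_cases)
    then have "of_int (D * u ^ k) = (of_int (m * v ^ k) :: rat)"
      using uv(2) by (simp add: uv(3) power_divide field_simps)
    then have "D * u ^ k = m * v ^ k" by (simp only: of_int_eq_iff)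
    then have "v ^ k dvd D * u ^ k" by simp
    moreover have "coprime (v ^ k) (u ^ k)" using uv(1) by (simp add: coprime_commute)
    ultimately show ?thesis by (simp add: coprime_dvd_mult_left_iff)
  qed
  have "\<not> v > 1"
  proof
    assume "v > 1"
    then have "int (nat \<bar>D\<bar>) < v ^ nat \<bar>D\<bar>"
      using power_gt_expt[of "nat v" "nat \<bar>D\<bar>"] by (metis (no_types) less_imp_le nat_int of_nat_less_iff of_nat_power int_nat_eq uv(2) nat_1 One_nat_def nat_less_iff of_nat_1 zero_le_one)
    moreover have "v ^ nat \<bar>D\<bar> \<le> \<bar>D\<bar>" using dvd_imp_le_int[OF assms(1) dvd] uv(2) by simp
    ultimately show False by simp
  qed
  then show "v dvd 1" using uv(2) by simp
qed

lemma rat_integral_if_squarefree_mult_square: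
  fixes r :: rat and d :: int
  assumes "squarefree d" "of_int d * r ^ 2 \<in> \<int>"
  shows "r \<in> \<int>"
proof (rule rat_denominator_dvd)
  fix u v assume uv: "coprime u v" "v > 0" "r = of_int u / of_int v"
  obtain m where "of_int d * r ^ 2 = of_int m" using assms(2) by (auto elim: Ints_cases)
  then have "of_int (d * u ^ 2) = (of_int (m * v ^ 2) :: rat)"
    using uv(2) by (simp add: uv(3) power_divide field_simps)
  then have "d * u ^ 2 = m * v ^ 2" by (simp only: of_int_eq_iff)
  then have "v ^ 2 dvd d * u ^ 2" by simp
  moreover have "coprime (v ^ 2) (u ^ 2)" using uv(1) by (simp add: coprime_commute)
  ultimately have "v ^ 2 dvd d" by (simp add: coprime_dvd_mult_left_iff)
  then show "v dvd 1" using assms(1) by (rule squarefreeD[rotated])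
qed

locale imag_quad_field = imag_quadratic T n \<theta> for T n :: int and \<theta> :: complex +
  fixes d :: int
  assumes d_pos: "d > 0" and d_squarefree: "squarefree d"
    and trace_norm:
      "(T = 1 \<and> 4 * n = 1 + d \<and> \<theta> = (- 1 + sqrt_neg d) / 2) \<or>
       (T = 0 \<and> n = d \<and> \<not> [- d = 1] (mod 4) \<and> \<theta> = sqrt_neg d)"
begin

lemma quad_field_eq: "quad_field d = {of_rat a + of_rat b * \<theta> |a b. True}"
  using trace_norm
proof (elim disjE conjE)
  assume "\<theta> = sqrt_neg d"
  then show ?thesis by (simp add: quad_field_def)
next
  assume th: "\<theta> = (- 1 + sqrt_neg d) / 2"
  show ?thesis unfolding quad_field_def
  proof (intro equalityI subsetI; elim CollectE exE conjE)
    fix x a b assume "x = of_rat a + of_rat b * sqrt_neg d"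
    then have "x = of_rat (a + b) + of_rat (2 * b) * \<theta>"
      by (simp add: th of_rat_add of_rat_mult field_simps)
    then show "x \<in> {of_rat a + of_rat b * \<theta> |a b. True}" by blast
  next
    fix x a b assume "x = of_rat a + of_rat b * \<theta>"
    then have "x = of_rat (a - b / 2) + of_rat (b / 2) * sqrt_neg d"
      by (simp add: th of_rat_diff of_rat_divide of_rat_mult field_simps)
    then show "x \<in> {of_rat a + of_rat b * sqrt_neg d |a b. True}" by blast
  qed
qed

lemma quad_field_I: "x = of_rat a + of_rat b * \<theta> \<Longrightarrow> x \<in> quad_field d"
  unfolding quad_field_eq by blast

lemma quad_field_E:
  assumes "x \<in> quad_field d"
  obtains a b where "x = of_rat a + of_rat b * \<theta>"
  using assms unfolding quad_field_eq by blast

lemma O_F_quad_field: "x \<in> O_F \<Longrightarrow> x \<in> quad_field d"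
  by (elim O_F_E) (rule quad_field_I[of _ "of_int _" "of_int _"], simp)

lemma quad_field_denominator:
  assumes "x \<in> quad_field d"
  shows "\<exists>e::nat. \<exists>y \<in> O_F. e > 0 \<and> of_nat e * x = y"
proof -
  obtain a b where x: "x = of_rat a + of_rat b * \<theta>" using assms by (rule quad_field_E)
  obtain u v where uv: "a = of_int u / of_int v" "v > 0"
    using quotient_of_div quotient_of_denom_pos by (metis surj_pair)
  obtain w z where wz: "b = of_int w / of_int z" "z > 0"
    using quotient_of_div quotient_of_denom_pos by (metis surj_pair)
  have "of_nat (nat (v * z)) * x = of_int (u * z) + of_int (w * v) * \<theta>"
    using uv(2) wz(2) by (simp add: x uv(1) wz(1) of_rat_divide field_simps)
  then have "of_nat (nat (v * z)) * x \<in> O_F" by (rule O_F_I)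
  moreover have "nat (v * z) > 0" using uv(2) wz(2) by simp
  ultimately show ?thesis by blast
qed

lemma quad_field_frac: "y \<in> O_F \<Longrightarrow> y / of_nat e \<in> quad_field d"
proof (elim O_F_E)
  fix i j assume "y = of_int i + of_int j * \<theta>"
  then have "y / of_nat e = of_rat (of_int i / of_nat e) + of_rat (of_int j / of_nat e) * \<theta>"
    by (simp add: of_rat_divide add_divide_distrib)
  then show ?thesis by (rule quad_field_I)
qed

lemma quad_field_mult:
  assumes "x \<in> quad_field d" "y \<in> quad_field d"
  shows "x * y \<in> quad_field d"
proof -
  obtain e z where e: "e > 0" "z \<in> O_F" "of_nat e * x = z" using quad_field_denominator[OF assms(1)] by blast
  obtain e' z' where e': "e' > 0" "z' \<in> O_F" "of_nat e' * y = z'" using quad_field_denominator[OF assms(2)] by blast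
  have "x * y = z * z' / of_nat (e * e')" using e(1) e'(1) by (simp add: e(3)[symmetric] e'(3)[symmetric])
  then show ?thesis by (simp only: quad_field_frac O_F_mult e(2) e'(2))
qed

lemma quad_field_inverse:
  assumes "x \<in> quad_field d" "x \<noteq> 0"
  shows "1 / x \<in> quad_field d"
proof -
  obtain e z where e: "e > 0" "z \<in> O_F" "of_nat e * x = z" using quad_field_denominator[OF assms(1)] by blast
  obtain N where N: "z * cnj z = of_nat N" using O_F_norm[OF e(2)] by blast
  have "z \<noteq> 0" using e(1,3) assms(2) by auto
  then have "N > 0" using N by (metis complex_cnj_zero_iff gr0I mult_eq_0_iff of_nat_0)
  have "1 / x = of_nat e * cnj z / of_nat N"
    unfolding N[symmetric] using e(1) assms(2) by (simp add: e(3)[symmetric])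
  then show ?thesis by (simp only: quad_field_frac O_F_mult O_F_int(2) O_F_cnj e(2))
qed

lemma algebraic_int_O_F:
  assumes "x \<in> O_F"
  shows "algebraic_int x"
proof -
  obtain i j where x: "x = of_int i + of_int j * \<theta>" using assms by (rule O_F_E)
  define N where "N = i ^ 2 - i * j * T + j ^ 2 * n"
  let ?p = "[:of_int N, - of_int (2 * i - j * T), 1:] :: complex poly"
  have "poly ?p x = 0"
    by (simp add: x N_def algebra_simps theta_sq theta_sq_left power2_eq_square)
  moreover have "\<forall>k. Polynomial.coeff ?p k \<in> \<int>" by (auto simp: coeff_pCons split: nat.splits)
  ultimately show ?thesis by (intro algebraic_int.intros[of ?p]) auto
qed

text \<open>A monic equation satisfied by \<open>x\<close> bounds the denominators of all powers of
  \<open>x\<close> at once.\<close>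

lemma algebraic_int_powers:
  assumes "x \<in> quad_field d" "algebraic_int x"
  shows "\<exists>D::nat. D > 0 \<and> (\<forall>k. of_nat D * x ^ k \<in> O_F)"
proof -
  obtain e y where e: "e > 0" "y \<in> O_F" "of_nat e * x = y"
    using quad_field_denominator[OF assms(1)] by blast
  obtain q where q: "Polynomial.lead_coeff q = 1" "\<forall>i. Polynomial.coeff q i \<in> \<int>" "poly q x = 0"
    using assms(2) by (auto elim: algebraic_int.cases)
  define m where "m = Polynomial.degree q"
  have "(\<Sum>i\<le>m. Polynomial.coeff q i * x ^ i) = 0" using q(3) by (simp add: poly_altdef m_def)
  then have "(\<Sum>i<m. Polynomial.coeff q i * x ^ i) + x ^ m = 0"
    using q(1) by (simp add: lessThan_Suc_atMost[symmetric] m_def)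
  then have xm: "x ^ m = - (\<Sum>i<m. Polynomial.coeff q i * x ^ i)" by (simp add: eq_neg_iff_add_eq_0 add.commute)
  have "of_nat (e ^ m) * x ^ k \<in> O_F" for k
  proof (induction k rule: less_induct)
    case (less k)
    show ?case
    proof (cases "k < m")
      case True
      have "of_nat (e ^ m) * x ^ k = of_nat (e ^ (m - k)) * (of_nat e * x) ^ k"
        using True by (simp add: power_mult_distrib mult.assoc[symmetric] flip: power_add)
      then show ?thesis using e by (auto intro: O_F_mult O_F_int O_F_power)
    next
      case False
      have "of_nat (e ^ m) * x ^ k = of_nat (e ^ m) * (x ^ (k - m) * x ^ m)"
        using False by (simp flip: power_add)
      also have "\<dots> = - (\<Sum>i<m. Polynomial.coeff q i * (of_nat (e ^ m) * x ^ (k - m + i)))"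
        unfolding xm by (simp add: sum_distrib_left power_add mult_ac)
      also have "\<dots> \<in> O_F"
      proof (intro lat_minus)
        have "Polynomial.coeff q i * (of_nat (e ^ m) * x ^ (k - m + i)) \<in> O_F" if "i < m" for i
        proof -
          obtain c where "Polynomial.coeff q i = of_int c" using q(2) by (meson Ints_cases)
          then show ?thesis using less[of "k - m + i"] that False by (simp add: lat_int_mult)
        qed
        then show "(\<Sum>i<m. Polynomial.coeff q i * (of_nat (e ^ m) * x ^ (k - m + i))) \<in> O_F"
          by (intro lat_sum) auto
      qed
      finally show ?thesis .
    qed
  qed
  then show ?thesis using e(1) by (intro exI[of _ "e ^ m"]) auto
qed

text \<open>The norms of the multiples $D x^k$ are integers, so the powers of the norm of \<open>x\<close>
  have bounded denominators.\<close>

lemma norm_integral: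
  assumes "\<And>k. of_nat D * x ^ k \<in> O_F" "D > 0" "x * cnj x = of_rat r"
  shows "r \<in> \<int>"
proof (rule rat_integral_if_powers_bounded_denominator)
  show "int (D ^ 2) \<noteq> 0" using assms(2) by simp
  fix k
  obtain N where N: "(of_nat D * x ^ k) * cnj (of_nat D * x ^ k) = of_nat N"
    using O_F_norm[OF assms(1)] by blast
  have "(of_nat D * x ^ k) * cnj (of_nat D * x ^ k) = of_nat (D ^ 2) * (x * cnj x) ^ k"
    by (simp add: power_mult_distrib power2_eq_square mult_ac)
  also have "\<dots> = of_rat (of_int (int (D ^ 2)) * r ^ k)"
    by (simp add: assms(3) of_rat_mult of_rat_power)
  finally have "of_rat (of_int (int (D ^ 2)) * r ^ k) = (of_rat (of_nat N) :: complex)" using N by simp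
  then have "of_int (int (D ^ 2)) * r ^ k = of_nat N" by (simp only: of_rat_eq_iff)
  then show "of_int (int (D ^ 2)) * r ^ k \<in> \<int>" by simp
qed

text \<open>The norms of \<open>x\<close> and $x + 1$ are integers, hence so is the trace. The discriminant
  times the square of the coefficient at \<open>\<theta>\<close> is then an integer, and
  squarefreeness of \<open>d\<close> leaves at most a denominator 2, which is excluded modulo 4.\<close>

lemma quad_integers_eq: "quad_integers d = O_F"
proof (intro equalityI subsetI)
  fix x assume "x \<in> O_F"
  then show "x \<in> quad_integers d"
    by (simp add: quad_integers_def O_F_quad_field algebraic_int_O_F)
next
  fix x assume "x \<in> quad_integers d"
  then have x: "x \<in> quad_field d" "algebraic_int x" by (auto simp: quad_integers_def)
  obtain r s where rs: "x = of_rat r + of_rat s * \<theta>" using x(1) by (rule quad_field_E)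
  obtain D where D: "D > 0" "\<And>k. of_nat D * x ^ k \<in> O_F" using algebraic_int_powers[OF x] by blast
  have cr: "cnj (of_rat q) = of_rat q" for q by (simp add: of_rat_complex)
  have norm: "(of_rat r' + of_rat s * \<theta>) * cnj (of_rat r' + of_rat s * \<theta>)
               = of_rat (r' ^ 2 - r' * s * of_int T + s ^ 2 * of_int n)" for r'
    by (simp add: cr cnj_theta of_rat_add of_rat_diff of_rat_mult of_rat_power algebra_simps
        power2_eq_square theta_sq theta_sq_left)
  define N where "N = r ^ 2 - r * s * of_int T + s ^ 2 * of_int n"
  have N: "N \<in> \<int>" unfolding N_def
    by (rule norm_integral[OF D(2,1)]) (unfold rs norm, rule refl)
  \<comment> \<open>The trace is the difference of the norms of $x + 1$ and \<open>x\<close>, minus 1.\<close>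
  have "of_nat D * (x + 1) ^ k \<in> O_F" for k
  proof -
    have "of_nat D * (x + 1) ^ k = (\<Sum>i\<le>k. of_int (int (k choose i)) * (of_nat D * x ^ i))"
      by (simp add: binomial_ring sum_distrib_left mult_ac)
    also have "\<dots> \<in> O_F"
      by (intro lat_sum lat_int_mult D(2))
    finally show ?thesis .
  qed
  moreover have "x + 1 = of_rat (r + 1) + of_rat s * \<theta>" by (simp add: rs of_rat_add)
  ultimately have N1: "(r + 1) ^ 2 - (r + 1) * s * of_int T + s ^ 2 * of_int n \<in> \<int>"
    by (intro norm_integral[OF _ D(1), of "x + 1"]) (auto simp only: norm)
  define t where "t = 2 * r - s * of_int T"
  have "t = ((r + 1) ^ 2 - (r + 1) * s * of_int T + s ^ 2 * of_int n) - N - 1"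
    by (simp add: t_def N_def power2_eq_square algebra_simps)
  then have t: "t \<in> \<int>" using N N1 by (metis Ints_1 Ints_diff)
  have disc: "of_int (4 * n - T ^ 2) * s ^ 2 = 4 * N - t ^ 2"
    by (simp add: t_def N_def power2_eq_square algebra_simps)
  have "r \<in> \<int> \<and> s \<in> \<int>"
    using trace_norm
  proof (elim disjE conjE)
    assume T: "T = 1" "4 * n = 1 + d"
    have "of_int d * s ^ 2 \<in> \<int>" using disc N t T by (simp add: Ints_diff Ints_mult Ints_power)
    then have s: "s \<in> \<int>" using d_squarefree rat_integral_if_squarefree_mult_square by blast
    obtain u v w where uvw: "s = of_int u" "t = of_int v" "N = of_int w"
      using s t N by (auto elim!: Ints_cases)
    have r: "2 * r = of_int (u + v)" using T uvw by (simp add: t_def)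
    have "even (u + v)"
    proof (rule ccontr)
      assume odd: "odd (u + v)"
      have "(2 * r) * (2 * r - 2 * s) = 4 * (N - s ^ 2 * of_int n)"
        using T by (simp add: N_def power2_eq_square algebra_simps)
      then have "of_int ((u + v) * (u + v - 2 * u)) = (of_int (4 * (w - u ^ 2 * n)) :: rat)"
        unfolding r uvw by simp
      then have "(u + v) * (u + v - 2 * u) = 4 * (w - u ^ 2 * n)" by (simp only: of_int_eq_iff)
      then have "even ((u + v) * (u + v - 2 * u))" by simp
      then show False using odd by simp
    qed
    then obtain l where "u + v = 2 * l" by (elim evenE)
    then have "r = of_int l" using r by simp
    then show ?thesis using s by simp
  next
    assume T: "T = 0" "n = d" "\<not> [- d = 1] (mod 4)"
    have "of_int d * (2 * s) ^ 2 = 4 * N - t ^ 2" using disc T by (simp add: power2_eq_square)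
    then have "of_int d * (2 * s) ^ 2 \<in> \<int>" using N t by (simp add: Ints_diff Ints_mult Ints_power)
    then have s: "2 * s \<in> \<int>" using d_squarefree rat_integral_if_squarefree_mult_square by blast
    obtain B A w where uvw: "2 * s = of_int B" "t = of_int A" "N = of_int w"
      using s t N by (auto elim!: Ints_cases)
    have "of_int (A ^ 2 + d * B ^ 2) = (of_int (4 * w) :: rat)"
      using \<open>of_int d * (2 * s) ^ 2 = 4 * N - t ^ 2\<close> unfolding uvw by simp
    then have AB: "A ^ 2 + d * B ^ 2 = 4 * w" by (simp only: of_int_eq_iff)
    have nd: "\<not> 4 dvd d" using squarefreeD[OF d_squarefree, of 2] by auto
    have d1: "\<not> 4 dvd d + 1"
    proof
      assume "4 dvd d + 1"
      then have "4 dvd - (d + 1)" by (simp only: dvd_minus_iff)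
      then show False using T(3) by (simp add: cong_iff_dvd_diff)
    qed
    have "even B"
    proof (rule ccontr)
      assume "odd B"
      then obtain b where b: "B = 2 * b + 1" by (elim oddE)
      show False
      proof (cases "even A")
        case True
        then obtain a where "A = 2 * a" by (elim evenE)
        then have "d = 4 * (w - a ^ 2 - d * (b ^ 2 + b))" using AB b by (simp add: power2_eq_square algebra_simps)
        then show False using nd by (metis dvd_triv_left)
      next
        case False
        then obtain a where "A = 2 * a + 1" by (elim oddE)
        then have "d + 1 = 4 * (w - a ^ 2 - a - d * (b ^ 2 + b))"
          using AB b by (simp add: power2_eq_square algebra_simps)
        then show False using d1 by (metis dvd_triv_left)
      qed
    qed
    then obtain b where b: "B = 2 * b" by (elim evenE)
    then have "A ^ 2 = 4 * (w - d * b ^ 2)" using AB by (simp add: power2_eq_square algebra_simps)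
    then have "even (A ^ 2)" by simp
    then have "even A" by simp
    then obtain a where a: "A = 2 * a" by (elim evenE)
    have "s = of_int b" "r = of_int a" using uvw a b T(1) by (simp_all add: t_def)
    then show ?thesis by simp
  qed
  then obtain i j where "r = of_int i" "s = of_int j" by (auto elim!: Ints_cases)
  then show "x \<in> O_F" by (intro O_F_I[of x i j]) (simp add: rs)
qed

text \<open>The coefficients of a form whose discriminant is that of the field have no common factor
  \<open>q\<close>: the square of \<open>q\<close> would divide the discriminant, which is
  \<open>d\<close> or $4 d$ up to sign. The prime 2 is excluded by congruences modulo 4.\<close>

lemma form_primitive:
  assumes "f c = a * a'" "prime q" "q dvd a" "q dvd a'" "q dvd 2 * c + T"
  shows False
proof -
  have qq: "q ^ 2 dvd f c" using assms(1,3,4) by (simp add: power2_eq_square mult_dvd_mono)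
  have disc: "T ^ 2 - 4 * n = (2 * c + T) ^ 2 - 4 * f c"
    by (simp add: f_def power2_eq_square algebra_simps)
  have "q ^ 2 dvd (2 * c + T) ^ 2 - 4 * f c"
    using qq assms(5) by (intro dvd_diff dvd_mult) (auto simp: dvd_power_same)
  then have q4: "q ^ 2 dvd T ^ 2 - 4 * n" by (simp only: disc)
  have nu: "\<not> q dvd 1" using assms(2) not_prime_unit by blast
  have nd: "\<not> q ^ 2 dvd d" using squarefreeD[OF d_squarefree, of q] nu by blast
  show False
    using trace_norm
  proof (elim disjE conjE)
    assume "T = 1" "4 * n = 1 + d"
    then have "T ^ 2 - 4 * n = - d" by simp
    then show False using q4 nd by (simp only: dvd_minus_iff)
  next
    assume T: "T = 0" "n = d" "\<not> [- d = 1] (mod 4)"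
    show False
    proof (cases "q = 2")
      case True
      have "f c = c ^ 2 + T * c + n" by (simp add: f_def)
      then have "f c = c ^ 2 + d" using T by simp
      then have "4 dvd c ^ 2 + d" using qq by (simp only: True) simp
      moreover have "\<not> 4 dvd d" using nd by (simp add: True)
      moreover have "\<not> 4 dvd d + 1"
      proof
        assume "4 dvd d + 1"
        then have "4 dvd - (d + 1)" by (simp only: dvd_minus_iff)
        then show False using T(3) by (simp add: cong_iff_dvd_diff)
      qed
      ultimately show False
      proof (cases "even c")
        case True
        then obtain e where "c = 2 * e" by (elim evenE)
        then have "c ^ 2 + d = 4 * e ^ 2 + d" by (simp add: power2_eq_square)
        then show False using \<open>4 dvd c ^ 2 + d\<close> \<open>\<not> 4 dvd d\<close> by (simp add: dvd_add_right_iff)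
      next
        case False
        then obtain e where "c = 2 * e + 1" by (elim oddE)
        then have eq: "c ^ 2 + d = 4 * (e ^ 2 + e) + (d + 1)" by (simp add: power2_eq_square algebra_simps)
        have "4 dvd 4 * (e ^ 2 + e) + (d + 1)" using \<open>4 dvd c ^ 2 + d\<close> unfolding eq .
        then show False using \<open>\<not> 4 dvd d + 1\<close> by (subst (asm) dvd_add_right_iff) auto
      qed
    next
      case False
      have "coprime q 2" using primes_coprime[OF assms(2) _ False] by simp
      then have "coprime (q ^ 2) 4" using coprime_power_left_iff[of q 2 4] coprime_mult_right_iff[of q 2 2] by simp
      moreover have "q ^ 2 dvd 4 * d" using q4 T by simp
      ultimately have "q ^ 2 dvd d" by (simp add: coprime_dvd_mult_right_iff)
      then show False using nd by blast
    qed
  qed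
qed

text \<open>The corner has imaginary part $\sqrt{3} / 2$, and \<open>x\<close> has imaginary part \<open>Im
  \<theta>\<close> divided by \<open>a\<close>. Equality makes \<open>d\<close> three times a
  square.\<close>

lemma no_corner:
  assumes "d \<noteq> 3" "is_pt x a" "cmod x = 1"
  shows "Re x \<noteq> - 1 / 2"
proof
  assume "Re x = - 1 / 2"
  then have "(Im x)\<^sup>2 = 3 / 4" using cmod_power2[of x] assms(3) by (simp add: power2_eq_square)
  moreover have "Im x = Im \<theta> / a" "a > 0" using is_pt_Im[OF assms(2)] by auto
  ultimately have eq: "4 * (Im \<theta>)\<^sup>2 = 3 * (real a)\<^sup>2" by (simp add: power_divide field_simps)
  have sq: "(Im (sqrt_neg d))\<^sup>2 = of_int d" using d_pos by (simp add: sqrt_neg_def)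
  have key: False if "d = 3 * (int b) ^ 2" for b
  proof -
    have "int b ^ 2 dvd d" using that by simp
    then have "int b dvd 1" using d_squarefree squarefreeD by blast
    then have "int b = 1" by simp
    then show False using that assms(1) by simp
  qed
  show False
    using trace_norm
  proof (elim disjE conjE)
    assume th: "\<theta> = (- 1 + sqrt_neg d) / 2"
    have im: "Im \<theta> = Im (sqrt_neg d) / 2" unfolding th by simp
    have "4 * (Im \<theta>)\<^sup>2 = of_int d" unfolding im power_divide sq by simp
    then have "of_int d = real_of_int (3 * (int a) ^ 2)" using eq by simp
    then have "d = 3 * (int a) ^ 2" by (simp only: of_int_eq_iff)
    then show False by (rule key)
  next
    assume "\<theta> = sqrt_neg d"
    then have "real_of_int (4 * d) = real_of_int (3 * (int a) ^ 2)" using eq sq by simp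
    then have 4: "4 * d = 3 * (int a) ^ 2" by (simp only: of_int_eq_iff)
    then have "even (3 * (int a) ^ 2)" by (metis dvd_mult2 dvd_triv_left even_numeral)
    then have "even a" by simp
    then obtain b where "a = 2 * b" by (elim evenE)
    then have "d = 3 * (int b) ^ 2" using 4 by (simp add: power2_eq_square)
    then show False by (rule key)
  qed
qed

end

section \<open>Rings of complex numbers and the splitting condition\<close>

lemma complex_ring_simps [simp]:
  "carrier (complex_ring S) = S" "x \<otimes>\<^bsub>complex_ring S\<^esub> y = x * y" "\<one>\<^bsub>complex_ring S\<^esub> = 1"
  "\<zero>\<^bsub>complex_ring S\<^esub> = 0" "x \<oplus>\<^bsub>complex_ring S\<^esub> y = x + y"
  by (simp_all add: complex_ring_def ring_of_type_algebra_def)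

lemma ideal_complex_ring_add:
  "ideal I (complex_ring S) \<Longrightarrow> x \<in> I \<Longrightarrow> y \<in> I \<Longrightarrow> x + y \<in> I"
  using additive_subgroup.a_closed[OF ideal.axioms(1), of I "complex_ring S" x y] by simp

lemma cring_complex_ring:
  assumes "0 \<in> S" "1 \<in> S" "\<And>x y. x \<in> S \<Longrightarrow> y \<in> S \<Longrightarrow> x + y \<in> S"
    "\<And>x y. x \<in> S \<Longrightarrow> y \<in> S \<Longrightarrow> x * y \<in> S" "\<And>x. x \<in> S \<Longrightarrow> - x \<in> S"
  shows "cring (complex_ring S)"
proof (rule cringI)
  show "abelian_group (complex_ring S)"
    using assms by (intro abelian_groupI) (auto simp: algebra_simps intro: bexI[of _ "- _"])
  show "comm_monoid (complex_ring S)"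
    using assms by (intro comm_monoidI) (auto simp: algebra_simps)
qed (auto simp: algebra_simps)

context imag_quad_field
begin

lemma cring_O_F: "cring (complex_ring O_F)"
  by (rule cring_complex_ring) (auto intro: lat_gen lat_add lat_minus O_F_mult)

text \<open>A prime ideal over \<open>q\<close> meets the integers in the multiples of \<open>q\<close>,
  because it contains 1 otherwise.\<close>

lemma prime_ideal_int:
  assumes "primeideal P (complex_ring O_F)" "prime q" "of_nat q \<in> P" "of_int k \<in> P"
  shows "int q dvd k"
proof (rule ccontr)
  interpret P: primeideal P "complex_ring O_F" by fact
  assume "\<not> int q dvd k"
  then have "coprime (int q) k" using assms(2) by (intro prime_imp_coprime) auto
  then obtain u v where "u * int q + v * k = 1" by (metis bezout_int coprime_iff_gcd_eq_1)
  then have "(1::complex) = of_int u * of_nat q + of_int v * of_int k"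
    by (metis of_int_1 of_int_add of_int_mult of_int_of_nat_eq)
  moreover have "of_int u * of_nat q \<in> P" "of_int v * of_int k \<in> P"
    using P.I_l_closed[OF assms(3), of "of_int u"] P.I_l_closed[OF assms(4), of "of_int v"] O_F_int by auto
  ultimately have "1 \<in> P"
    using ideal_complex_ring_add[OF P.ideal_axioms, of "of_int u * of_nat q" "of_int v * of_int k"] by simp
  then show False using P.one_imp_carrier P.I_notcarr by simp
qed

text \<open>A prime ideal over \<open>q\<close> which is not generated by \<open>q\<close> is given by a root of the minimal
  polynomial of the generator modulo \<open>q\<close>.\<close>

lemma prime_ideal_root:
  assumes P: "primeideal P (complex_ring O_F)" and q: "prime q" "of_nat q \<in> P"
    and x: "x \<in> P" "\<not> (\<exists>y \<in> O_F. x = of_nat q * y)"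
  shows "\<exists>c. int q dvd f c \<and> (\<forall>i j. of_int i + of_int j * \<theta> \<in> P \<longleftrightarrow> int q dvd i + j * c)"
proof -
  interpret P: primeideal P "complex_ring O_F" by fact
  have sub: "y \<in> O_F" if "y \<in> P" for y using that P.a_subset by auto
  have mult: "y * z \<in> P" if "y \<in> O_F" "z \<in> P" for y z using P.I_l_closed[of z y] that by simp
  have add: "y + z \<in> P" if "y \<in> P" "z \<in> P" for y z using ideal_complex_ring_add[OF P.ideal_axioms] that by blast
  have diff: "y - z \<in> P" if "y \<in> P" "z \<in> P" for y z
    using add[OF that(1) mult[of "- 1", OF _ that(2)]] O_F_int(1)[of "- 1"] by simp
  obtain i j where ij: "x = of_int i + of_int j * \<theta>" using sub[OF x(1)] by (rule O_F_E)
  have qint: "of_int k \<in> P \<longleftrightarrow> int q dvd k" for k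
  proof
    assume "int q dvd k"
    then obtain l where "k = int q * l" by (elim dvdE)
    then have "of_int k = of_int l * (of_nat q :: complex)" by simp
    then show "of_int k \<in> P" using mult[OF O_F_int(1) q(2)] by simp
  qed (rule prime_ideal_int[OF P q])
  have "\<not> int q dvd j"
  proof
    assume "int q dvd j"
    then obtain l where l: "j = int q * l" by (elim dvdE)
    have "x - (of_int l * \<theta>) * of_nat q \<in> P"
      by (intro diff x mult O_F_mult O_F_int q)
    also have "x - (of_int l * \<theta>) * of_nat q = of_int i" by (simp add: ij l)
    finally have "int q dvd i" by (simp only: qint)
    then obtain k where "i = int q * k" by (elim dvdE)
    then have "x = of_nat q * (of_int k + of_int l * \<theta>)" by (simp add: ij l algebra_simps)
    then show False using x(2) O_F_I by blast
  qed
  then have "coprime j (int q)" using q(1) by (subst coprime_commute) (intro prime_imp_coprime, auto)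
  then obtain l m where lm: "l * j + m * int q = 1" by (metis bezout_int coprime_iff_gcd_eq_1)
  \<comment> \<open>Modulo \<open>q\<close>, the element \<open>x\<close> times the inverse \<open>l\<close> of \<open>j\<close> is $\theta - c$.\<close>
  define c where "c = - (l * i)"
  have "of_int l * x + (of_int m * \<theta>) * of_nat q \<in> P"
    by (intro add x mult O_F_mult O_F_int q)
  also have "of_int l * x + (of_int m * \<theta>) * of_nat q = of_int (l * j + m * int q) * \<theta> + of_int (l * i)"
    by (simp add: ij algebra_simps)
  finally have root: "\<theta> - of_int c \<in> P" by (simp add: lm c_def)
  have "of_int (f c) \<in> P"
    unfolding theta_sub_norm[symmetric]
    by (subst mult.commute, intro mult root O_F_cnj lat_diff O_F_int)
  then have "int q dvd f c" by (simp only: qint)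
  moreover have "of_int k + of_int l * \<theta> \<in> P \<longleftrightarrow> int q dvd k + l * c" for k l
  proof -
    have eq: "of_int k + of_int l * \<theta> = of_int (k + l * c) + of_int l * (\<theta> - of_int c)"
      by (simp add: algebra_simps)
    have "of_int l * (\<theta> - of_int c) \<in> P" by (intro mult root O_F_int)
    then have "of_int k + of_int l * \<theta> \<in> P \<longleftrightarrow> of_int (k + l * c) \<in> P"
      unfolding eq using add diff by (metis add_diff_cancel_right')
    then show ?thesis by (simp only: qint)
  qed
  ultimately show ?thesis by blast
qed

text \<open>The two primes yield roots \<open>c\<close> and $c'$ modulo \<open>q\<close>, and the roots
  differ because the primes do. Then $c + c' + T$ vanishes modulo \<open>q\<close>, and the
  derivative at \<open>c\<close> is congruent to $c - c'$.\<close>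

lemma splits_completely_root:
  assumes "prime q" "splits_completely q d"
  shows "\<exists>c. int q dvd f c \<and> \<not> int q dvd 2 * c + T"
proof -
  obtain P Q where PQ: "primeideal P (complex_ring O_F)" "primeideal Q (complex_ring O_F)" "P \<noteq> Q"
      "PIdl\<^bsub>complex_ring O_F\<^esub> (of_nat q) = ideal_prod (complex_ring O_F) P Q"
    using assms(2) unfolding splits_completely_def quad_integers_eq by blast
  interpret R: cring "complex_ring O_F" by (rule cring_O_F)
  interpret P: primeideal P "complex_ring O_F" by fact
  interpret Q: primeideal Q "complex_ring O_F" by fact
  have "of_nat q \<in> PIdl\<^bsub>complex_ring O_F\<^esub> (of_nat q)"
    using R.cgenideal_self[of "of_nat q"] O_F_int by simp
  then have qPQ: "of_nat q \<in> ideal_prod (complex_ring O_F) P Q" by (simp only: PQ(4))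
  then have qP: "of_nat q \<in> P" and qQ: "of_nat q \<in> Q"
    using R.ideal_prod_inter[OF P.ideal_axioms Q.ideal_axioms] by auto
  have q0: "q \<noteq> 0" using assms(1) by auto
  have proper: "\<exists>x \<in> I. \<not> (\<exists>y \<in> O_F. x = of_nat q * y)"
    if IJ: "primeideal I (complex_ring O_F)" "primeideal J (complex_ring O_F)"
       "of_nat q \<in> ideal_prod (complex_ring O_F) I J" for I J
  proof (rule ccontr)
    interpret J: primeideal J "complex_ring O_F" by fact
    assume "\<not> (\<exists>x \<in> I. \<not> (\<exists>y \<in> O_F. x = of_nat q * y))"
    then have I: "\<exists>y \<in> O_F. x = of_nat q * y" if "x \<in> I" for x using that by blast
    have "\<exists>y \<in> J. s = of_nat q * y" if "s \<in> ideal_prod (complex_ring O_F) I J" for s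
      using that
    proof induction
      case (prod i j)
      then obtain y where "y \<in> O_F" "i = of_nat q * y" using I by blast
      then show ?case using J.I_l_closed[OF prod(2), of y] by (intro bexI[of _ "y * j"]) auto
    next
      case (sum s t)
      then obtain y z where "y \<in> J" "z \<in> J" "s = of_nat q * y" "t = of_nat q * z" by blast
      then show ?case using ideal_complex_ring_add[OF J.ideal_axioms, of y z] by (intro bexI[of _ "y + z"]) (auto simp: algebra_simps)
    qed
    then obtain y where "y \<in> J" "of_nat q = of_nat q * y" using IJ(3) by blast
    then have "1 \<in> J" using q0 by simp
    then show False using J.one_imp_carrier J.I_notcarr by simp
  qed
  have qQP: "of_nat q \<in> ideal_prod (complex_ring O_F) Q P"
    using qPQ R.ideal_prod_commute[OF P.ideal_axioms Q.ideal_axioms] by simp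
  obtain c where c: "int q dvd f c" "\<And>i j. of_int i + of_int j * \<theta> \<in> P \<longleftrightarrow> int q dvd i + j * c"
    using proper[OF PQ(1,2) qPQ] prime_ideal_root[OF PQ(1) assms(1) qP] by blast
  obtain c' where c': "int q dvd f c'" "\<And>i j. of_int i + of_int j * \<theta> \<in> Q \<longleftrightarrow> int q dvd i + j * c'"
    using proper[OF PQ(2,1) qQP] prime_ideal_root[OF PQ(2) assms(1) qQ] by blast
  have ne: "\<not> int q dvd c - c'"
  proof
    assume h: "int q dvd c - c'"
    have "int q dvd i + j * c \<longleftrightarrow> int q dvd i + j * c'" for i j
    proof -
      have eq: "i + j * c = (i + j * c') + j * (c - c')" by (simp add: algebra_simps)
      show ?thesis unfolding eq by (rule dvd_add_left_iff) (use h in simp)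
    qed
    then have "of_int i + of_int j * \<theta> \<in> P \<longleftrightarrow> of_int i + of_int j * \<theta> \<in> Q" for i j
      by (simp add: c(2) c'(2))
    moreover have "P \<subseteq> O_F" "Q \<subseteq> O_F" using P.a_subset Q.a_subset by auto
    ultimately have "P = Q" by (metis O_F_E subset_antisym subsetD subsetI)
    then show False using PQ(3) by simp
  qed
  have "f c - f c' = (c - c') * (c + c' + T)" by (simp add: f_def power2_eq_square algebra_simps)
  then have "int q dvd (c - c') * (c + c' + T)" using c(1) c'(1) by (metis dvd_diff)
  then have "int q dvd c + c' + T" using ne assms(1) by (simp add: prime_dvd_mult_iff)
  have "\<not> int q dvd 2 * c + T"
  proof
    assume "int q dvd 2 * c + T"
    then have "int q dvd (2 * c + T) - (c + c' + T)" using \<open>int q dvd c + c' + T\<close> by (rule dvd_diff)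
    then show False using ne by (simp add: algebra_simps)
  qed
  then show ?thesis using c(1) by blast
qed

text \<open>The root of the minimal polynomial that Hensel's lemma provides is \<open>\<theta>\<close> or
  its conjugate, and the sum of the two is an integer.\<close>

lemma split_prime_if_splits:
  fixes \<iota> :: "complex \<Rightarrow> 'p::prime_card padic alg_closure"
  assumes "\<iota> \<in> ring_iso ring_of_type_algebra ring_of_type_algebra" "splits_completely CARD('p) d"
  shows "split_prime T n \<theta> CARD('p) (Zp_in \<iota>)"
proof -
  interpret R: padic_subring "CARD('p)" "Zp_in \<iota>" by (rule padic_subring_Zp_in[OF assms(1)])
  obtain c where c: "int CARD('p) dvd f c" "\<not> int CARD('p) dvd 2 * c + T"
    using splits_completely_root[OF R.prime_p assms(2)] by blast
  obtain y where y: "y \<in> Zp_in \<iota>" "y ^ 2 + of_int T * y + of_int n = 0"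
    using quadratic_root_in_Zp_in[OF assms(1) c[unfolded f_def]] by blast
  have "(y - \<theta>) * (y - cnj \<theta>) = y ^ 2 + of_int T * y + of_int n"
    by (simp add: cnj_theta power2_eq_square algebra_simps theta_sq)
  then have "y = \<theta> \<or> y = cnj \<theta>" using y(2) by simp
  moreover have mT: "- of_int T \<in> Zp_in \<iota>"
    using trace_cases R.one_in R.minus_in R.add_in[OF R.one_in R.minus_in[OF R.one_in]] by auto
  moreover have "- of_int T + - y \<in> Zp_in \<iota>" by (rule R.add_in[OF mT R.minus_in[OF y(1)]])
  moreover have "- of_int T + - cnj \<theta> = \<theta>" by (simp add: cnj_theta)
  ultimately have "\<theta> \<in> Zp_in \<iota>" using y(1) by metis
  moreover have "\<not> int CARD('p) dvd T ^ 2 - 4 * n"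
  proof
    assume "int CARD('p) dvd T ^ 2 - 4 * n"
    moreover have "(2 * c + T) ^ 2 = (T ^ 2 - 4 * n) + 4 * f c"
      by (simp add: f_def power2_eq_square algebra_simps)
    ultimately have "int CARD('p) dvd (2 * c + T) ^ 2" using c(1) by (metis dvd_add dvd_mult)
    then show False using c(2) R.prime_p prime_dvd_power by (metis prime_nat_int_transfer)
  qed
  ultimately show ?thesis by unfold_locales
qed

end

section \<open>Powers of the prime ideal\<close>

text \<open>The product of two sets depends on the ring only through the operations, so the carrier
  \<open>S\<close> is arbitrary. The algebraic laws of the product hold for arbitrary sets of
  complex numbers, which covers both ideals and fractional ideals.\<close>

lemma complex_ideal_prodI:
  "x \<in> I \<Longrightarrow> y \<in> J \<Longrightarrow> x * y \<in> ideal_prod (complex_ring S) I J"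
  using ideal_prod.prod[of x I y J "complex_ring S"] by simp

lemma complex_ideal_prod_add:
  "s \<in> ideal_prod (complex_ring S) I J \<Longrightarrow> t \<in> ideal_prod (complex_ring S) I J
     \<Longrightarrow> s + t \<in> ideal_prod (complex_ring S) I J"
  using ideal_prod.sum[of s "complex_ring S" I J t] by simp

lemma complex_ideal_prod_subset:
  assumes "\<And>x y. x \<in> I \<Longrightarrow> y \<in> J \<Longrightarrow> x * y \<in> K" "\<And>x y. x \<in> K \<Longrightarrow> y \<in> K \<Longrightarrow> x + y \<in> K"
  shows "ideal_prod (complex_ring S) I J \<subseteq> K"
proof
  fix x assume "x \<in> ideal_prod (complex_ring S) I J"
  then show "x \<in> K" by induction (use assms in auto)
qed

lemma complex_ideal_prod_scale:
  assumes "\<And>x. x \<in> I \<Longrightarrow> c * x \<in> I" "s \<in> ideal_prod (complex_ring S) I J"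
  shows "c * s \<in> ideal_prod (complex_ring S) I J"
  using assms(2)
proof induction
  case (prod i j)
  then show ?case using complex_ideal_prodI[of "c * i" I j J S] assms(1) by (simp add: mult.assoc)
next
  case (sum s t)
  then show ?case by (simp add: distrib_left complex_ideal_prod_add)
qed

lemma complex_ideal_prod_commute:
  "ideal_prod (complex_ring S) I J = ideal_prod (complex_ring S) J I"
proof -
  have "ideal_prod (complex_ring S) I J \<subseteq> ideal_prod (complex_ring S) J I" for I J
    by (rule complex_ideal_prod_subset)
       (metis mult.commute complex_ideal_prodI, rule complex_ideal_prod_add)
  then show ?thesis by blast
qed

lemma complex_ideal_prod_assoc:
  "ideal_prod (complex_ring S) (ideal_prod (complex_ring S) I J) K
     = ideal_prod (complex_ring S) I (ideal_prod (complex_ring S) J K)"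
proof -
  let ?p = "ideal_prod (complex_ring S)"
  have sub: "?p (?p I J) K \<subseteq> ?p I (?p J K)" for I J K
  proof (rule complex_ideal_prod_subset)
    fix x k assume "x \<in> ?p I J" and k: "k \<in> K"
    then show "x * k \<in> ?p I (?p J K)"
    proof induction
      case (prod i j)
      then show ?case using complex_ideal_prodI[of i I "j * k" "?p J K" S] complex_ideal_prodI[of j J k K S] k
        by (simp add: mult.assoc)
    next
      case (sum s t)
      then show ?case using k by (simp add: distrib_right complex_ideal_prod_add)
    qed
  qed (rule complex_ideal_prod_add)
  have "?p I (?p J K) = ?p (?p K J) I"
    using complex_ideal_prod_commute by metis
  also have "\<dots> \<subseteq> ?p K (?p J I)" by (rule sub)
  also have "\<dots> = ?p (?p I J) K" using complex_ideal_prod_commute by metis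
  finally show ?thesis using sub by blast
qed

context split_prime
begin

lemma pow_ideal_0: "pow_ideal 0 = O_F"
  unfolding pow_ideal_def using O_F_in by auto

lemma pow_ideal_add: "x \<in> pow_ideal m \<Longrightarrow> y \<in> pow_ideal m \<Longrightarrow> x + y \<in> pow_ideal m"
  by (auto simp: pow_ideal_def add_divide_distrib intro: lat_add add_in)

lemma pow_ideal_scale: "x \<in> pow_ideal m \<Longrightarrow> c \<in> O_F \<Longrightarrow> c * x \<in> pow_ideal m"
  using mult_in[OF O_F_in[of c], of "x / of_nat p ^ m"] by (auto simp: pow_ideal_def intro: O_F_mult)

lemma pow_ideal_mult:
  assumes "x \<in> pow_ideal m" "y \<in> pow_ideal k"
  shows "x * y \<in> pow_ideal (m + k)"
proof -
  have "x * y / of_nat p ^ (m + k) = (x / of_nat p ^ m) * (y / of_nat p ^ k)" by (simp add: power_add)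
  also have "\<dots> \<in> R" using assms by (intro mult_in) (auto simp: pow_ideal_def)
  finally have "x * y / of_nat p ^ (m + k) \<in> R" .
  then show ?thesis using assms by (simp add: pow_ideal_def O_F_mult)
qed

lemma pow_ideal_antimono: "m \<le> k \<Longrightarrow> pow_ideal k \<subseteq> pow_ideal m"
  unfolding pow_ideal_def using div_power_le by blast

lemma pow_ideal_gens: "of_nat p ^ m \<in> pow_ideal m" "\<theta> - of_int (root_mod m) \<in> pow_ideal m"
  unfolding pow_ideal_eq_lat by (rule lat_gen)+

text \<open>With $\pi = \theta - c$ for a root \<open>c\<close> modulo $p^{m + 1}$, the product contains
  $p^{m + 1}$, $p \pi$ and $\pi^2 = - f'(c) \pi - f(c)$. Since $f'(c)$ is prime to
  \<open>p\<close>, it contains $\pi$.\<close>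

lemma pow_ideal_Suc: "ideal_prod (complex_ring S) (pow_ideal m) (pow_ideal 1) = pow_ideal (Suc m)"
proof
  show "ideal_prod (complex_ring S) (pow_ideal m) (pow_ideal 1) \<subseteq> pow_ideal (Suc m)"
    using pow_ideal_mult[of _ m _ 1] by (intro complex_ideal_prod_subset) (auto intro: pow_ideal_add)
  let ?I = "ideal_prod (complex_ring S) (pow_ideal m) (pow_ideal 1)"
  have scale: "c * x \<in> ?I" if "c \<in> O_F" "x \<in> ?I" for c x
    using that by (intro complex_ideal_prod_scale pow_ideal_scale)
  have minus: "- x \<in> ?I" if "x \<in> ?I" for x
    using scale[of "- 1", OF _ that] O_F_int(1)[of "- 1"] by simp
  define c where "c = root_mod (Suc m)"
  define \<pi> where "\<pi> = \<theta> - of_int c"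
  have pi: "\<pi> \<in> pow_ideal (Suc m)" unfolding \<pi>_def c_def by (rule pow_ideal_gens)
  then have pi1: "\<pi> \<in> pow_ideal 1" and pim: "\<pi> \<in> pow_ideal m"
    using pow_ideal_antimono[of 1 "Suc m"] pow_ideal_antimono[of m "Suc m"] by auto
  have q1: "of_nat p \<in> pow_ideal 1" using pow_ideal_gens(1)[of 1] by simp
  have qS: "of_nat p ^ Suc m \<in> ?I"
    using complex_ideal_prodI[OF pow_ideal_gens(1)[of m] q1] by (simp add: mult.commute)
  have qpi: "of_nat p * \<pi> \<in> ?I" using complex_ideal_prodI[OF pim q1] by (simp add: mult.commute)
  have pipi: "\<pi> * \<pi> \<in> ?I" by (rule complex_ideal_prodI[OF pim pi1])
  obtain k where k: "f c = int p ^ Suc m * k"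
    using root_mod_f[of "Suc m"] unfolding c_def by (elim dvdE)
  have fc: "of_int (f c) \<in> ?I"
    using scale[OF O_F_int(1)[of k] qS] by (simp add: k mult.commute)
  have sq: "\<pi> * \<pi> = - of_int (2 * c + T) * \<pi> - of_int (f c)"
    by (simp add: \<pi>_def f_def algebra_simps theta_sq power2_eq_square)
  have "of_int (2 * c + T) * \<pi> = - (\<pi> * \<pi>) + - of_int (f c)"
    unfolding sq by (simp add: algebra_simps)
  then have der: "of_int (2 * c + T) * \<pi> \<in> ?I"
    using complex_ideal_prod_add[OF minus[OF pipi] minus[OF fc]] by simp
  have "\<not> int p dvd 2 * c + T"
  proof
    assume "int p dvd 2 * c + T"
    moreover have "int p dvd f c" using k by simp
    moreover have "T ^ 2 - 4 * n = (2 * c + T) * (2 * c + T) - 4 * f c"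
      by (simp add: f_def power2_eq_square algebra_simps)
    ultimately have "int p dvd T ^ 2 - 4 * n" by (metis dvd_diff dvd_mult)
    then show False using unramified by blast
  qed
  then have "coprime (int p) (2 * c + T)"
    using prime_p by (intro prime_imp_coprime) auto
  then obtain u v where "u * int p + v * (2 * c + T) = 1" by (metis bezout_int coprime_iff_gcd_eq_1)
  then have uv: "of_int u * of_nat p + of_int v * of_int (2 * c + T) = 1"
    by (metis of_int_1 of_int_add of_int_mult of_int_of_nat_eq)
  have "\<pi> = (of_int u * of_nat p + of_int v * of_int (2 * c + T)) * \<pi>" unfolding uv by simp
  also have "\<dots> = of_int u * (of_nat p * \<pi>) + of_int v * (of_int (2 * c + T) * \<pi>)"
    by (simp only: distrib_right mult.assoc)
  finally have "\<pi> \<in> ?I"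
    using complex_ideal_prod_add[OF scale[OF O_F_int(1)[of u] qpi] scale[OF O_F_int(1)[of v] der]] by simp
  then have "of_int i * of_nat p ^ Suc m + of_int j * \<pi> \<in> ?I" for i j
    by (intro complex_ideal_prod_add scale O_F_int qS)
  then show "pow_ideal (Suc m) \<subseteq> ?I"
    unfolding pow_ideal_eq_lat[of "Suc m"] by (auto simp: lat_def \<pi>_def c_def)
qed

end

locale split_quad_field =
  imag_quad_field T n \<theta> d + padic_cf T n \<theta> \<iota>
  for T n :: int and \<theta> :: complex and d :: int
    and \<iota> :: "complex \<Rightarrow> 'p::prime_card padic alg_closure"
begin

lemma prime_above_eq: "prime_above \<iota> d = pow_ideal 1"
proof -
  have "(\<exists>y \<in> Zp_in \<iota>. x = of_nat CARD('p) * y) \<longleftrightarrow> x / of_nat CARD('p) ^ 1 \<in> Zp_in \<iota>" for x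
    by (auto intro!: bexI[of _ "x / of_nat CARD('p)"])
  then show ?thesis unfolding prime_above_def quad_integers_eq pow_ideal_def by blast
qed

lemma pow_ideal_power_ideals_set:
  "prime_above \<iota> d [^]\<^bsub>ideals_set (quad_ring d)\<^esub> m = pow_ideal m"
proof (induction m)
  case 0
  show ?case by (simp add: ideals_set_def quad_integers_eq pow_ideal_0)
next
  case (Suc m)
  have "prime_above \<iota> d [^]\<^bsub>ideals_set (quad_ring d)\<^esub> Suc m
          = ideal_prod (quad_ring d) (pow_ideal m) (pow_ideal 1)"
    using Suc by (simp add: prime_above_eq ideals_set_def)
  then show ?case by (simp only: pow_ideal_Suc)
qed

lemma PIdl_eq: "PIdl\<^bsub>quad_ring d\<^esub> u = lat u (u * \<theta>)"
proof -
  have "PIdl\<^bsub>quad_ring d\<^esub> u = (*) u ` O_F"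
    by (auto simp: cgenideal_def quad_integers_eq mult.commute)
  then show ?thesis by (simp add: lat_scale)
qed

end

section \<open>The ideal class group\<close>

lemma int_subgroup_generator:
  fixes A :: "int set"
  assumes "0 \<in> A" "\<And>x y. x \<in> A \<Longrightarrow> y \<in> A \<Longrightarrow> x - y \<in> A"
  shows "\<exists>g\<ge>0. A = {g * k |k. True}"
proof (cases "A = {0}")
  case True
  then show ?thesis by (intro exI[of _ 0]) auto
next
  case False
  have neg: "- x \<in> A" if "x \<in> A" for x using assms(2)[OF assms(1) that] by simp
  have add: "x + y \<in> A" if "x \<in> A" "y \<in> A" for x y using assms(2)[OF that(1) neg[OF that(2)]] by simp
  obtain x where x: "x \<in> A" "x \<noteq> 0" using False assms(1) by blast
  define m where "m = (LEAST m::nat. m > 0 \<and> int m \<in> A)"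
  have "\<exists>m::nat. m > 0 \<and> int m \<in> A"
    using x neg by (intro exI[of _ "nat \<bar>x\<bar>"]) (auto simp: abs_if)
  then have m: "m > 0" "int m \<in> A" unfolding m_def by (metis (mono_tags, lifting) LeastI_ex)+
  have natmult: "int m * int k \<in> A" for k
    by (induction k) (auto simp: assms(1) distrib_left intro: add m)
  have mult: "int m * k \<in> A" for k
  proof (cases "k \<ge> 0")
    case True
    then show ?thesis using natmult[of "nat k"] by simp
  next
    case False
    then show ?thesis using neg[OF natmult[of "nat (- k)"]] by simp
  qed
  have "y \<in> {int m * k |k. True}" if "y \<in> A" for y
  proof -
    have "y mod int m = y - int m * (y div int m)" by (simp add: minus_mult_div_eq_mod)
    then have r: "y mod int m \<in> A" using assms(2)[OF that mult] by simp
    have "y mod int m = 0"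
    proof (rule ccontr)
      assume "y mod int m \<noteq> 0"
      moreover have "0 \<le> y mod int m" "y mod int m < int m" using m(1) by simp_all
      ultimately have "nat (y mod int m) > 0" "int (nat (y mod int m)) \<in> A" "nat (y mod int m) < m"
        using r by auto
      then show False using not_less_Least[of "nat (y mod int m)"] unfolding m_def by blast
    qed
    then show ?thesis by (auto simp: mod_eq_0_iff_dvd elim: dvdE)
  qed
  then show ?thesis using mult by (intro exI[of _ "int m"]) auto
qed

context imag_quad_field
begin

abbreviation fprod :: "complex set \<Rightarrow> complex set \<Rightarrow> complex set" where
  "fprod \<equiv> ideal_prod (complex_ring (quad_field d))"

lemma fractional_idealD:
  assumes "fractional_ideal d J"
  shows "J \<subseteq> quad_field d" "0 \<in> J" "J \<noteq> {0}" "\<And>x y. x \<in> J \<Longrightarrow> y \<in> J \<Longrightarrow> x + y \<in> J"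
    "\<And>a x. a \<in> O_F \<Longrightarrow> x \<in> J \<Longrightarrow> a * x \<in> J"
    "\<exists>c \<in> O_F. c \<noteq> 0 \<and> (\<forall>x \<in> J. c * x \<in> O_F)"
  using assms by (auto simp: fractional_ideal_def quad_integers_eq)

text \<open>An ideal has a basis adapted to the flag of the integers in the maximal order. Closure under
  multiplication by the generator forces the basis into the shape of a quadratic form.\<close>

lemma ideal_basis:
  assumes sub: "J \<subseteq> O_F" and ne: "x0 \<in> J" "x0 \<noteq> 0"
    and add: "\<And>x y. x \<in> J \<Longrightarrow> y \<in> J \<Longrightarrow> x + y \<in> J"
    and mult: "\<And>a x. a \<in> O_F \<Longrightarrow> x \<in> J \<Longrightarrow> a * x \<in> J"
  shows "\<exists>g a c. g > 0 \<and> a > 0 \<and> a dvd f c \<and>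
           J = (*) (of_int g) ` lat (of_int a) (\<theta> - of_int c)"
proof -
  have zero: "0 \<in> J" using mult[OF _ ne(1), of 0] lat_gen by simp
  have minus: "- x \<in> J" if "x \<in> J" for x using mult[of "- 1", OF _ that] O_F_int(1)[of "- 1"] by simp
  have diff: "x - y \<in> J" if "x \<in> J" "y \<in> J" for x y using add[OF that(1) minus[OF that(2)]] by simp
  define A where "A = {i. of_int i \<in> J}"
  define B where "B = {j. \<exists>i. of_int i + of_int j * \<theta> \<in> J}"
  have "\<exists>e\<ge>0. A = {e * k |k. True}"
  proof (rule int_subgroup_generator)
    show "x - y \<in> A" if "x \<in> A" "y \<in> A" for x y using diff that by (simp add: A_def)
  qed (simp add: A_def zero)
  then obtain e where e: "e \<ge> 0" "A = {e * k |k. True}" by blast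
  have "\<exists>g\<ge>0. B = {g * k |k. True}"
  proof (rule int_subgroup_generator)
    show "x - y \<in> B" if "x \<in> B" "y \<in> B" for x y
    proof -
      obtain i where i: "of_int i + of_int x * \<theta> \<in> J" using \<open>x \<in> B\<close> unfolding B_def by blast
      obtain i' where i': "of_int i' + of_int y * \<theta> \<in> J" using \<open>y \<in> B\<close> unfolding B_def by blast
      from diff[OF i i'] have "of_int (i - i') + of_int (x - y) * \<theta> \<in> J" by (simp add: algebra_simps)
      then show ?thesis unfolding B_def by blast
    qed
    show "0 \<in> B" unfolding B_def using zero by (auto intro!: exI[of _ 0])
  qed
  then obtain g where g: "g \<ge> 0" "B = {g * k |k. True}" by blast
  have eJ: "of_int e \<in> J" using e(2) by (auto simp: A_def set_eq_iff dest: spec[of _ e] intro: exI[of _ 1])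
  have "e \<noteq> 0"
  proof
    assume "e = 0"
    obtain N where N: "x0 * cnj x0 = of_nat N" using O_F_norm sub ne(1) by blast
    have "cnj x0 * x0 \<in> J" using sub ne(1) by (intro mult O_F_cnj) auto
    then have "int N \<in> A" using N by (simp add: A_def mult.commute)
    then have "N = 0" using e(2) \<open>e = 0\<close> by auto
    then show False using N ne(2) by simp
  qed
  then have e0: "e > 0" using e(1) by simp
  have memB: "g dvd j" if "of_int i + of_int j * \<theta> \<in> J" for i j
  proof -
    have "j \<in> B" using that by (auto simp: B_def)
    then show ?thesis using g(2) by auto
  qed
  have "of_int 0 + of_int e * \<theta> \<in> J" using mult[OF O_F_int(4) eJ] by (simp add: mult.commute)
  then have "g dvd e" by (rule memB)
  then obtain a where a: "e = g * a" by (elim dvdE)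
  have "g > 0" "a > 0" using e0 g(1) a by (auto simp: zero_less_mult_iff)
  have "g \<in> B" using g(2) by (auto intro!: exI[of _ 1])
  then obtain b where b: "of_int b + of_int g * \<theta> \<in> J" by (auto simp: B_def)
  have "\<theta> * (of_int b + of_int g * \<theta>) = of_int (- g * n) + of_int (b - g * T) * \<theta>"
    by (simp add: algebra_simps theta_sq theta_sq_left)
  then have "g dvd b - g * T" using memB mult[OF O_F_int(4) b] by metis
  then have "g dvd b" by (metis dvd_diff_commute dvd_triv_left dvd_diffD1 diff_add_cancel dvd_add)
  then obtain c' where c': "b = g * c'" by (elim dvdE)
  define c where "c = - c'"
  have gJ: "of_int g * (\<theta> - of_int c) \<in> J" using b by (simp add: c_def c' algebra_simps)
  have "cnj (\<theta> - of_int c) * (of_int g * (\<theta> - of_int c)) \<in> J"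
    by (intro mult gJ O_F_cnj lat_diff O_F_int)
  also have "cnj (\<theta> - of_int c) * (of_int g * (\<theta> - of_int c)) = of_int (g * f c)"
    unfolding of_int_mult theta_sub_norm[symmetric] by (simp only: mult_ac)
  finally have "g * f c \<in> A" by (simp add: A_def)
  then have "g * a dvd g * f c" using e(2) a by auto
  then have af: "a dvd f c" using \<open>g > 0\<close> by simp
  have "J = (*) (of_int g) ` lat (of_int a) (\<theta> - of_int c)"
    unfolding lat_scale
  proof (intro equalityI subsetI)
    fix x assume x: "x \<in> J"
    then obtain i j where ij: "x = of_int i + of_int j * \<theta>" using sub O_F_E by blast
    then have "g dvd j" using memB x by blast
    then obtain v where v: "j = g * v" by (elim dvdE)
    have "x - of_int v * (of_int g * (\<theta> - of_int c)) \<in> J"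
      by (intro diff x mult gJ O_F_int)
    also have "x - of_int v * (of_int g * (\<theta> - of_int c)) = of_int (i + v * g * c)"
      by (simp add: ij v algebra_simps)
    finally have "i + v * g * c \<in> A" by (simp add: A_def)
    then obtain k where "i + v * g * c = g * a * k" using e(2) a by auto
    then have i: "i = g * a * k - v * g * c" by simp
    show "x \<in> lat (of_int g * of_int a) (of_int g * (\<theta> - of_int c))"
      by (rule latI[of _ k _ v]) (simp add: ij i v algebra_simps)
  next
    fix x assume "x \<in> lat (of_int g * of_int a) (of_int g * (\<theta> - of_int c))"
    then obtain k v where x: "x = of_int k * (of_int g * of_int a) + of_int v * (of_int g * (\<theta> - of_int c))"
      by (rule latE)
    have "of_int g * of_int a \<in> J" using eJ a by simp
    then show "x \<in> J" unfolding x by (rule add[OF mult[OF O_F_int(1)] mult[OF O_F_int(1) gJ]])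
  qed
  then show ?thesis using \<open>g > 0\<close> \<open>a > 0\<close> af by blast
qed

text \<open>The inverse of an ideal is proportional to its conjugate. The product of the two contains
  $a$ times the coefficients of a primitive form, hence $a$ itself.\<close>

lemma lat_conj_product:
  assumes "a > 0" "a dvd f c"
  shows "ideal_prod (complex_ring S) (lat (of_int a) (\<theta> - of_int c)) (lat (of_int a) (cnj (\<theta> - of_int c)))
           = (*) (of_int a) ` O_F"
proof -
  let ?w = "\<theta> - of_int c"
  let ?K = "lat (of_int a) ?w" and ?K' = "lat (of_int a) (cnj ?w)"
  let ?I = "ideal_prod (complex_ring S) ?K ?K'"
  obtain a' where a': "f c = a * a'" using assms(2) by (elim dvdE)
  have w: "?w \<in> O_F" "cnj ?w \<in> O_F" by (intro O_F_cnj lat_diff O_F_int)+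
  have ww: "?w * cnj ?w = of_int a * of_int a'" unfolding theta_sub_norm by (simp add: a')
  have "?I \<subseteq> (*) (of_int a) ` O_F"
  proof (rule complex_ideal_prod_subset)
    fix x y assume "x \<in> ?K" "y \<in> ?K'"
    then obtain i j k l where xy: "x = of_int i * of_int a + of_int j * ?w" "y = of_int k * of_int a + of_int l * cnj ?w"
      by (elim latE)
    have "x * y = of_int a * (of_int (i * k) * of_int a + of_int (i * l) * cnj ?w + of_int (j * k) * ?w)
                  + of_int (j * l) * (?w * cnj ?w)"
      unfolding xy by (simp add: algebra_simps del: complex_cnj_diff)
    also have "\<dots> = of_int a * (of_int (i * k) * of_int a + of_int (i * l) * cnj ?w + of_int (j * k) * ?w
                  + of_int (j * l) * of_int a')"
      unfolding ww by (simp add: algebra_simps del: complex_cnj_diff)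
    finally show "x * y \<in> (*) (of_int a) ` O_F"
      by (rule image_eqI) (intro lat_add O_F_mult O_F_int w)
  next
    fix x y assume "x \<in> (*) (of_int a) ` O_F" "y \<in> (*) (of_int a) ` O_F"
    then obtain x' y' where "x' \<in> O_F" "y' \<in> O_F" "x = of_int a * x'" "y = of_int a * y'" by blast
    then show "x + y \<in> (*) (of_int a) ` O_F"
      by (intro image_eqI[of _ _ "x' + y'"]) (auto simp: distrib_left lat_add)
  qed
  moreover have "(*) (of_int a) ` O_F \<subseteq> ?I"
  proof -
    have K: "\<theta> * x \<in> ?K" if h: "x \<in> ?K" for x
    proof -
      obtain i j where x: "x = of_int i * of_int a + of_int j * ?w" using h by (rule latE)
      have "\<theta> * x = of_int i * (of_int a * ?w + of_int c * of_int a) + of_int j * (\<theta> * ?w)"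
        unfolding x by (simp add: algebra_simps)
      also have "\<theta> * ?w = - of_int (T + c) * ?w - of_int (f c)"
        by (simp add: f_def algebra_simps theta_sq power2_eq_square)
      also have "of_int i * (of_int a * ?w + of_int c * of_int a) + of_int j * (- of_int (T + c) * ?w - of_int (f c))
          = of_int (i * c - j * a') * of_int a + of_int (i * a - j * (T + c)) * ?w"
        by (simp add: a' algebra_simps)
      finally show ?thesis by (rule latI)
    qed
    have scale: "y * x \<in> ?K" if y: "y \<in> O_F" and x: "x \<in> ?K" for x y
    proof -
      obtain i j where ij: "y = of_int i + of_int j * \<theta>" using y by (rule O_F_E)
      have "of_int i * x + of_int j * (\<theta> * x) \<in> ?K" by (intro lat_add lat_int_mult K x)
      then show ?thesis by (simp add: ij algebra_simps)
    qed
    have I: "y * x \<in> ?I" if "y \<in> O_F" "x \<in> ?I" for x y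
      using that by (intro complex_ideal_prod_scale scale)
    have "\<exists>u v w. u * a + v * a' + w * (2 * c + T) = 1"
    proof -
      have "gcd a (gcd a' (2 * c + T)) = 1"
      proof (rule ccontr)
        assume "gcd a (gcd a' (2 * c + T)) \<noteq> 1"
        then have "\<not> is_unit (gcd a (gcd a' (2 * c + T)))" by simp
        moreover have "gcd a (gcd a' (2 * c + T)) \<noteq> 0" using assms(1) by simp
        ultimately obtain r where "prime r" "r dvd gcd a (gcd a' (2 * c + T))"
          using prime_divisorE by blast
        then show False using form_primitive[OF a', of r] by simp
      qed
      moreover obtain u z where "u * a + z * gcd a' (2 * c + T) = gcd a (gcd a' (2 * c + T))"
        using bezout_int by blast
      moreover obtain v w where "v * a' + w * (2 * c + T) = gcd a' (2 * c + T)"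
        using bezout_int by blast
      ultimately have "u * a + z * (v * a' + w * (2 * c + T)) = 1" by simp
      then have "u * a + (z * v) * a' + (z * w) * (2 * c + T) = 1" by (simp add: algebra_simps)
      then show ?thesis by blast
    qed
    then obtain u v w' where uvw: "u * a + v * a' + w' * (2 * c + T) = 1" by blast
    have 1: "of_int a * of_int a \<in> ?I" "of_int a * cnj ?w \<in> ?I" "?w * of_int a \<in> ?I" "?w * cnj ?w \<in> ?I"
      by (intro complex_ideal_prodI lat_gen)+
    have "of_int u * (of_int a * of_int a) + of_int v * (?w * cnj ?w)
             + of_int (- w') * (of_int a * cnj ?w + ?w * of_int a) \<in> ?I"
      by (intro complex_ideal_prod_add I O_F_int 1)
    also have "of_int u * (of_int a * of_int a) + of_int v * (?w * cnj ?w)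
             + of_int (- w') * (of_int a * cnj ?w + ?w * of_int a)
          = of_int a * (of_int u * of_int a + of_int v * of_int a' - of_int w' * (?w + cnj ?w))"
      unfolding ww by (simp add: algebra_simps del: complex_cnj_diff)
    also have "?w + cnj ?w = - of_int (2 * c + T)" by (simp add: cnj_theta)
    also have "(of_int a :: complex) * (of_int u * of_int a + of_int v * of_int a' - of_int w' * - of_int (2 * c + T))
          = of_int a * of_int (u * a + v * a' + w' * (2 * c + T))" by (simp add: algebra_simps)
    finally have "of_int a \<in> ?I" unfolding uvw by simp
    then show ?thesis using I by (auto simp: mult.commute)
  qed
  ultimately show ?thesis by blast
qed

lemma complex_ideal_prod_image:
  "ideal_prod (complex_ring S) ((*) x ` I) ((*) y ` J) = (*) (x * y) ` ideal_prod (complex_ring S) I J"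
proof
  show "ideal_prod (complex_ring S) ((*) x ` I) ((*) y ` J) \<subseteq> (*) (x * y) ` ideal_prod (complex_ring S) I J"
  proof (rule complex_ideal_prod_subset)
    fix v w assume "v \<in> (*) x ` I" "w \<in> (*) y ` J"
    then obtain i j where "i \<in> I" "j \<in> J" "v = x * i" "w = y * j" by blast
    then show "v * w \<in> (*) (x * y) ` ideal_prod (complex_ring S) I J"
      by (intro image_eqI[of _ _ "i * j"]) (auto intro: complex_ideal_prodI)
  next
    fix v w assume "v \<in> (*) (x * y) ` ideal_prod (complex_ring S) I J" "w \<in> (*) (x * y) ` ideal_prod (complex_ring S) I J"
    then show "v + w \<in> (*) (x * y) ` ideal_prod (complex_ring S) I J"
      by (auto simp: distrib_left[symmetric] intro: complex_ideal_prod_add)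
  qed
  show "(*) (x * y) ` ideal_prod (complex_ring S) I J \<subseteq> ideal_prod (complex_ring S) ((*) x ` I) ((*) y ` J)"
  proof
    fix v assume "v \<in> (*) (x * y) ` ideal_prod (complex_ring S) I J"
    then obtain s where s: "s \<in> ideal_prod (complex_ring S) I J" and v: "v = x * y * s" by blast
    from s have "x * y * s \<in> ideal_prod (complex_ring S) ((*) x ` I) ((*) y ` J)"
    proof induction
      case (prod i j)
      then have "(x * i) * (y * j) \<in> ideal_prod (complex_ring S) ((*) x ` I) ((*) y ` J)"
        by (intro complex_ideal_prodI) auto
      then show ?case by (simp add: mult_ac)
    qed (simp add: distrib_left complex_ideal_prod_add)
    then show "v \<in> ideal_prod (complex_ring S) ((*) x ` I) ((*) y ` J)" by (simp only: v)
  qed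
qed

lemma fractional_idealI:
  assumes "I \<subseteq> O_F" "x \<in> I" "x \<noteq> 0" "\<And>x y. x \<in> I \<Longrightarrow> y \<in> I \<Longrightarrow> x + y \<in> I"
    "\<And>a x. a \<in> O_F \<Longrightarrow> x \<in> I \<Longrightarrow> a * x \<in> I" "r \<in> quad_field d" "r \<noteq> 0"
  shows "fractional_ideal d ((*) r ` I)"
proof -
  obtain e z where e: "e > 0" "z \<in> O_F" "of_nat e * (1 / r) = z"
    using quad_field_denominator[OF quad_field_inverse[OF assms(6,7)]] by blast
  have zr: "z * r = of_nat e" using assms(7) by (simp add: e(3)[symmetric])
  have zero: "0 \<in> I" using assms(5)[OF lat_gen(3) assms(2)] by simp
  show ?thesis unfolding fractional_ideal_def quad_integers_eq
  proof (intro conjI ballI)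
    show "(*) r ` I \<subseteq> quad_field d" using assms(1,6) by (auto intro: quad_field_mult O_F_quad_field)
    show "0 \<in> (*) r ` I" using zero by (intro image_eqI[of _ _ 0]) auto
    show "(*) r ` I \<noteq> {0}" using assms(2,3,7) by (metis image_eqI mult_eq_0_iff singletonD)
  next
    fix v w assume "v \<in> (*) r ` I" "w \<in> (*) r ` I"
    then show "v + w \<in> (*) r ` I" by (auto simp: distrib_left[symmetric] intro: assms(4))
  next
    fix a v assume "a \<in> O_F" "v \<in> (*) r ` I"
    then show "a * v \<in> (*) r ` I" using assms(5) by (auto simp: mult.left_commute)
  next
    obtain N where N: "z * cnj z = of_nat N" using O_F_norm[OF e(2)] by blast
    have "z \<noteq> 0" using zr e(1) by auto
    have "z * (r * y) \<in> O_F" if "y \<in> I" for y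
      using that assms(1) O_F_mult[OF O_F_int(2)[of e], of y] zr by (simp add: mult.assoc[symmetric] subset_iff)
    then show "\<exists>c \<in> O_F. c \<noteq> 0 \<and> (\<forall>v \<in> (*) r ` I. c * v \<in> O_F)"
      using e(2) \<open>z \<noteq> 0\<close> by blast
  qed
qed

lemma fractional_ideal_principal:
  assumes "x \<in> quad_field d" "x \<noteq> 0"
  shows "fractional_ideal d ((*) x ` O_F)"
  by (rule fractional_idealI[of _ 1]) (auto simp: assms intro: lat_gen lat_add O_F_mult)

lemma fractional_ideal_lat:
  assumes "fractional_ideal d J"
  obtains r a c where "r \<in> quad_field d" "r \<noteq> 0" "a > 0" "a dvd f c"
    "J = (*) r ` lat (of_int a) (\<theta> - of_int c)"
proof -
  obtain z where z: "z \<in> O_F" "z \<noteq> 0" "\<forall>x \<in> J. z * x \<in> O_F" using fractional_idealD(6)[OF assms] by blast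
  obtain x0 where x0: "x0 \<in> J" "x0 \<noteq> 0" using fractional_idealD(2,3)[OF assms] by blast
  have "\<exists>g a c. g > 0 \<and> a > 0 \<and> a dvd f c \<and>
           (*) z ` J = (*) (of_int g) ` lat (of_int a) (\<theta> - of_int c)"
  proof (rule ideal_basis)
    show "(*) z ` J \<subseteq> O_F" using z(3) by blast
    show "z * x0 \<in> (*) z ` J" "z * x0 \<noteq> 0" using x0 z(2) by auto
    show "v + w \<in> (*) z ` J" if "v \<in> (*) z ` J" "w \<in> (*) z ` J" for v w
      using that fractional_idealD(4)[OF assms] by (auto simp: distrib_left[symmetric])
    show "a * v \<in> (*) z ` J" if "a \<in> O_F" "v \<in> (*) z ` J" for a v
      using that fractional_idealD(5)[OF assms] by (auto simp: mult.left_commute)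
  qed
  then obtain g a c where gac: "g > 0" "a > 0" "a dvd f c"
      "(*) z ` J = (*) (of_int g) ` lat (of_int a) (\<theta> - of_int c)" by blast
  have "J = (*) (1 / z) ` (*) z ` J" using z(2) by (simp add: image_image)
  also have "\<dots> = (*) (of_int g * (1 / z)) ` lat (of_int a) (\<theta> - of_int c)"
    unfolding gac(4) by (simp add: image_image mult_ac)
  finally have J: "J = (*) (of_int g * (1 / z)) ` lat (of_int a) (\<theta> - of_int c)" .
  have "of_int g * (1 / z) \<in> quad_field d"
    using z by (intro quad_field_mult quad_field_inverse O_F_quad_field O_F_int)
  moreover have "of_int g * (1 / z) \<noteq> 0" using gac(1) z(2) by simp
  ultimately show ?thesis using that gac(2,3) J by blast
qed

lemma fractional_ideal_prod:
  assumes I: "fractional_ideal d I" and J: "fractional_ideal d J"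
  shows "fractional_ideal d (fprod I J)"
proof -
  obtain z where z: "z \<in> O_F" "z \<noteq> 0" "\<forall>x \<in> I. z * x \<in> O_F" using fractional_idealD(6)[OF I] by blast
  obtain w where w: "w \<in> O_F" "w \<noteq> 0" "\<forall>x \<in> J. w * x \<in> O_F" using fractional_idealD(6)[OF J] by blast
  obtain x0 where x0: "x0 \<in> I" "x0 \<noteq> 0" using fractional_idealD(2,3)[OF I] by blast
  obtain y0 where y0: "y0 \<in> J" "y0 \<noteq> 0" using fractional_idealD(2,3)[OF J] by blast
  have "fprod ((*) z ` I) ((*) w ` J) \<subseteq> O_F"
    using z(3) w(3) by (intro complex_ideal_prod_subset) (auto intro: O_F_mult lat_add)
  then have "fractional_ideal d ((*) (1 / (z * w)) ` fprod ((*) z ` I) ((*) w ` J))"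
  proof (rule fractional_idealI)
    show "z * x0 * (w * y0) \<in> fprod ((*) z ` I) ((*) w ` J)" using x0 y0 by (intro complex_ideal_prodI) auto
    show "z * x0 * (w * y0) \<noteq> 0" using x0 y0 z(2) w(2) by simp
    show "a * v \<in> fprod ((*) z ` I) ((*) w ` J)" if "a \<in> O_F" "v \<in> fprod ((*) z ` I) ((*) w ` J)" for a v
    proof (rule complex_ideal_prod_scale[OF _ that(2)])
      show "a * x \<in> (*) z ` I" if "x \<in> (*) z ` I" for x
        using that \<open>a \<in> O_F\<close> fractional_idealD(5)[OF I] by (auto simp: mult.left_commute)
    qed
    show "1 / (z * w) \<in> quad_field d" using z w by (intro quad_field_inverse O_F_quad_field O_F_mult) auto
  qed (use z(2) w(2) in \<open>auto intro: complex_ideal_prod_add\<close>)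
  also have "(*) (1 / (z * w)) ` fprod ((*) z ` I) ((*) w ` J) = fprod I J"
    unfolding complex_ideal_prod_image using z(2) w(2) by (simp add: image_image)
  finally show ?thesis .
qed

lemma fractional_ideal_prod_one: "fractional_ideal d J \<Longrightarrow> fprod O_F J = J"
proof
  assume J: "fractional_ideal d J"
  show "fprod O_F J \<subseteq> J"
    using fractional_idealD[OF J] by (intro complex_ideal_prod_subset) auto
  show "J \<subseteq> fprod O_F J"
  proof
    fix x assume "x \<in> J"
    then have "1 * x \<in> fprod O_F J" by (rule complex_ideal_prodI[OF lat_gen(1)])
    then show "x \<in> fprod O_F J" by simp
  qed
qed

text \<open>The inverse is the conjugate ideal, scaled.\<close>

lemma fractional_ideal_inverse:
  assumes "fractional_ideal d J"
  shows "\<exists>J'. fractional_ideal d J' \<and> fprod J' J = O_F"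
proof -
  obtain r a c where J: "r \<in> quad_field d" "r \<noteq> 0" "a > 0" "a dvd f c"
      "J = (*) r ` lat (of_int a) (\<theta> - of_int c)"
    using fractional_ideal_lat[OF assms] by metis
  let ?w = "\<theta> - of_int c"
  define s where "s = 1 / (r * of_int a)"
  have s: "s \<in> quad_field d" "s \<noteq> 0"
    using J(1-3) quad_field_inverse[OF quad_field_mult[OF J(1) O_F_quad_field[OF O_F_int(1)[of a]]]]
    by (auto simp: s_def)
  let ?K = "lat (of_int a) (cnj ?w)"
  have Kc: "x \<in> ?K \<longleftrightarrow> cnj x \<in> lat (of_int a) ?w" for x
  proof -
    have 1: "cnj y \<in> lat (of_int a) (cnj v)" if y: "y \<in> lat (of_int a) v" for y v
    proof -
      obtain i j where "y = of_int i * of_int a + of_int j * v" using y by (rule latE)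
      then have "cnj y = of_int i * of_int a + of_int j * cnj v" by simp
      then show ?thesis by (rule latI)
    qed
    show ?thesis using 1[of x "cnj ?w"] 1[of "cnj x" ?w] by (auto simp del: complex_cnj_diff)
  qed
  have Jr: "y \<in> lat (of_int a) ?w \<longleftrightarrow> r * y \<in> J" for y using J(2,5) by auto
  have "fractional_ideal d ((*) s ` ?K)"
  proof (rule fractional_idealI[OF _ _ _ _ _ s])
    show "?K \<subseteq> O_F" by (simp add: lat_subset_iff del: complex_cnj_diff) (intro conjI O_F_int O_F_cnj lat_diff)
    show "of_int a \<in> ?K" by (rule lat_gen)
    show "of_int a \<noteq> (0 :: complex)" using J(3) by simp
    show "x + y \<in> ?K" if "x \<in> ?K" "y \<in> ?K" for x y using that by (rule lat_add)
    show "b * x \<in> ?K" if b: "b \<in> O_F" and x: "x \<in> ?K" for b x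
    proof -
      have "cnj b * (r * cnj x) \<in> J"
        using fractional_idealD(5)[OF assms] O_F_cnj[OF b] x by (simp only: Kc Jr)
      then have "r * cnj (b * x) \<in> J" by (simp add: mult_ac)
      then show ?thesis by (simp only: Kc Jr)
    qed
  qed
  moreover have "fprod ((*) s ` ?K) J = O_F"
  proof -
    have "fprod ((*) s ` ?K) J = (*) (s * r) ` fprod (lat (of_int a) ?w) ?K"
      unfolding J(5) complex_ideal_prod_image by (simp only: complex_ideal_prod_commute)
    also have "\<dots> = (*) (s * r) ` (*) (of_int a) ` O_F" by (simp only: lat_conj_product[OF J(3,4)])
    also have "\<dots> = O_F" using J(2,3) by (simp add: image_image s_def)
    finally show ?thesis .
  qed
  ultimately show ?thesis by blast
qed

lemma comm_group_fractional_ideals: "comm_group (fractional_ideal_group d)"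
proof (rule comm_groupI)
  fix J assume "J \<in> carrier (fractional_ideal_group d)"
  then show "\<exists>J' \<in> carrier (fractional_ideal_group d). J' \<otimes>\<^bsub>fractional_ideal_group d\<^esub> J = \<one>\<^bsub>fractional_ideal_group d\<^esub>"
    using fractional_ideal_inverse[of J] by (auto simp: fractional_ideal_group_def quad_integers_eq)
next
  fix I J assume "I \<in> carrier (fractional_ideal_group d)" "J \<in> carrier (fractional_ideal_group d)"
  then show "I \<otimes>\<^bsub>fractional_ideal_group d\<^esub> J \<in> carrier (fractional_ideal_group d)"
    by (simp add: fractional_ideal_group_def fractional_ideal_prod)
  show "I \<otimes>\<^bsub>fractional_ideal_group d\<^esub> J = J \<otimes>\<^bsub>fractional_ideal_group d\<^esub> I"
    unfolding fractional_ideal_group_def monoid.simps by (rule complex_ideal_prod_commute)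
next
  show "\<one>\<^bsub>fractional_ideal_group d\<^esub> \<in> carrier (fractional_ideal_group d)"
    using fractional_ideal_principal[OF O_F_quad_field[OF lat_gen(1)]]
    by (simp add: fractional_ideal_group_def quad_integers_eq)
qed (simp_all add: fractional_ideal_group_def quad_integers_eq complex_ideal_prod_assoc fractional_ideal_prod_one)

lemma principal_fractional_subgroup:
  "subgroup (principal_fractional_ideals d) (fractional_ideal_group d)"
proof -
  interpret G: comm_group "fractional_ideal_group d" by (rule comm_group_fractional_ideals)
  have mult: "(*) x ` O_F \<otimes>\<^bsub>fractional_ideal_group d\<^esub> (*) y ` O_F = (*) (x * y) ` O_F" for x y
    using fractional_ideal_prod_one[OF fractional_ideal_principal[of 1]] O_F_quad_field[OF lat_gen(1)]
    by (simp add: fractional_ideal_group_def complex_ideal_prod_image)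
  show ?thesis
  proof (rule G.subgroupI)
    show "principal_fractional_ideals d \<subseteq> carrier (fractional_ideal_group d)"
      using fractional_ideal_principal
      by (auto simp: principal_fractional_ideals_def fractional_ideal_group_def quad_integers_eq)
    show "principal_fractional_ideals d \<noteq> {}"
    proof -
      have "(*) 1 ` quad_integers d \<in> principal_fractional_ideals d"
        unfolding principal_fractional_ideals_def using O_F_quad_field[OF lat_gen(1)]
        by (intro CollectI exI[of _ 1]) simp
      then show ?thesis by blast
    qed
  next
    fix J assume "J \<in> principal_fractional_ideals d"
    then obtain x where x: "x \<in> quad_field d" "x \<noteq> 0" "J = (*) x ` O_F"
      by (auto simp: principal_fractional_ideals_def quad_integers_eq)
    have x': "1 / x \<in> quad_field d" "1 / x \<noteq> 0" using quad_field_inverse[OF x(1,2)] x(2) by simp_all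
    have "inv\<^bsub>fractional_ideal_group d\<^esub> J = (*) (1 / x) ` O_F"
    proof (rule G.inv_equality)
      show "(*) (1 / x) ` O_F \<otimes>\<^bsub>fractional_ideal_group d\<^esub> J = \<one>\<^bsub>fractional_ideal_group d\<^esub>"
        unfolding x(3) mult using x(2) by (simp add: fractional_ideal_group_def quad_integers_eq)
    next
      show "J \<in> carrier (fractional_ideal_group d)" "(*) (1 / x) ` O_F \<in> carrier (fractional_ideal_group d)"
        using fractional_ideal_principal[OF x(1,2)] fractional_ideal_principal[OF x']
        by (simp_all only: fractional_ideal_group_def x(3) partial_object.simps mem_Collect_eq)
    qed
    then show "inv\<^bsub>fractional_ideal_group d\<^esub> J \<in> principal_fractional_ideals d"
      using x' unfolding principal_fractional_ideals_def quad_integers_eq by blast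
  next
    fix I J assume "I \<in> principal_fractional_ideals d" "J \<in> principal_fractional_ideals d"
    then obtain x y where "x \<in> quad_field d" "x \<noteq> 0" "I = (*) x ` O_F" "y \<in> quad_field d" "y \<noteq> 0" "J = (*) y ` O_F"
      by (auto simp: principal_fractional_ideals_def quad_integers_eq)
    then show "I \<otimes>\<^bsub>fractional_ideal_group d\<^esub> J \<in> principal_fractional_ideals d"
      unfolding principal_fractional_ideals_def quad_integers_eq
      by (auto simp: mult intro!: exI[of _ "x * y"] quad_field_mult)
  qed
qed

end

context split_quad_field
begin

lemma fractional_pow_ideal: "fractional_ideal d (pow_ideal m)"
proof -
  have "fractional_ideal d ((*) 1 ` pow_ideal m)"
  proof (rule fractional_idealI)
    show "of_nat CARD('p) ^ m \<in> pow_ideal m" by (rule pow_ideal_gens)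
    show "1 \<in> quad_field d" using O_F_quad_field[OF lat_gen(1)] .
    show "pow_ideal m \<subseteq> O_F" by (auto simp: pow_ideal_def)
  qed (auto intro: pow_ideal_add pow_ideal_scale)
  then show ?thesis by simp
qed

lemma principal_pow_ideal_iff:
  "pow_ideal m \<in> principal_fractional_ideals d \<longleftrightarrow> (\<exists>y. is_gen y m)"
proof
  assume "pow_ideal m \<in> principal_fractional_ideals d"
  then obtain x where "pow_ideal m = (*) x ` O_F"
    by (auto simp: principal_fractional_ideals_def quad_integers_eq)
  then show "\<exists>y. is_gen y m" by (auto simp: is_gen_iff lat_scale)
next
  assume "\<exists>y. is_gen y m"
  then obtain y where y: "is_gen y m" ..
  then have "pow_ideal m = (*) y ` O_F" by (simp add: is_gen_iff lat_scale)
  moreover have "y \<in> quad_field d" using y by (auto simp: is_gen_def pow_ideal_def intro: O_F_quad_field)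
  moreover have "y \<noteq> 0" using y by (auto simp: is_gen_def)
  ultimately show "pow_ideal m \<in> principal_fractional_ideals d"
    unfolding principal_fractional_ideals_def quad_integers_eq by blast
qed

lemma ideal_class_ord_dvd_iff:
  "ideal_class_ord d (prime_above \<iota> d) dvd m \<longleftrightarrow> (\<exists>y. is_gen y m)"
proof -
  interpret G: comm_group "fractional_ideal_group d" by (rule comm_group_fractional_ideals)
  let ?P = "principal_fractional_ideals d"
  interpret P: normal ?P "fractional_ideal_group d"
    by (rule G.subgroup_imp_normal[OF principal_fractional_subgroup])
  interpret C: group "class_group d"
    unfolding class_group_def by (rule P.factorgroup_is_group)
  have mem: "pow_ideal k \<in> carrier (fractional_ideal_group d)" for k
    by (simp add: fractional_ideal_group_def fractional_pow_ideal)
  have pow: "pow_ideal 1 [^]\<^bsub>fractional_ideal_group d\<^esub> m = pow_ideal m"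
  proof (induction m)
    case 0
    show ?case by (simp add: fractional_ideal_group_def quad_integers_eq pow_ideal_0)
  next
    case (Suc m)
    then show ?case
      by (simp add: fractional_ideal_group_def pow_ideal_Suc del: One_nat_def)
  qed
  let ?c = "ideal_class d (prime_above \<iota> d)"
  have c: "?c \<in> carrier (class_group d)"
    unfolding ideal_class_def class_group_def carrier_FactGroup prime_above_eq using mem by blast
  have "?c [^]\<^bsub>class_group d\<^esub> m = ?P #>\<^bsub>fractional_ideal_group d\<^esub> pow_ideal m"
    unfolding ideal_class_def class_group_def prime_above_eq by (simp only: P.FactGroup_pow[OF mem] pow)
  moreover have "\<one>\<^bsub>class_group d\<^esub> = ?P" by (simp add: class_group_def)
  moreover have "?P #>\<^bsub>fractional_ideal_group d\<^esub> pow_ideal m = ?P \<longleftrightarrow> pow_ideal m \<in> ?P"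
    using G.coset_join1[OF _ mem P.subgroup_axioms] G.coset_join2[OF mem P.subgroup_axioms] by blast
  ultimately show ?thesis
    using C.pow_eq_id[OF c, of m] unfolding ideal_class_ord_def principal_pow_ideal_iff by simp
qed

end

section \<open>Norm-one units\<close>

context split_prime
begin

lemma is_gen_quotient:
  assumes "is_gen y m" "is_gen w m"
  shows "\<exists>\<tau> \<in> O_F. y = w * \<tau> \<and> \<tau> * cnj \<tau> = 1"
proof -
  have "y \<in> lat w (w * \<theta>)" using assms by (metis is_gen_iff lat_gen(1))
  then obtain i j where ij: "y = of_int i * w + of_int j * (w * \<theta>)" by (rule latE)
  define \<tau> where "\<tau> = of_int i + of_int j * \<theta>"
  have y: "y = w * \<tau>" unfolding ij \<tau>_def by (simp add: algebra_simps)
  have "y * cnj y = (w * cnj w) * (\<tau> * cnj \<tau>)" by (simp add: y mult_ac)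
  then have "of_nat p ^ m = of_nat p ^ m * (\<tau> * cnj \<tau>)" using assms by (simp add: is_gen_def)
  then have "\<tau> * cnj \<tau> = 1" using p_pos by simp
  then show ?thesis using y O_F_I[OF \<tau>_def] by blast
qed

lemma is_gen_mult: "is_gen x m \<Longrightarrow> is_gen y k \<Longrightarrow> is_gen (x * y) (m + k)"
  unfolding is_gen_def by (auto intro: pow_ideal_mult simp: power_add mult_ac)

lemma is_gen_power: "is_gen y m \<Longrightarrow> is_gen (y ^ k) (m * k)"
proof (induction k)
  case 0
  show ?case by (simp add: is_gen_def pow_ideal_0 O_F_int)
next
  case (Suc k)
  then show ?case using is_gen_mult[of y m "y ^ k" "m * k"] by simp
qed

text \<open>The norm of \<open>u\<close> is a power of \<open>p\<close>, so \<open>r\<close> is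
  \<open>p\<close>. But the ideal contains an element prime to the conjugate prime.\<close>

lemma is_gen_primitive:
  assumes "is_gen u m" "y \<in> O_F" "u = of_nat r * y" "prime r" "m \<ge> 1"
  shows False
proof -
  obtain N where N: "y * cnj y = of_nat N" using O_F_norm[OF assms(2)] by blast
  have "of_nat (p ^ m) = (of_nat r * of_nat r * (y * cnj y))"
    using assms(1,3) by (simp add: is_gen_def mult_ac)
  then have "of_nat (p ^ m) = (of_nat (r * r * N) :: complex)" unfolding N by simp
  then have "p ^ m = r * r * N" by (simp only: of_nat_eq_iff)
  then have "r dvd p ^ m" by simp
  then have "r dvd p" using assms(4) prime_dvd_power by blast
  then have r: "r = p" using assms(4) prime_p primes_dvd_imp_eq by blast
  let ?w = "\<theta> - of_int (root_mod m)"
  have "?w \<in> lat u (u * \<theta>)" using assms(1) pow_ideal_gens(2)[of m] by (simp add: is_gen_iff)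
  then obtain i j where "?w = of_int i * u + of_int j * (u * \<theta>)" by (rule latE)
  then have w: "?w = of_nat p * (y * (of_int i + of_int j * \<theta>))"
    unfolding assms(3) r by (simp add: algebra_simps)
  have "y * (of_int i + of_int j * \<theta>) \<in> O_F" using assms(2) O_F_I by (intro O_F_mult) auto
  then have "cnj (y * (of_int i + of_int j * \<theta>)) \<in> R" by (intro O_F_in O_F_cnj)
  moreover have "cnj ?w / of_nat p = cnj (y * (of_int i + of_int j * \<theta>))"
    unfolding w using p_pos by simp
  ultimately show False using cnj_root_mod_unit[OF assms(5)] by metis
qed

end

locale split_quad = imag_quad_field T n \<theta> d + split_prime T n \<theta> p R
  for T n :: int and \<theta> :: complex and d :: int and p :: nat and R :: "complex set"
begin

lemma root_of_unity_in_O_F: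
  assumes "x \<in> quad_field d" "x ^ k = 1" "k > 0"
  shows "x \<in> O_F"
proof -
  have "algebraic_int x"
  proof (rule algebraic_int_root)
    show "poly (Polynomial.monom 1 k) x = 1" using assms(2) by (simp add: poly_monom)
    show "\<forall>i. Polynomial.coeff (Polynomial.monom 1 k :: complex poly) i \<in> \<int>" by simp
    show "Polynomial.lead_coeff (Polynomial.monom 1 k :: complex poly) = 1" by (simp add: degree_monom_eq)
    show "Polynomial.degree (Polynomial.monom 1 k :: complex poly) > 0" using assms(3) by (simp add: degree_monom_eq)
  qed simp
  then show ?thesis using assms(1) unfolding quad_integers_eq[symmetric] quad_integers_def by simp
qed

text \<open>The norm of \<open>x\<close> is $p^N$ because roots of unity have absolute value 1. At the
  prime itself, \<open>x\<close> has half the valuation of \<open>u\<close>.\<close>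

lemma square_root_is_gen:
  assumes u: "is_gen u (2 * N)" and x: "x \<in> O_F" and k: "k > 0" "(u / x ^ 2) ^ k = 1"
  shows "is_gen x N"
proof -
  let ?q = "of_nat p :: complex"
  have x0: "x \<noteq> 0" and u0: "u \<noteq> 0" using k by (auto simp: zero_power)
  have "cmod (u / x ^ 2) ^ k = 1" using k(2) by (metis norm_one norm_power)
  then have "cmod (u / x ^ 2) = 1" using power_eq_iff_eq_base[OF k(1), of "cmod (u / x ^ 2)" 1] by simp
  then have "cmod u = (cmod x)\<^sup>2" using x0 by (simp add: norm_divide norm_power)
  moreover have "(cmod u)\<^sup>2 = (real p ^ N)\<^sup>2"
    using u by (simp add: is_gen_def is_gen_cmod power_mult[symmetric] mult.commute)
  ultimately have "((cmod x)\<^sup>2)\<^sup>2 = (real p ^ N)\<^sup>2" by simp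
  then have "(cmod x)\<^sup>2 = real p ^ N" by (rule power2_eq_imp_eq) simp_all
  then have norm: "x * cnj x = ?q ^ N" by (simp add: is_gen_cmod)
  define \<eta> where "\<eta> = x ^ 2 * (1 / u)"
  have uO: "u \<in> O_F" "u / ?q ^ (2 * N) \<in> R" using u by (auto simp: is_gen_def pow_ideal_def)
  have "\<eta> \<in> O_F"
  proof (rule root_of_unity_in_O_F[OF _ _ k(1)])
    show "\<eta> \<in> quad_field d"
      unfolding \<eta>_def by (intro quad_field_mult quad_field_inverse O_F_quad_field O_F_power x uO u0)
    have "\<eta> ^ k = (1 / (u / x ^ 2)) ^ k" by (simp add: \<eta>_def)
    also have "\<dots> = 1 / (u / x ^ 2) ^ k" by (rule power_one_over)
    finally show "\<eta> ^ k = 1" using k(2) by simp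
  qed
  then have "\<eta> * (u / ?q ^ (2 * N)) \<in> R" using uO(2) by (rule mult_in[OF O_F_in])
  also have "\<eta> * (u / ?q ^ (2 * N)) = x ^ 2 / ?q ^ (2 * N)" using u0 by (simp add: \<eta>_def)
  finally have sq: "x ^ 2 / ?q ^ (2 * N) \<in> R" .
  have "\<exists>m w. w \<in> R \<and> 1 / w \<in> R \<and> w \<noteq> 0 \<and> x = ?q ^ m * w"
  proof (rule p_val)
    show "x \<in> R" by (rule O_F_in[OF x])
    show "int p ^ N \<noteq> 0" using p_pos by simp
    fix m assume "x / ?q ^ m \<in> R"
    then have "x / ?q ^ m * cnj x \<in> R" by (rule mult_in[OF _ O_F_in[OF O_F_cnj[OF x]]])
    also have "x / ?q ^ m * cnj x = of_int (int p ^ N) / ?q ^ m" using norm by simp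
    finally show "int p ^ m dvd int p ^ N" by (rule int_dvd)
  qed
  then obtain m w where w: "w \<in> R" "1 / w \<in> R" "w \<noteq> 0" "x = ?q ^ m * w" by blast
  have "N \<le> m"
  proof (rule ccontr)
    assume "\<not> N \<le> m"
    define l where "l = N - m"
    have l: "N = m + l" "l > 0" using \<open>\<not> N \<le> m\<close> by (auto simp: l_def)
    have "x ^ 2 / ?q ^ (2 * N) * (1 / w) ^ 2 \<in> R" by (intro mult_in power_in sq w)
    also have "x ^ 2 / ?q ^ (2 * N) * (1 / w) ^ 2 = of_int 1 / ?q ^ (2 * l)"
      using w(3) p_pos by (simp add: w(4) l(1) power_mult_distrib power_divide power_add power_mult[symmetric] mult.commute distrib_right)
    finally have "int p ^ (2 * l) dvd 1" by (rule int_dvd)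
    then have "int p dvd 1" using l(2) by (metis dvd_power dvd_trans mult_pos_pos pos2)
    then show False using p_gt1 by simp
  qed
  then have "x / ?q ^ N = ?q ^ (m - N) * w" using p_pos by (simp add: w(4) power_diff)
  moreover have "?q ^ (m - N) * w \<in> R" by (intro mult_in power_in nat_in w)
  ultimately show ?thesis using x norm by (simp add: is_gen_def pow_ideal_def)
qed

text \<open>If $y$ generates $\mathfrak{p}^N$, then \<open>u\<close> and $y^2$ generate the same ideal and
  their quotient is a unit of norm one.\<close>

lemma square_root_iff:
  assumes "is_gen u (2 * N)"
  shows "(\<exists>x \<in> O_F. \<exists>k>0. (u / x ^ 2) ^ k = 1) \<longleftrightarrow> (\<exists>y. is_gen y N)"
proof
  assume "\<exists>y. is_gen y N"
  then obtain y where y: "is_gen y N" ..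
  then have "is_gen (y ^ 2) (2 * N)" using is_gen_power[OF y, of 2] by (simp add: mult.commute)
  then obtain \<tau> where t: "\<tau> \<in> O_F" "u = y ^ 2 * \<tau>" "\<tau> * cnj \<tau> = 1"
    using is_gen_quotient[OF assms] by blast
  obtain k where k: "k > 0" "\<tau> ^ k = 1" using O_F_unit_torsion[OF t(1,3)] by blast
  have "y \<noteq> 0" using y p_pos by (auto simp: is_gen_def)
  then have "(u / y ^ 2) ^ k = 1" using k(2) by (simp add: t(2))
  moreover have "y \<in> O_F" using y by (simp add: is_gen_def pow_ideal_def)
  ultimately show "\<exists>x \<in> O_F. \<exists>k>0. (u / x ^ 2) ^ k = 1" using k(1) by blast
qed (use square_root_is_gen[OF assms] in blast)

abbreviation O_inv :: "complex set" where "O_inv \<equiv> quad_integers_inv d p"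
abbreviation U1 :: "complex monoid" where "U1 \<equiv> norm_one_group d p"

lemma O_inv_E:
  assumes "x \<in> O_inv"
  obtains y m where "y \<in> O_F" "x = y / of_nat p ^ m"
  using assms by (auto simp: quad_integers_inv_def quad_integers_eq)

lemma O_inv_I: "y \<in> O_F \<Longrightarrow> x = y / of_nat p ^ m \<Longrightarrow> x \<in> O_inv"
  by (auto simp: quad_integers_inv_def quad_integers_eq)

lemma O_inv_mult: "x \<in> O_inv \<Longrightarrow> y \<in> O_inv \<Longrightarrow> x * y \<in> O_inv"
proof (elim O_inv_E)
  fix a m b k assume "a \<in> O_F" "b \<in> O_F" "x = a / of_nat p ^ m" "y = b / of_nat p ^ k"
  then show ?thesis by (intro O_inv_I[of "a * b" _ "m + k"]) (auto simp: power_add intro: O_F_mult)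
qed

lemma O_inv_cnj: "x \<in> O_inv \<Longrightarrow> cnj x \<in> O_inv"
proof (elim O_inv_E)
  fix a m assume "a \<in> O_F" "x = a / of_nat p ^ m"
  then show ?thesis by (intro O_inv_I[of "cnj a" _ m]) (auto intro: O_F_cnj)
qed

lemma O_inv_quad_field: "x \<in> O_inv \<Longrightarrow> x \<in> quad_field d"
  using quad_field_frac[of _ "p ^ _"] by (elim O_inv_E) simp

lemma carrier_U1: "carrier U1 = {x \<in> O_inv. x * cnj x = 1}"
proof -
  have "x \<in> Units (complex_ring O_inv)" if "x \<in> O_inv" "x * cnj x = 1" for x
    using that O_inv_cnj[OF that(1)] by (auto simp: Units_def mult.commute intro!: bexI[of _ "cnj x"])
  then show ?thesis
    by (auto simp: norm_one_group_def quad_norm_def units_of_def) (auto simp: Units_def)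
qed

lemma U1_simps: "x \<otimes>\<^bsub>U1\<^esub> y = x * y" "\<one>\<^bsub>U1\<^esub> = 1"
  by (simp_all add: norm_one_group_def units_of_def)

lemma comm_group_U1: "comm_group U1"
proof (rule comm_groupI)
  fix x assume "x \<in> carrier U1"
  then show "\<exists>y \<in> carrier U1. y \<otimes>\<^bsub>U1\<^esub> x = \<one>\<^bsub>U1\<^esub>"
    by (intro bexI[of _ "cnj x"]) (auto simp: carrier_U1 U1_simps O_inv_cnj mult.commute)
next
  fix x y assume "x \<in> carrier U1" "y \<in> carrier U1"
  then have xy: "x \<in> O_inv" "y \<in> O_inv" "x * cnj x = 1" "y * cnj y = 1" by (auto simp: carrier_U1)
  have "(x * y) * cnj (x * y) = (x * cnj x) * (y * cnj y)" by (simp add: mult_ac)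
  then show "x \<otimes>\<^bsub>U1\<^esub> y \<in> carrier U1" using xy by (simp add: carrier_U1 U1_simps O_inv_mult)
next
  show "\<one>\<^bsub>U1\<^esub> \<in> carrier U1"
    using O_inv_I[OF lat_gen(1), of _ 0] by (simp add: carrier_U1 U1_simps)
qed (simp_all add: U1_simps mult_ac)

lemma U1_pow: "x [^]\<^bsub>U1\<^esub> (k::nat) = x ^ k"
  by (induction k) (simp_all add: U1_simps mult.commute)

lemma U1_inv: "x \<in> carrier U1 \<Longrightarrow> inv\<^bsub>U1\<^esub> x = cnj x"
  using comm_group_U1 by (intro group.inv_equality comm_group.axioms(2))
    (auto simp: carrier_U1 U1_simps O_inv_cnj mult.commute)

lemma U1_torsion: "torsion_subgroup U1 = {x \<in> O_F. x * cnj x = 1}"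
proof (intro equalityI subsetI)
  fix x assume "x \<in> torsion_subgroup U1"
  then obtain k :: nat where k: "x \<in> O_inv" "x * cnj x = 1" "k > 0" "x ^ k = 1"
    by (auto simp: torsion_subgroup_def carrier_U1 U1_simps U1_pow)
  then show "x \<in> {x \<in> O_F. x * cnj x = 1}"
    using root_of_unity_in_O_F[OF O_inv_quad_field[OF k(1)]] by blast
next
  fix x assume "x \<in> {x \<in> O_F. x * cnj x = 1}"
  then have x: "x \<in> O_F" "x * cnj x = 1" by auto
  then show "x \<in> torsion_subgroup U1"
    using O_F_unit_torsion[OF x] O_inv_I[OF x(1), of x 0]
    by (auto simp: torsion_subgroup_def carrier_U1 U1_simps U1_pow)
qed

lemma torsion_subgroup_U1: "subgroup (torsion_subgroup U1) U1"
proof -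
  interpret G: comm_group U1 by (rule comm_group_U1)
  have sub: "torsion_subgroup U1 \<subseteq> carrier U1" by (auto simp: torsion_subgroup_def)
  show ?thesis
  proof (rule G.subgroupI[OF sub])
    show "torsion_subgroup U1 \<noteq> {}" using lat_gen(1)[of 1 \<theta>] unfolding U1_torsion by force
  next
    fix x assume "x \<in> torsion_subgroup U1"
    then show "inv\<^bsub>U1\<^esub> x \<in> torsion_subgroup U1"
      using sub U1_inv[of x] unfolding U1_torsion by (auto simp: mult.commute O_F_cnj)
  next
    fix x y assume "x \<in> torsion_subgroup U1" "y \<in> torsion_subgroup U1"
    then have "x \<in> O_F" "y \<in> O_F" "x * cnj x = 1" "y * cnj y = 1" unfolding U1_torsion by auto
    moreover have "(x * y) * cnj (x * y) = (x * cnj x) * (y * cnj y)" by (simp add: mult_ac)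
    ultimately show "x \<otimes>\<^bsub>U1\<^esub> y \<in> torsion_subgroup U1" unfolding U1_torsion by (simp add: U1_simps O_F_mult)
  qed
qed

text \<open>A norm-one unit whose denominator is a power of p in lowest terms has a primitive numerator, so
  it or its conjugate generates an even power of the prime.\<close>

lemma norm_one_unit_numerator:
  assumes "x \<in> carrier U1"
  shows "\<exists>m y. (x = y / of_nat p ^ m \<or> cnj x = y / of_nat p ^ m) \<and> is_gen y (2 * m)"
proof -
  let ?q = "of_nat p :: complex"
  have x: "x \<in> O_inv" "x * cnj x = 1" using assms by (auto simp: carrier_U1)
  define m where "m = (LEAST m. \<exists>y \<in> O_F. x = y / ?q ^ m)"
  have "\<exists>m. \<exists>y \<in> O_F. x = y / ?q ^ m" using x(1) by (elim O_inv_E) blast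
  then have "\<exists>y \<in> O_F. x = y / ?q ^ m" unfolding m_def by (rule LeastI_ex)
  then obtain y where y: "y \<in> O_F" "x = y / ?q ^ m" by blast
  have "y * cnj y = (x * cnj x) * ?q ^ (2 * m)"
    using p_pos by (simp add: y(2) power_mult power2_eq_square power_mult_distrib mult.commute)
  then have norm: "y * cnj y = ?q ^ (2 * m)" by (simp add: x(2))
  have "is_gen y (2 * m) \<or> is_gen (cnj y) (2 * m)"
  proof (cases "m = 0")
    case True
    then show ?thesis using y(1) norm by (simp add: is_gen_def pow_ideal_0)
  next
    case False
    have "\<not> (\<exists>z \<in> O_F. y = ?q * z)"
    proof
      assume "\<exists>z \<in> O_F. y = ?q * z"
      then obtain z where z: "z \<in> O_F" "y = ?q * z" by blast
      have "x = z / ?q ^ (m - 1)" using False p_pos by (simp add: y(2) z(2) power_eq_if)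
      then have "m \<le> m - 1" unfolding m_def using z(1) by (intro Least_le) blast
      then show False using False by simp
    qed
    then show ?thesis using primitive_is_gen[OF y(1) norm] by simp
  qed
  then show ?thesis
  proof
    assume "is_gen (cnj y) (2 * m)"
    moreover have "cnj x = cnj y / ?q ^ m" by (simp add: y(2))
    ultimately show ?thesis by blast
  qed (use y(2) in blast)
qed

text \<open>A norm-one unit, or its inverse, is a generator of some $\mathfrak{p}^{2m}$ divided by $p^m$.
  By hypothesis $N$ divides $m$, so the unit is a power of \<open>\<epsilon>\<close> times a root
  of unity. No positive power of \<open>\<epsilon>\<close> is a
  root of unity, because it is divisible by \<open>p\<close> in the ring \<open>R\<close>, whereas roots of unity in the field
  are units of the order and hence of \<open>R\<close>.\<close>

lemma fundamental_norm_one_unit_if_gen: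
  assumes u: "is_gen u (2 * N)" and N: "N \<ge> 1"
    and least: "\<And>y k. is_gen y (2 * k) \<Longrightarrow> N dvd k"
    and \<epsilon>: "u = of_nat p ^ N * \<epsilon>"
  shows "fundamental_norm_one_unit d p \<epsilon>"
proof -
  let ?q = "of_nat p :: complex"
  let ?T = "torsion_subgroup U1"
  interpret G: comm_group U1 by (rule comm_group_U1)
  interpret T: normal ?T U1 by (rule G.subgroup_imp_normal[OF torsion_subgroup_U1])
  interpret Q: group "U1 Mod ?T" by (rule T.factorgroup_is_group)
  have e: "\<epsilon> = u / ?q ^ N" using p_pos by (simp add: \<epsilon>)
  have uO: "u \<in> O_F" "u * cnj u = ?q ^ (2 * N)" using u by (auto simp: is_gen_def pow_ideal_def)
  have "\<epsilon> * cnj \<epsilon> = (u * cnj u) / ?q ^ (2 * N)"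
    by (simp add: e power_mult power2_eq_square power_mult_distrib mult.commute)
  then have eU: "\<epsilon> \<in> carrier U1" using O_inv_I[OF uO(1) e] p_pos by (simp add: carrier_U1 uO(2))
  have power: "\<epsilon> ^ k = u ^ k / ?q ^ (N * k)" for k by (simp add: e power_divide power_mult)
  have decomp_pos: "\<exists>k. \<exists>\<tau> \<in> ?T. x = \<epsilon> ^ k * \<tau>" if x: "x = y / ?q ^ m" "is_gen y (2 * m)" for x y m
  proof -
    obtain k where k: "m = N * k" using least[OF x(2)] by (elim dvdE)
    have "is_gen (u ^ k) (2 * m)" using is_gen_power[OF u, of k] by (simp add: k mult.assoc)
    then obtain \<tau> where t: "\<tau> \<in> O_F" "y = u ^ k * \<tau>" "\<tau> * cnj \<tau> = 1"
      using is_gen_quotient[OF x(2)] by blast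
    have "x = \<epsilon> ^ k * \<tau>" by (simp add: x(1) t(2) power k)
    then show ?thesis using t unfolding U1_torsion by blast
  qed
  have decomp: "\<exists>k::int. ?T #>\<^bsub>U1\<^esub> x = (?T #>\<^bsub>U1\<^esub> \<epsilon>) [^]\<^bsub>U1 Mod ?T\<^esub> k" if x: "x \<in> carrier U1" for x
  proof -
    have coset: "?T #>\<^bsub>U1\<^esub> z = (?T #>\<^bsub>U1\<^esub> \<epsilon>) [^]\<^bsub>U1 Mod ?T\<^esub> int k"
      if "\<tau> \<in> ?T" "z = \<epsilon> ^ k * \<tau>" for z k \<tau>
    proof -
      have tc: "\<tau> \<in> carrier U1" using that(1) T.subset by blast
      have "z = \<tau> \<otimes>\<^bsub>U1\<^esub> (\<epsilon> [^]\<^bsub>U1\<^esub> k)" using that(2) by (simp add: U1_simps U1_pow mult.commute)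
      then have "?T #>\<^bsub>U1\<^esub> z = ?T #>\<^bsub>U1\<^esub> (\<epsilon> [^]\<^bsub>U1\<^esub> k)"
        using G.coset_mult_assoc[OF T.subset tc G.nat_pow_closed[OF eU, of k]]
          G.coset_join2[OF tc T.subgroup_axioms that(1)] by simp
      then show ?thesis by (simp add: T.FactGroup_pow[OF eU] int_pow_int)
    qed
    obtain m y where my: "x = y / ?q ^ m \<or> cnj x = y / ?q ^ m" "is_gen y (2 * m)"
      using norm_one_unit_numerator[OF x] by blast
    from my(1) show ?thesis
    proof
      assume "x = y / ?q ^ m"
      then obtain k \<tau> where "\<tau> \<in> ?T" "x = \<epsilon> ^ k * \<tau>" using decomp_pos[OF _ my(2)] by blast
      from coset[OF this] show ?thesis by blast
    next
      assume "cnj x = y / ?q ^ m"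
      then obtain k \<tau> where "\<tau> \<in> ?T" "cnj x = \<epsilon> ^ k * \<tau>" using decomp_pos[OF _ my(2)] by blast
      note k = coset[OF this]
      have cx: "cnj x \<in> carrier U1" "inv\<^bsub>U1\<^esub> (cnj x) = x"
        using U1_inv[OF x] x G.inv_closed G.inv_inv by metis+
      have "?T #>\<^bsub>U1\<^esub> x = inv\<^bsub>U1 Mod ?T\<^esub> (?T #>\<^bsub>U1\<^esub> cnj x)"
        using T.inv_FactGroup[of "?T #>\<^bsub>U1\<^esub> cnj x"] T.rcos_inv[OF cx(1)] cx
        by (simp add: carrier_FactGroup)
      also have "\<dots> = (?T #>\<^bsub>U1\<^esub> \<epsilon>) [^]\<^bsub>U1 Mod ?T\<^esub> (- int k)"
        unfolding k using eU by (intro Q.int_pow_neg[symmetric]) (simp add: carrier_FactGroup)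
      finally show ?thesis by blast
    qed
  qed
  have notT: "\<epsilon> ^ k \<notin> ?T" if "k > 0" for k
  proof
    assume "\<epsilon> ^ k \<in> ?T"
    then have t: "\<epsilon> ^ k \<in> O_F" "\<epsilon> ^ k * cnj (\<epsilon> ^ k) = 1" unfolding U1_torsion by auto
    have "u ^ k \<in> pow_ideal (2 * N * k)" using is_gen_power[OF u, of k] by (simp add: is_gen_def)
    then have "u ^ k / ?q ^ (2 * N * k) \<in> R" by (simp add: pow_ideal_def)
    then have "u ^ k / ?q ^ (2 * N * k) * cnj (\<epsilon> ^ k) \<in> R"
      by (rule mult_in[OF _ O_F_in[OF O_F_cnj[OF t(1)]]])
    also have "u ^ k / ?q ^ (2 * N * k) = \<epsilon> ^ k / ?q ^ (N * k)"
      by (simp add: power mult_2 distrib_right power_add)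
    also have "\<epsilon> ^ k / ?q ^ (N * k) * cnj (\<epsilon> ^ k) = of_int 1 / ?q ^ (N * k)" using t(2) by simp
    finally have "int p ^ (N * k) dvd 1" by (rule int_dvd)
    moreover have "N * k > 0" using N that by simp
    ultimately have "int p dvd 1" by (metis dvd_power dvd_trans)
    then show False using p_gt1 by simp
  qed
  let ?E = "?T #>\<^bsub>U1\<^esub> \<epsilon>"
  have Ec: "?E \<in> carrier (U1 Mod ?T)" using eU by (simp add: carrier_FactGroup)
  have "Q.ord ?E = 0"
  proof (rule ccontr)
    assume "Q.ord ?E \<noteq> 0"
    then obtain k where k: "k > 0" "k = Q.ord ?E" by simp
    have "?E [^]\<^bsub>U1 Mod ?T\<^esub> k = \<one>\<^bsub>U1 Mod ?T\<^esub>" using Q.pow_eq_id[OF Ec, of k] k(2) by simp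
    then have "?T #>\<^bsub>U1\<^esub> (\<epsilon> ^ k) = ?T" by (simp add: T.FactGroup_pow[OF eU] U1_pow)
    then have "\<epsilon> ^ k \<in> ?T"
      using G.coset_join1[OF _ _ T.subgroup_axioms] G.nat_pow_closed[OF eU, of k] by (simp add: U1_pow)
    then show False using notT[OF k(1)] by blast
  qed
  have carrier: "carrier (U1 Mod ?T) = range (\<lambda>k::int. ?E [^]\<^bsub>U1 Mod ?T\<^esub> k)"
  proof (intro equalityI subsetI)
    fix C assume "C \<in> carrier (U1 Mod ?T)"
    then obtain x where "x \<in> carrier U1" "C = ?T #>\<^bsub>U1\<^esub> x" by (auto simp: carrier_FactGroup)
    then show "C \<in> range (\<lambda>k::int. ?E [^]\<^bsub>U1 Mod ?T\<^esub> k)" using decomp by blast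
  qed (use Q.int_pow_closed[OF Ec] in blast)
  have inj: "inj (\<lambda>k::int. ?E [^]\<^bsub>U1 Mod ?T\<^esub> k)"
  proof (rule injI)
    fix k l :: int assume "?E [^]\<^bsub>U1 Mod ?T\<^esub> k = ?E [^]\<^bsub>U1 Mod ?T\<^esub> l"
    then have "?E [^]\<^bsub>U1 Mod ?T\<^esub> (k - l) = \<one>\<^bsub>U1 Mod ?T\<^esub>"
      using Ec Q.int_pow_diff[OF Ec, of k l] Q.int_pow_closed[OF Ec, of l] Q.r_inv by simp
    then have "int (Q.ord ?E) dvd k - l" using Q.int_pow_eq_id[OF Ec] by blast
    then show "k = l" using \<open>Q.ord ?E = 0\<close> by simp
  qed
  have "(\<lambda>k::int. ?E [^]\<^bsub>U1 Mod ?T\<^esub> k) \<in> iso integer_group (U1 Mod ?T)"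
    using Q.hom_integer_group_pow[OF Ec] inj carrier by (simp add: iso_def bij_betw_def)
  then have "integer_group \<cong> U1 Mod ?T" unfolding is_iso_def by blast
  then have "U1 Mod ?T \<cong> integer_group" by (rule group.iso_sym[OF group_integer_group])
  moreover have "generate (U1 Mod ?T) {?E} = carrier (U1 Mod ?T)"
    using Q.generate_pow[OF Ec] carrier by auto
  ultimately show ?thesis unfolding fundamental_norm_one_unit_def Let_def using eU by blast
qed

end

section \<open>The period\<close>

text \<open>If \<open>h\<close> is the order of the class of the prime, the even power with exponent $2k$
  is principal exactly when \<open>h\<close> divides $2k$. The least such $k$ is \<open>h\<close> for odd
  \<open>h\<close> and $h / 2$ for even \<open>h\<close>.\<close>

lemma half_order_cases:
  fixes h N :: nat
  assumes "h dvd 2 * N" "N \<ge> 1" "\<And>k. k \<ge> 1 \<Longrightarrow> h dvd 2 * k \<Longrightarrow> N \<le> k"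
  shows "h = N \<and> odd h \<or> h = 2 * N" "h dvd 2 * k \<Longrightarrow> N dvd k"
proof -
  have h0: "h > 0" using assms(1,2) by (auto intro!: gr0I)
  show cases: "h = N \<and> odd h \<or> h = 2 * N"
  proof (cases "even h")
    case True
    then obtain h' where h': "h = 2 * h'" by (elim evenE)
    have "N \<le> h'" using assms(3)[of h'] h0 h' by simp
    moreover have "h' \<le> N" using assms(1,2) h' by (simp add: dvd_imp_le)
    ultimately show ?thesis using h' by simp
  next
    case False
    then have "coprime h 2" by simp
    then have "h dvd N" using assms(1) by (simp add: coprime_dvd_mult_right_iff)
    then have "h \<le> N" using assms(2) by (simp add: dvd_imp_le)
    moreover have "N \<le> h" using assms(3)[of h] h0 by simp
    ultimately show ?thesis using False by simp
  qed
  show "N dvd k" if "h dvd 2 * k"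
    using cases
  proof
    assume "h = N \<and> odd h"
    then have "coprime N 2" "N dvd 2 * k" using that by auto
    then show ?thesis by (simp add: coprime_dvd_mult_right_iff)
  next
    assume "h = 2 * N"
    then show ?thesis using that by simp
  qed
qed

sublocale split_quad_field \<subseteq> split_quad T n \<theta> d "CARD('p)" "Zp_in \<iota>" ..

context split_quad_field
begin

lemma cf_period:
  assumes wd: "cf_well_defined \<iota> \<theta>"
  shows
    "(\<exists>N\<ge>1. cf_x \<iota> \<theta> (N + 1) = \<theta>) \<and>
     (let N = (LEAST N. N \<ge> 1 \<and> cf_x \<iota> \<theta> (N + 1) = \<theta>);
          M = matrix_inv (cf_B \<iota> \<theta> N);
          s\<^sub>N = M $ 2 $ 1;
          t\<^sub>N = M $ 2 $ 2;
          \<epsilon> = of_rat s\<^sub>N * \<theta> + of_rat t\<^sub>N;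
          u = of_nat CARD('p) ^ N * \<epsilon>;
          \<pp> = prime_above \<iota> d
      in M \<in> SL2_Z_inv CARD('p) \<and>
         \<epsilon> \<in> quad_field d \<and>
         fundamental_norm_one_unit d CARD('p) \<epsilon> \<and>
         (\<exists>s t :: int. of_int s = of_nat CARD('p) ^ N * s\<^sub>N \<and> of_int t = of_nat CARD('p) ^ N * t\<^sub>N \<and>
            coprime s t \<and> u = of_int s * \<theta> + of_int t) \<and>
         u \<in> quad_integers d \<and>
         PIdl\<^bsub>quad_ring d\<^esub> u = \<pp> [^]\<^bsub>ideals_set (quad_ring d)\<^esub> (2 * N) \<and>
         ((\<exists>x \<in> quad_integers d. \<exists>n>0. (u / x ^ 2) ^ n = 1) \<longrightarrow> ideal_class_ord d \<pp> = N) \<and>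
         (\<not> (\<exists>x \<in> quad_integers d. \<exists>n>0. (u / x ^ 2) ^ n = 1) \<longrightarrow>
            ideal_class_ord d \<pp> = 2 * N))"
proof -
  let ?q = "of_nat CARD('p) :: complex"
  let ?ret = "\<lambda>N. N \<ge> 1 \<and> cf_x \<iota> \<theta> (N + 1) = \<theta>"
  define N where "N = (LEAST N. ?ret N)"
  have ex: "\<exists>N. ?ret N"
    using exists_principal_power[OF wd] cf_x_return_iff[OF wd] by blast
  then have N: "N \<ge> 1" "cf_x \<iota> \<theta> (N + 1) = \<theta>" unfolding N_def by (metis (mono_tags, lifting) LeastI_ex)+
  have N_le: "N \<le> k" if "?ret k" for k unfolding N_def using that by (rule Least_le)
  obtain M e where M: "M = matrix_inv (cf_B \<iota> \<theta> N)" "M \<in> SL2_Z_inv CARD('p)"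
      "acts M \<theta> e (cf_x \<iota> \<theta> (Suc N))"
      "lat (?q ^ N * e) (?q ^ N * e * cf_x \<iota> \<theta> (Suc N)) = pow_ideal (2 * N)"
    using cf_invariant[of N] by blast
  define u where "u = ?q ^ N * e"
  have e: "e = of_rat (M $ 2 $ 1) * \<theta> + of_rat (M $ 2 $ 2)" using M(3) by (simp add: acts_def)
  have u: "is_gen u (2 * N)" using M(4) N(2) by (simp add: is_gen_iff u_def)
  let ?h = "ideal_class_ord d (prime_above \<iota> d)"
  have h: "?h dvd 2 * N" using u ideal_class_ord_dvd_iff by blast
  have h_least: "N \<le> k" if "k \<ge> 1" "?h dvd 2 * k" for k
    using that ideal_class_ord_dvd_iff[of "2 * k"] cf_x_return_iff[OF wd, of k] N_le[of k] by blast
  note hN = half_order_cases[OF h N(1) h_least]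
  have fund: "fundamental_norm_one_unit d CARD('p) e"
  proof (rule fundamental_norm_one_unit_if_gen[OF u N(1) _ u_def])
    show "N dvd k" if "is_gen y (2 * k)" for y k
      using hN(2)[of k] that ideal_class_ord_dvd_iff[of "2 * k"] by blast
  qed
  have uO: "u \<in> O_F" using u by (simp add: is_gen_def pow_ideal_def)
  then obtain t s where st: "u = of_int t + of_int s * \<theta>" by (rule O_F_E)
  have "of_rat (of_int t) + of_rat (of_int s) * \<theta>
          = of_rat (of_nat CARD('p) ^ N * M $ 2 $ 2) + of_rat (of_nat CARD('p) ^ N * M $ 2 $ 1) * \<theta>"
    using st unfolding u_def e by (simp add: of_rat_mult of_rat_power algebra_simps)
  note st' = rat_basis_unique[OF this]
  have "coprime s t"
  proof (rule ccontr)
    assume "\<not> coprime s t"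
    have "\<exists>r. prime r \<and> r dvd gcd s t"
    proof (cases "gcd s t = 0")
      case True
      then show ?thesis by (auto intro: exI[of _ 2])
    next
      case False
      then show ?thesis using \<open>\<not> coprime s t\<close> prime_divisorE[of "gcd s t"] by (metis is_unit_gcd)
    qed
    then obtain r where r: "prime r" "r dvd s" "r dvd t" by auto
    obtain s' t' where "s = r * s'" "t = r * t'" using r(2,3) by (elim dvdE)
    then have "u = of_nat (nat r) * (of_int t' + of_int s' * \<theta>)"
      using prime_ge_0_int[OF r(1)] by (simp add: st algebra_simps)
    moreover have "prime (nat r)" using r(1) prime_ge_0_int[OF r(1)] by simp
    moreover have "2 * N \<ge> 1" using N(1) by simp
    ultimately show False by (rule is_gen_primitive[OF u O_F_I[OF refl]])
  qed
  moreover have "e \<in> quad_field d" by (rule quad_field_I[of _ "M $ 2 $ 2" "M $ 2 $ 1"]) (simp add: e)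
  moreover have "PIdl\<^bsub>quad_ring d\<^esub> u = prime_above \<iota> d [^]\<^bsub>ideals_set (quad_ring d)\<^esub> (2 * N)"
    unfolding PIdl_eq pow_ideal_power_ideals_set using u by (simp add: is_gen_iff)
  moreover have "(\<exists>x \<in> quad_integers d. \<exists>n>0. (u / x ^ 2) ^ n = 1) \<longleftrightarrow> ?h dvd N"
    unfolding quad_integers_eq square_root_iff[OF u] ideal_class_ord_dvd_iff ..
  moreover have "?h dvd N \<longleftrightarrow> ?h = N" using hN(1) N(1) by auto
  moreover have "?h = N \<or> ?h = 2 * N" using hN(1) by blast
  ultimately show ?thesis
    using ex M(2) fund uO st st'[symmetric]
    unfolding Let_def N_def[symmetric] M(1)[symmetric] e[symmetric] u_def[symmetric] quad_integers_eq
    by (auto simp: add.commute intro!: exI[of _ s] exI[of _ t])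
qed

end

lemma sqrt_neg_square: "d > 0 \<Longrightarrow> sqrt_neg d * sqrt_neg d = - of_int d"
proof -
  assume d: "d > 0"
  have "sqrt_neg d * sqrt_neg d = (\<i> * \<i>) * of_real (sqrt (of_int d) * sqrt (of_int d))"
    by (simp only: sqrt_neg_def of_real_mult mult_ac)
  also have "sqrt (of_int d) * sqrt (of_int d) = of_int d" using d by simp
  finally show ?thesis by simp
qed

lemma imag_quad_field_exists:
  fixes d :: int
  assumes d: "d > 0" "squarefree d"
    and theta: "\<theta> = (if [- d = 1] (mod 4) then (- 1 + sqrt_neg d) / 2 else sqrt_neg d)"
  shows "\<exists>T n. imag_quad_field T n \<theta> d"
proof (cases "[- d = 1] (mod 4)")
  case True
  then have "4 dvd - d - 1" by (simp add: cong_iff_dvd_diff)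
  then have "4 dvd - (- d - 1)" by (simp only: dvd_minus_iff)
  then have "4 dvd 1 + d" by simp
  then obtain n where n: "1 + d = 4 * n" by (elim dvdE)
  have th: "\<theta> = (- 1 + sqrt_neg d) / 2" using theta True by simp
  have "of_int d = 4 * of_int n - (1 :: complex)"
    using arg_cong[OF n, of "of_int :: int \<Rightarrow> complex"] by (simp add: algebra_simps)
  then have root: "\<theta> ^ 2 + of_int 1 * \<theta> + of_int n = 0"
    using sqrt_neg_square[OF d(1)] unfolding th by (simp add: power2_eq_square field_simps)
  have im: "Im \<theta> > 0" unfolding th using d(1) by (simp add: sqrt_neg_def)
  have "imag_quad_field 1 n \<theta> d"
  proof unfold_locales
    show "(1 = (1::int) \<and> 4 * n = 1 + d \<and> \<theta> = (- 1 + sqrt_neg d) / 2) \<or>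
       (1 = (0::int) \<and> n = d \<and> \<not> [- d = 1] (mod 4) \<and> \<theta> = sqrt_neg d)"
      by (intro disjI1 conjI refl th n[symmetric])
  qed (rule root im d | simp)+
  then show ?thesis by blast
next
  case False
  then have th: "\<theta> = sqrt_neg d" using theta by simp
  have root: "\<theta> ^ 2 + of_int 0 * \<theta> + of_int d = 0"
    unfolding th by (simp add: power2_eq_square sqrt_neg_square[OF d(1)])
  have im: "Im \<theta> > 0" unfolding th using d(1) by (simp add: sqrt_neg_def)
  have "imag_quad_field 0 d \<theta> d"
  proof unfold_locales
    show "(0 = (1::int) \<and> 4 * d = 1 + d \<and> \<theta> = (- 1 + sqrt_neg d) / 2) \<or>
       (0 = (0::int) \<and> d = d \<and> \<not> [- d = 1] (mod 4) \<and> \<theta> = sqrt_neg d)"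
      by (intro disjI2 conjI refl th False)
  qed (rule root im d | simp)+
  then show ?thesis by blast
qed

theorem theorem4p4p1:
  fixes d :: int and p :: nat
    and \<iota> :: "complex \<Rightarrow> 'p::prime_card padic alg_closure"
    and \<theta> :: complex
  assumes d: "d > 0" "squarefree d"
    and p: "prime p" "p = CARD('p)" "splits_completely p d"
    and iota: "\<iota> \<in> ring_iso ring_of_type_algebra ring_of_type_algebra"
    and theta: "\<theta> = (if [- d = 1] (mod 4) then (- 1 + sqrt_neg d) / 2 else sqrt_neg d)"
  shows
    "(d \<noteq> 3 \<longrightarrow> cf_well_defined \<iota> \<theta>) \<and>
     (cf_well_defined \<iota> \<theta> \<longrightarrow>
        (\<exists>N\<ge>1. cf_x \<iota> \<theta> (N + 1) = \<theta>) \<and>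
        (let N = (LEAST N. N \<ge> 1 \<and> cf_x \<iota> \<theta> (N + 1) = \<theta>);
             M = matrix_inv (cf_B \<iota> \<theta> N);
             s\<^sub>N = M $ 2 $ 1;
             t\<^sub>N = M $ 2 $ 2;
             \<epsilon> = of_rat s\<^sub>N * \<theta> + of_rat t\<^sub>N;
             u = of_nat p ^ N * \<epsilon>;
             \<pp> = prime_above \<iota> d
         in M \<in> SL2_Z_inv p \<and>
            \<epsilon> \<in> quad_field d \<and>
            fundamental_norm_one_unit d p \<epsilon> \<and>
            (\<exists>s t :: int. of_int s = of_nat p ^ N * s\<^sub>N \<and> of_int t = of_nat p ^ N * t\<^sub>N \<and>
               coprime s t \<and> u = of_int s * \<theta> + of_int t) \<and>
            u \<in> quad_integers d \<and>
            PIdl\<^bsub>quad_ring d\<^esub> u = \<pp> [^]\<^bsub>ideals_set (quad_ring d)\<^esub> (2 * N) \<and>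
            ((\<exists>x \<in> quad_integers d. \<exists>n>0. (u / x ^ 2) ^ n = 1) \<longrightarrow> ideal_class_ord d \<pp> = N) \<and>
            (\<not> (\<exists>x \<in> quad_integers d. \<exists>n>0. (u / x ^ 2) ^ n = 1) \<longrightarrow>
               ideal_class_ord d \<pp> = 2 * N)))"
proof -
  obtain T n where "imag_quad_field T n \<theta> d" using imag_quad_field_exists[OF d theta] by blast
  then interpret Fd: imag_quad_field T n \<theta> d .
  have split: "split_prime T n \<theta> CARD('p) (Zp_in \<iota>)"
    using Fd.split_prime_if_splits[OF iota] p(2,3) by simp
  interpret S: split_quad_field T n \<theta> d \<iota>
    by (intro split_quad_field.intro padic_cf.intro split Fd.imag_quad_field_axioms)
  have "cf_well_defined \<iota> \<theta>" if "d \<noteq> 3"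
    using Fd.no_corner[OF that] by (rule S.cf_well_defined_if_no_corner)
  then show ?thesis unfolding p(2) using S.cf_period by blast
qed

end
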